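(* Let $H:\Sigma\to\mathbb{R}$ be a double-well type potential and, for $\beta>0$, let $\mu_\beta$ be its Gibbs measure at temperature $\beta^{-1}$. Assume $H_\infty^0\le H_\infty^1$. \begin{enumerate} \item If $\tfrac12(H_\infty^1+H_\infty^0)>H_{min}^1+H_\infty^0$, then $\mu_\beta\to\delta_{1^\infty}$ weak$^*$ as $\beta\to+\infty$. \item If $H_{min}^1+H_\infty^0\ge \tfrac12(H_\infty^1+H_\infty^0)>0$, then $$\lim_{\beta\to+\infty}\mu_\beta=\frac{1}{1+c^2}\,\delta_{0^\infty}+\frac{c^2}{1+c^2}\,\delta_{1^\infty}\quad(\text{weak}^* ),$$ where $c$ is the number defined in the context. \item There exists a double-well type potential $H$ with $a_n^0=a_n^1=0$ for all $n$ and $H_\infty^0=H_\infty^1=0$, which is Lipschitz continuous with respect to the metric $d(x,y)=2^{-\min\{i\,:\,x_i\neq y_i\}}$, and a sequence $\beta_k\to+\infty$ such that $\mu_{\beta_{2k}}\to\delta_{0^\infty}$ and $\mu_{\beta_{2k+1}}\to\delta_{1^\infty}$ weak$^*$ as $k\to+\infty$ (so $\mu_\beta$ does not converge as $\beta\to+\infty$). \end{enumerate}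
   Context: $\Sigma:=\{0,1\}^{\mathbb N}$ with the product topology, $\sigma:\Sigma\to\Sigma$ the left shift $\sigma(x_0,x_1,\dots)=(x_1,x_2,\dots)$. A cylinder $[i_0\dots i_{n-1}]$ is the set of $x\in\Sigma$ with $x_j=i_j$ for $0\le j\le n-1$; $0^n$ denotes $n$ consecutive zeros, $0^\infty,1^\infty$ the two fixed points. Write $x\stackrel{n}{=}y$ if $x,y$ lie in the same cylinder of length $n$; $\mathrm{var}(H,n):=\sup\{|H(x)-H(y)|: x\stackrel{n}{=}y\}$, and $H$ has summable variation if $\sum_{n\ge1}\mathrm{var}(H,n)<\infty$. A double-well type potential is a continuous nonnegative $H:\Sigma\to\mathbb R$ with summable variation for which there are nonnegative sequences $(a_n^0),(a_n^1)$ and strictly positive sequences $(b_n^0),(b_n^1)$ ($n\ge1$) with: $H=a_n^0$ on $[00^n1]$, $H=a_n^1$ on $[11^n0]$, $H=b_n^0$ on $[01^n0]$, $H=b_n^1$ on $[10^n1]$; $\sum_n n a_n^0<\infty$, $\sum_n na_n^1<\infty$; $\sum_{k\ge1}\sup_{n\ge0}|b_k^0-b_{k+n}^0|<\infty$ and $\sum_{k\ge1}\sup_{n\ge0}|b_k^1-b_{k+n}^1|<\infty$. Set $H_n^0:=b_n^0+\sum_{k=1}^{n-1}a_k^1$, $H_n^1:=b_n^1+\sum_{k=1}^{n-1}a_k^0$, $H_{min}^0:=\inf_{n\ge1}H_n^0$, $H_{min}^1:=\inf_{n\ge1}H_n^1$, $H_\infty^0:=\lim_n b_n^0+\sum_{n\ge1}a_n^1$,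 $H_\infty^1:=\lim_n b_n^1+\sum_{n\ge1}a_n^0$. Coincidence number: $\kappa:=\mathrm{card}\{n\ge1: \tfrac12(H_\infty^1+H_\infty^0)=H_n^1+H_\infty^0\}$, and $c:=\frac{\kappa+\sqrt{\kappa^2+4}}{2}$ (largest root of $X^2=\kappa X+1$). Gibbs measure: for $\beta>0$ the transfer operator on $C^0(\Sigma)$ is $\mathcal L_\beta[\Phi](x)=e^{-\beta H(0x)}\Phi(0x)+e^{-\beta H(1x)}\Phi(1x)$ (where $ix=(i,x_0,x_1,\dots)$). For $H$ of summable variation there is a unique positive continuous $\Phi_\beta$ with $\max\Phi_\beta=1$ and $\mathcal L_\beta\Phi_\beta=\lambda_\beta\Phi_\beta$ for some $\lambda_\beta>0$, and a unique Borel probability $\nu_\beta$ with $\mathcal L_\beta^*\nu_\beta=\lambda_\beta\nu_\beta$; the Gibbs measure is $\mu_\beta:=\Phi_\beta\nu_\beta/\int\Phi_\beta\,d\nu_\beta$, a $\sigma$-invariant probability. *)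

theory Defs
  imports "HOL-Probability.Probability"
begin

text \<open>Sigma = {0,1}^N is modelled as nat \<Rightarrow> bool (False = symbol 0, True = symbol 1).\<close>

type_synonym seq = "nat \<Rightarrow> bool"

definition Sigma_top :: "seq topology" where
  "Sigma_top = product_topology (\<lambda>_. discrete_topology (UNIV::bool set)) UNIV"

definition contS :: "(seq \<Rightarrow> real) \<Rightarrow> bool" where
  "contS f \<longleftrightarrow> continuous_map Sigma_top euclideanreal f"

text \<open>Borel sigma-algebra of Sigma (= product sigma-algebra of the discrete factors).\<close>
definition Sigma_M :: "seq measure" where
  "Sigma_M = PiM UNIV (\<lambda>_. count_space (UNIV::bool set))"

definition pre :: "bool \<Rightarrow> seq \<Rightarrow> seq" where
  "pre i x = case_nat i x"

definition zeros :: seq where "zeros = (\<lambda>_. False)"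
definition ones :: seq where "ones = (\<lambda>_. True)"

definition same_cyl :: "nat \<Rightarrow> seq \<Rightarrow> seq \<Rightarrow> bool" where
  "same_cyl n x y \<longleftrightarrow> (\<forall>i<n. x i = y i)"

definition var :: "(seq \<Rightarrow> real) \<Rightarrow> nat \<Rightarrow> real" where
  "var H n = (SUP p \<in> {(x,y). same_cyl n x y}. \<bar>H (fst p) - H (snd p)\<bar>)"

definition summable_variation :: "(seq \<Rightarrow> real) \<Rightarrow> bool" where
  "summable_variation H \<longleftrightarrow> summable (\<lambda>n. var H (Suc n))"

definition summable_osc :: "(nat \<Rightarrow> real) \<Rightarrow> bool" where
  "summable_osc b \<longleftrightarrow>
     (\<forall>k\<ge>1. bdd_above (range (\<lambda>n. \<bar>b k - b (k + n)\<bar>))) \<and>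
     summable (\<lambda>k. SUP n. \<bar>b (Suc k) - b (Suc k + n)\<bar>)"

definition double_well ::
  "(seq \<Rightarrow> real) \<Rightarrow> (nat \<Rightarrow> real) \<Rightarrow> (nat \<Rightarrow> real) \<Rightarrow> (nat \<Rightarrow> real) \<Rightarrow> (nat \<Rightarrow> real) \<Rightarrow> bool" where
  "double_well H a0 a1 b0 b1 \<longleftrightarrow>
     contS H \<and> (\<forall>x. 0 \<le> H x) \<and> summable_variation H \<and>
     (\<forall>n\<ge>1. 0 \<le> a0 n \<and> 0 \<le> a1 n \<and> 0 < b0 n \<and> 0 < b1 n) \<and>
     (\<forall>n\<ge>1. \<forall>x. (\<forall>i\<le>n. \<not> x i) \<and> x (Suc n) \<longrightarrow> H x = a0 n) \<and>
     (\<forall>n\<ge>1. \<forall>x. (\<forall>i\<le>n. x i) \<and> \<not> x (Suc n) \<longrightarrow> H x = a1 n) \<and>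
     (\<forall>n\<ge>1. \<forall>x. \<not> x 0 \<and> (\<forall>i\<in>{1..n}. x i) \<and> \<not> x (Suc n) \<longrightarrow> H x = b0 n) \<and>
     (\<forall>n\<ge>1. \<forall>x. x 0 \<and> (\<forall>i\<in>{1..n}. \<not> x i) \<and> x (Suc n) \<longrightarrow> H x = b1 n) \<and>
     summable (\<lambda>n. real (Suc n) * a0 (Suc n)) \<and>
     summable (\<lambda>n. real (Suc n) * a1 (Suc n)) \<and>
     summable_osc b0 \<and> summable_osc b1"

text \<open>H_n^0 = b_n^0 + sum_{k=1}^{n-1} a_k^1, H_n^1 = b_n^1 + sum_{k=1}^{n-1} a_k^0.\<close>
definition Hn :: "(nat \<Rightarrow> real) \<Rightarrow> (nat \<Rightarrow> real) \<Rightarrow> nat \<Rightarrow> real" where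
  "Hn b a n = b n + (\<Sum>k=1..<n. a k)"

definition Hmin :: "(nat \<Rightarrow> real) \<Rightarrow> (nat \<Rightarrow> real) \<Rightarrow> real" where
  "Hmin b a = (INF n \<in> {1..}. Hn b a n)"

definition Hinf :: "(nat \<Rightarrow> real) \<Rightarrow> (nat \<Rightarrow> real) \<Rightarrow> real" where
  "Hinf b a = lim b + (\<Sum>n. a (Suc n))"

text \<open>Coincidence number kappa and c (largest root of X^2 = kappa X + 1).
  Here H_inf^0 = Hinf b0 a1, H_inf^1 = Hinf b1 a0, H_n^1 = Hn b1 a0 n.\<close>
definition kappa :: "(nat \<Rightarrow> real) \<Rightarrow> (nat \<Rightarrow> real) \<Rightarrow> (nat \<Rightarrow> real) \<Rightarrow> (nat \<Rightarrow> real) \<Rightarrow> nat" where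
  "kappa a0 a1 b0 b1 = card {n. 1 \<le> n \<and>
     (Hinf b1 a0 + Hinf b0 a1) / 2 = Hn b1 a0 n + Hinf b0 a1}"

definition cnum :: "nat \<Rightarrow> real" where
  "cnum k = (real k + sqrt (real k ^ 2 + 4)) / 2"

definition transfer :: "(seq \<Rightarrow> real) \<Rightarrow> real \<Rightarrow> (seq \<Rightarrow> real) \<Rightarrow> seq \<Rightarrow> real" where
  "transfer H \<beta> \<Phi> x =
     exp (- \<beta> * H (pre False x)) * \<Phi> (pre False x) + exp (- \<beta> * H (pre True x)) * \<Phi> (pre True x)"

text \<open>mu is the Gibbs measure of H at inverse temperature beta: mu = Phi nu / int Phi dnu where
  Phi is the positive continuous eigenfunction with max 1 and nu the eigenprobability of the dual
  operator (both unique for H of summable variation).\<close>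
definition gibbs :: "(seq \<Rightarrow> real) \<Rightarrow> real \<Rightarrow> seq measure \<Rightarrow> bool" where
  "gibbs H \<beta> \<mu> \<longleftrightarrow> (\<exists>\<Phi> lam \<nu>.
     0 < lam \<and> contS \<Phi> \<and> (\<forall>x. 0 < \<Phi> x) \<and> (\<forall>x. \<Phi> x \<le> 1) \<and> (\<exists>x. \<Phi> x = 1) \<and>
     (\<forall>x. transfer H \<beta> \<Phi> x = lam * \<Phi> x) \<and>
     prob_space \<nu> \<and> sets \<nu> = sets Sigma_M \<and>
     (\<forall>f. contS f \<longrightarrow> integral\<^sup>L \<nu> (transfer H \<beta> f) = lam * integral\<^sup>L \<nu> f) \<and>
     \<mu> = density \<nu> (\<lambda>x. ennreal (\<Phi> x / integral\<^sup>L \<nu> \<Phi>)))"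

text \<open>Weak-* convergence of measures mu t along filter F to the (positive linear) functional L;
  L f = f(p) represents a Dirac mass, L f = p f(u) + q f(v) a convex combination of Dirac masses.\<close>
definition weak_star :: "('i \<Rightarrow> seq measure) \<Rightarrow> ((seq \<Rightarrow> real) \<Rightarrow> real) \<Rightarrow> 'i filter \<Rightarrow> bool" where
  "weak_star \<mu> L F \<longleftrightarrow> (\<forall>f. contS f \<longrightarrow> ((\<lambda>t. integral\<^sup>L (\<mu> t) f) \<longlongrightarrow> L f) F)"

definition dS :: "seq \<Rightarrow> seq \<Rightarrow> real" where
  "dS x y = (if x = y then 0 else (1/2) ^ (LEAST i. x i \<noteq> y i))"

end

theory Submission
  imports Defs "HOL-Real_Asymp.Real_Asymp"
begin

text \<open>
  Along a maximal run of equal symbols the eigenfunction equation and its dual are a renewal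
  recursion: with \<open>z = 1 / \<lambda>\<close>, a run of zeros of length \<open>n\<close> carries the weight \<open>z^n exp (- \<beta> H_n^1)\<close>
  and a run of ones the weight \<open>z^n exp (- \<beta> H_n^0)\<close>. If \<open>F_0\<close> and \<open>F_1\<close> are the two total weights, then
  \<open>z\<close> is determined by \<open>F_0 F_1 = 1\<close>, and by invariance the masses of the cylinders \<open>[0]\<close> and \<open>[1]\<close> are
  proportional to the mean run lengths \<open>G_0 / F_0\<close> and \<open>G_1 / F_1\<close>; the mass of the transition
  cylinders tends to zero, so only this ratio matters. As \<open>\<beta>\<close> grows, \<open>z\<close> tends to 1, and with
  \<open>\<epsilon> = (1 - z) / z\<close> and \<open>X = exp (- \<beta> (H_\<infinity>^0 + H_\<infinity>^1) / 2) / \<epsilon>\<close> the equation \<open>F_0 F_1 = 1\<close> becomes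
  \<open>X (X + \<kappa>) = 1\<close> up to vanishing errors, whence \<open>X\<close> tends to \<open>1 / c\<close> and the mass ratio to \<open>X\<^sup>2\<close>; if some
  \<open>H_n^1\<close> lies below \<open>(H_\<infinity>^1 - H_\<infinity>^0) / 2\<close>, the short runs of zeros dominate and the ratio tends to zero.
  When all limits vanish, step functions \<open>b_n^0\<close> and \<open>b_n^1\<close> with interlaced, rapidly growing steps
  make either well the one with the much longer runs, along suitable sequences of \<open>\<beta>\<close>.
\<close>

section \<open>The topology of the full shift\<close>

text \<open>The recursion closes because \<open>\<Phi>\<close> is constant on each of the cylinders
  [01] and [10], where one run ends and the next begins. The continuity of \<open>\<Phi>\<close>
  forces this, and it gives the run lengths under the Gibbs measure a law proportional to the
  weights. The limits H_\<infinity>^1 and H_\<infinity>^0 may differ, so the two total weights may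
  live on different exponential scales. The constraint F_0 F_1 = 1 survives multiplying F_0 by exp
  (\<beta> \<theta>) and F_1 by exp (- \<beta> \<theta>), where \<theta> = (H_\<infinity>^1 -
  H_\<infinity>^0) / 2, and after this tilt the long runs of either symbol weigh X. Each of the
  \<kappa> lengths with H_n^1 = \<theta> adds 1 to the tilted F_0. Being bounded, these lengths do
  not show in \<epsilon> G_0, so \<epsilon> G_0 / F_0 is close to X / (X + \<kappa>) = X^2 while
  \<epsilon> G_1 / F_1 is close to 1: hence the square. When short runs dominate, the tilted F_1
  tends to 0, and errors must be small relative to it. In the oscillating example the existence of
  Gibbs measures is part of the claim; the vanishing a_n allow explicit formulas for the
  eigenfunction and the eigenmeasure.\<close>

definition cyl_uc :: "(seq \<Rightarrow> real) \<Rightarrow> bool" where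
  "cyl_uc f \<longleftrightarrow> (\<forall>e>0. \<exists>n. \<forall>x y. same_cyl n x y \<longrightarrow> \<bar>f x - f y\<bar> < e)"

lemma same_cyl_mono: "same_cyl n x y \<Longrightarrow> m \<le> n \<Longrightarrow> same_cyl m x y"
  by (auto simp: same_cyl_def)

lemma same_cyl_refl [simp]: "same_cyl n x x"
  by (simp add: same_cyl_def)

lemma topspace_Sigma_top [simp]: "topspace Sigma_top = UNIV"
  by (auto simp: Sigma_top_def)

lemma openin_Sigma_top:
  "openin Sigma_top U \<longleftrightarrow> (\<forall>x\<in>U. \<exists>n. \<forall>y. same_cyl n x y \<longrightarrow> y \<in> U)"
proof
  assume U: "openin Sigma_top U"
  show "\<forall>x\<in>U. \<exists>n. \<forall>y. same_cyl n x y \<longrightarrow> y \<in> U"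
  proof
    fix x assume "x \<in> U"
    from U[unfolded Sigma_top_def openin_product_topology_alt, rule_format, OF this]
    obtain V where V: "finite {i. V i \<noteq> (UNIV::bool set)}" "x \<in> Pi\<^sub>E UNIV V" "Pi\<^sub>E UNIV V \<subseteq> U"
      by auto
    obtain n where n: "\<And>i. V i \<noteq> UNIV \<Longrightarrow> i < n"
      using finite_nat_set_iff_bounded[THEN iffD1, OF V(1)] by blast
    have "y \<in> U" if "same_cyl n x y" for y
    proof -
      have "y i \<in> V i" for i
      proof (cases "V i = UNIV")
        case False
        then have "x i = y i" using n[OF False] that by (simp add: same_cyl_def)
        then show ?thesis using V(2) PiE_mem[OF V(2), of i] by simp
      qed simp
      then show ?thesis by (intro subsetD[OF V(3)] PiE_I) simp_all
    qed
    then show "\<exists>n. \<forall>y. same_cyl n x y \<longrightarrow> y \<in> U" by blast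
  qed
next
  assume R: "\<forall>x\<in>U. \<exists>n. \<forall>y. same_cyl n x y \<longrightarrow> y \<in> U"
  show "openin Sigma_top U"
    unfolding Sigma_top_def openin_product_topology_alt
  proof
    fix x assume "x \<in> U"
    with R obtain n where n: "\<And>y. same_cyl n x y \<Longrightarrow> y \<in> U" by blast
    let ?V = "\<lambda>i. if i < n then {x i} else (UNIV::bool set)"
    have "finite {i \<in> UNIV. ?V i \<noteq> topspace (discrete_topology UNIV)}"
      by (rule finite_subset[of _ "{..<n}"]) (auto split: if_splits)
    moreover have "Pi\<^sub>E UNIV ?V \<subseteq> U"
      using n by (force simp: PiE_iff same_cyl_def split: if_splits)
    ultimately show "\<exists>V. finite {i \<in> UNIV. V i \<noteq> topspace (discrete_topology (UNIV::bool set))} \<and>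
        (\<forall>i\<in>UNIV. openin (discrete_topology UNIV) (V i)) \<and> x \<in> Pi\<^sub>E UNIV V \<and> Pi\<^sub>E UNIV V \<subseteq> U"
      by (intro exI[of _ ?V]) auto
  qed
qed

lemma compact_Sigma_top: "compact_space Sigma_top"
  by (simp add: Sigma_top_def compact_space_product_topology compact_space_discrete_topology)

text \<open>A Lebesgue number argument: finitely many cylinders on which \<open>f\<close> stays
  within e / 2 of its value at the centre cover the space, and the largest of their depths works
  everywhere. From here on continuity is handled through cylinder depths.\<close>

lemma contS_iff_cyl_uc: "contS f \<longleftrightarrow> cyl_uc f"
proof
  assume f: "contS f"
  show "cyl_uc f"
    unfolding cyl_uc_def
  proof (intro allI impI)
    fix e :: real assume e: "e > 0"
    have "\<exists>n. \<forall>y. same_cyl n x y \<longrightarrow> \<bar>f x - f y\<bar> < e / 2" for x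
    proof -
      have "openin Sigma_top {y \<in> topspace Sigma_top. f y \<in> ball (f x) (e/2)}"
        using f unfolding contS_def by (rule openin_continuous_map_preimage) simp
      from this[unfolded openin_Sigma_top, rule_format, of x] e show ?thesis
        by (simp add: dist_real_def)
    qed
    then obtain N where N: "\<And>x y. same_cyl (N x) x y \<Longrightarrow> \<bar>f x - f y\<bar> < e / 2" by metis
    define U where "U = (\<lambda>x. {y. same_cyl (N x) x y})"
    have "openin Sigma_top (U x)" for x
      unfolding openin_Sigma_top U_def by (auto simp: same_cyl_def)
    moreover have "x \<in> U x" for x by (simp add: U_def)
    ultimately have "\<exists>\<F>. finite \<F> \<and> \<F> \<subseteq> range U \<and> UNIV \<subseteq> \<Union>\<F>"
      by (intro compactinD[OF compact_Sigma_top[unfolded compact_space_def topspace_Sigma_top]]) blast+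
    then obtain X where X: "finite X" "UNIV \<subseteq> (\<Union>x\<in>X. U x)"
      by (metis finite_subset_image)
    obtain n where n: "\<And>x. x \<in> X \<Longrightarrow> N x \<le> n"
      using X(1) by (meson Max_ge finite_imageI imageI)
    have "\<bar>f x - f y\<bar> < e" if "same_cyl n x y" for x y
    proof -
      obtain w where w: "w \<in> X" "same_cyl (N w) w x" using X(2) by (auto simp: U_def)
      then have "same_cyl (N w) w y" using that n[of w] by (auto simp: same_cyl_def)
      with N w show ?thesis by (smt (verit) field_sum_of_halves)
    qed
    then show "\<exists>n. \<forall>x y. same_cyl n x y \<longrightarrow> \<bar>f x - f y\<bar> < e" by blast
  qed
next
  assume f: "cyl_uc f"
  show "contS f"
    unfolding contS_def continuous_map
  proof (intro conjI allI impI)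
    fix U assume U: "openin euclideanreal U"
    show "openin Sigma_top {x \<in> topspace Sigma_top. f x \<in> U}"
      unfolding openin_Sigma_top
    proof
      fix x assume "x \<in> {x \<in> topspace Sigma_top. f x \<in> U}"
      then obtain e where e: "e > 0" "ball (f x) e \<subseteq> U" using U by (auto simp: open_contains_ball)
      then obtain n where "\<And>y. same_cyl n x y \<Longrightarrow> \<bar>f x - f y\<bar> < e" using f unfolding cyl_uc_def by blast
      with e show "\<exists>n. \<forall>y. same_cyl n x y \<longrightarrow> y \<in> {x \<in> topspace Sigma_top. f x \<in> U}"
        by (auto simp: dist_real_def subset_iff)
    qed
  qed auto
qed

lemma contS_uniform:
  assumes "contS f" "e > 0"
  obtains n where "\<And>x y. same_cyl n x y \<Longrightarrow> \<bar>f x - f y\<bar> < e"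
  using assms unfolding contS_iff_cyl_uc cyl_uc_def by blast

lemma contS_attains_inf:
  assumes "contS f" obtains x where "\<And>y. f x \<le> f y"
proof -
  have "compactin euclideanreal (f ` topspace Sigma_top)"
    using compact_Sigma_top assms unfolding contS_def compact_space_def by (rule image_compactin)
  then obtain x where "\<forall>y. f x \<le> f y"
    using compact_attains_inf[of "range f"] by auto
  with that show ?thesis by blast
qed

lemma contS_uminus: "contS f \<Longrightarrow> contS (\<lambda>x. - f x)"
  by (simp add: contS_def continuous_map_minus)

lemma contS_attains_sup:
  assumes "contS f" obtains x where "\<And>y. f y \<le> f x"
  using contS_attains_inf[OF contS_uminus[OF assms]] by force

lemma contS_bounded:
  assumes "contS f" obtains C where "\<And>x. \<bar>f x\<bar> \<le> C"
proof -
  obtain a where a: "\<And>y. f a \<le> f y" using contS_attains_inf[OF assms] by blast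
  obtain b where b: "\<And>y. f y \<le> f b" using contS_attains_sup[OF assms] by blast
  have "\<bar>f x\<bar> \<le> max \<bar>f a\<bar> \<bar>f b\<bar>" for x using a[of x] b[of x] by auto
  with that show ?thesis by blast
qed

lemma contS_mult: "contS f \<Longrightarrow> contS g \<Longrightarrow> contS (\<lambda>x. f x * g x)"
  by (simp add: contS_def continuous_map_real_mult)

lemma contS_add: "contS f \<Longrightarrow> contS g \<Longrightarrow> contS (\<lambda>x. f x + g x)"
  by (simp add: contS_def continuous_map_add)

lemma contS_const [simp]: "contS (\<lambda>x. c)"
  by (simp add: contS_def)

lemma contS_cyl:
  assumes "\<And>x y. same_cyl n x y \<Longrightarrow> f x = f y" shows "contS f"
  unfolding contS_iff_cyl_uc cyl_uc_def using assms by force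

lemma contS_real_compose:
  assumes "contS f" "continuous_on UNIV g" shows "contS (\<lambda>x. g (f x))"
  using continuous_map_compose[of Sigma_top euclideanreal f euclideanreal g] assms
  by (simp add: contS_def o_def)

lemma contS_pre: "contS f \<Longrightarrow> contS (\<lambda>x. f (pre i x))"
  unfolding contS_iff_cyl_uc cyl_uc_def
proof (intro allI impI)
  fix e :: real assume "\<forall>e>0. \<exists>n. \<forall>x y. same_cyl n x y \<longrightarrow> \<bar>f x - f y\<bar> < e" "e > 0"
  then obtain n where n: "\<And>x y. same_cyl n x y \<Longrightarrow> \<bar>f x - f y\<bar> < e" by blast
  show "\<exists>n. \<forall>x y. same_cyl n x y \<longrightarrow> \<bar>f (pre i x) - f (pre i y)\<bar> < e"
    by (intro exI[of _ n] allI impI n) (auto simp: same_cyl_def pre_def split: nat.splits)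
qed

lemma contS_shift: "contS f \<Longrightarrow> contS (\<lambda>x. f (\<lambda>k. x (Suc k)))"
  unfolding contS_iff_cyl_uc cyl_uc_def
proof (intro allI impI)
  fix e :: real assume "\<forall>e>0. \<exists>n. \<forall>x y. same_cyl n x y \<longrightarrow> \<bar>f x - f y\<bar> < e" "e > 0"
  then obtain n where n: "\<And>x y. same_cyl n x y \<Longrightarrow> \<bar>f x - f y\<bar> < e" by blast
  show "\<exists>n. \<forall>x y. same_cyl n x y \<longrightarrow> \<bar>f (\<lambda>k. x (Suc k)) - f (\<lambda>k. y (Suc k))\<bar> < e"
    by (intro exI[of _ "Suc n"] allI impI n) (auto simp: same_cyl_def)
qed

lemma space_Sigma_M [simp]: "space Sigma_M = UNIV"
  by (auto simp: Sigma_M_def space_PiM)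

lemma measurable_coord: "(\<lambda>x. x n) \<in> measurable Sigma_M (count_space UNIV)"
  unfolding Sigma_M_def by measurable

text \<open>\<open>tr n\<close> keeps the first n symbols and pads with \<open>False\<close>. It has
  finite range, so \<open>f (tr n x)\<close> is measurable for the product sigma-algebra, and
  uniform continuity makes it converge to \<open>f x\<close>.\<close>

lemma contS_measurable:
  assumes "contS f" shows "f \<in> borel_measurable Sigma_M"
proof (rule borel_measurable_LIMSEQ_real)
  define tr :: "nat \<Rightarrow> seq \<Rightarrow> seq" where "tr = (\<lambda>n x k. k < n \<and> x k)"
  have cyl: "same_cyl n (tr n x) x" for n x by (simp add: same_cyl_def tr_def)
  show "(\<lambda>n. f (tr n x)) \<longlonglongrightarrow> f x" for x
    unfolding LIMSEQ_iff
  proof (intro allI impI)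
    fix e :: real assume "e > 0"
    then obtain n where n: "\<And>x y. same_cyl n x y \<Longrightarrow> \<bar>f x - f y\<bar> < e" using contS_uniform[OF assms] by blast
    show "\<exists>no. \<forall>n\<ge>no. norm (f (tr n x) - f x) < e"
      using n same_cyl_mono[OF cyl] by (auto intro!: exI[of _ n])
  qed
  show "(\<lambda>x. f (tr n x)) \<in> borel_measurable Sigma_M" for n
  proof (rule measurable_compose[of _ _ "count_space (range (tr n))"])
    have fin: "finite (range (tr n))"
    proof (rule finite_subset)
      show "range (tr n) \<subseteq> (\<lambda>A k. k \<in> A) ` Pow {..<n}"
      proof
        fix u assume "u \<in> range (tr n)"
        then obtain x where "u = tr n x" by blast
        then have "u = (\<lambda>k. k \<in> {k. k < n \<and> x k})" by (auto simp: tr_def)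
        then show "u \<in> (\<lambda>A k. k \<in> A) ` Pow {..<n}" by blast
      qed
    qed simp
    show "tr n \<in> measurable Sigma_M (count_space (range (tr n)))"
    proof (subst measurable_count_space_eq2[OF fin], intro conjI ballI)
      fix u assume "u \<in> range (tr n)"
      then have "tr n -` {u} \<inter> space Sigma_M = (\<Inter>k\<in>{..<n}. {x \<in> space Sigma_M. x k = u k}) \<inter> space Sigma_M"
        by (auto simp: tr_def fun_eq_iff)
      also have "\<dots> \<in> sets Sigma_M"
      proof (cases "n = 0")
        case False
        have "{x \<in> space Sigma_M. x k = u k} \<in> sets Sigma_M" for k
          using measurable_sets[OF measurable_coord[of k], of "{u k}"] by (simp add: vimage_def)
        then show ?thesis using False sets.top[of Sigma_M] by (intro sets.Int sets.finite_INT) auto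
      qed (use sets.top[of Sigma_M] in simp)
      finally show "tr n -` {u} \<inter> space Sigma_M \<in> sets Sigma_M" .
    qed auto
  qed auto
qed

section \<open>Renewal structure of a Gibbs measure\<close>

definition run :: "bool \<Rightarrow> nat \<Rightarrow> seq \<Rightarrow> seq" where
  "run i n y = (\<lambda>k. if k < n then i else y (k - n))"

definition left_shift :: "seq \<Rightarrow> seq" where
  "left_shift x = (\<lambda>k. x (Suc k))"

lemma run_0 [simp]: "run i 0 y = y"
  by (simp add: run_def)

lemma pre_run: "pre i (run i n y) = run i (Suc n) y"
  by (auto simp: pre_def run_def fun_eq_iff split: nat.splits)

lemma pre_nth [simp]: "pre i x 0 = i" "pre i x (Suc k) = x k"
  by (simp_all add: pre_def)

lemma shift_pre [simp]: "left_shift (pre i x) = x"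
  by (simp add: left_shift_def)

lemma shift_nth [simp]: "left_shift x k = x (Suc k)"
  by (simp add: left_shift_def)

definition run_cyl :: "bool \<Rightarrow> nat \<Rightarrow> seq set" where
  "run_cyl i n = {x. (\<forall>k<n. x k = i) \<and> x n = (\<not> i)}"

definition block :: "bool \<Rightarrow> nat \<Rightarrow> seq set" where
  "block i n = {x. \<forall>k<n. x k = i}"

definition wsum :: "(nat \<Rightarrow> real) \<Rightarrow> real \<Rightarrow> real \<Rightarrow> real" where
  "wsum h \<beta> z = (\<Sum>n. z ^ Suc n * exp (- \<beta> * h n))"

text \<open>This is \<open>z\<close> times the derivative of \<open>wsum h \<beta>\<close> at
  \<open>z\<close>, so the quotient of \<open>wmean\<close> by \<open>wsum\<close> is the mean run
  length when a run of length n + 1 has probability proportional to its weight.\<close>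

definition wmean :: "(nat \<Rightarrow> real) \<Rightarrow> real \<Rightarrow> real \<Rightarrow> real" where
  "wmean h \<beta> z = (\<Sum>n. real (Suc n) * (z ^ Suc n * exp (- \<beta> * h n)))"

text \<open>\<open>A i n\<close> and \<open>B i n\<close> are \<open>a_n^i\<close> and \<open>b_n^i\<close>, with \<open>False\<close> for the symbol 0 and \<open>True\<close> for 1.\<close>

locale potential =
  fixes H :: "seq \<Rightarrow> real" and A B :: "bool \<Rightarrow> nat \<Rightarrow> real" and Binf :: "bool \<Rightarrow> real"
  assumes contH: "contS H" and H_nonneg: "0 \<le> H x"
    and H_A: "\<lbrakk>1 \<le> n; \<forall>k\<le>n. x k = i; x (Suc n) = (\<not> i)\<rbrakk> \<Longrightarrow> H x = A i n"
    and H_B: "\<lbrakk>1 \<le> n; x 0 = i; \<forall>k\<in>{1..n}. x k = (\<not> i); x (Suc n) = i\<rbrakk> \<Longrightarrow> H x = B i n"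
    and A_nonneg: "1 \<le> n \<Longrightarrow> 0 \<le> A i n"
    and B_pos: "1 \<le> n \<Longrightarrow> 0 < B i n"
    and summable_A: "summable (\<lambda>n. real (Suc n) * A i (Suc n))"
    and summable_B: "summable (\<lambda>n. \<bar>B i (Suc n) - Binf i\<bar>)"
begin

text \<open>
  The cost of a run of \<open>n + 1\<close> symbols \<open>i\<close>; hence \<open>cost False n\<close> is \<open>H_(n+1)^1\<close> and \<open>cost True n\<close> is
  \<open>H_(n+1)^0\<close>. Run lengths are shifted by one throughout, so that sequences start at 0.
\<close>

definition cost :: "bool \<Rightarrow> nat \<Rightarrow> real" where
  "cost i n = B (\<not> i) (Suc n) + (\<Sum>k=1..<Suc n. A i k)"

lemma cost_pos: "0 < cost i n"
  unfolding cost_def using A_nonneg by (intro add_pos_nonneg B_pos sum_nonneg) auto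

lemma A_tendsto_0: "(\<lambda>n. A i (Suc n)) \<longlonglongrightarrow> 0"
proof (rule Lim_null_comparison)
  show "\<forall>\<^sub>F n in sequentially. norm (A i (Suc n)) \<le> real (Suc n) * A i (Suc n)"
  proof (intro always_eventually allI)
    fix n
    have "0 \<le> A i (Suc n)" by (rule A_nonneg) simp
    moreover from this have "1 * A i (Suc n) \<le> real (Suc n) * A i (Suc n)" by (intro mult_right_mono) auto
    ultimately show "norm (A i (Suc n)) \<le> real (Suc n) * A i (Suc n)" by simp
  qed
  show "(\<lambda>n. real (Suc n) * A i (Suc n)) \<longlonglongrightarrow> 0"
    using summable_A by (rule summable_LIMSEQ_zero)
qed

text \<open>Points that begin with more and more symbols i before the first change approach the
  fixed point, and \<open>H\<close> takes there the values a_n, which tend to 0. This normalisation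
  is what forces the eigenvalue above 1.\<close>

lemma H_const_0: "H (\<lambda>_. i) = 0"
proof (rule LIMSEQ_unique[OF _ A_tendsto_0])
  show "(\<lambda>n. A i (Suc n)) \<longlonglongrightarrow> H (\<lambda>_. i)"
    unfolding LIMSEQ_iff
  proof (intro allI impI)
    fix e :: real assume "e > 0"
    then obtain n where n: "\<And>x y. same_cyl n x y \<Longrightarrow> \<bar>H x - H y\<bar> < e"
      using contS_uniform[OF contH] by blast
    have "norm (A i (Suc m) - H (\<lambda>_. i)) < e" if "m \<ge> n" for m
    proof -
      let ?x = "run i (Suc (Suc m)) (\<lambda>_. \<not> i)"
      have "H ?x = A i (Suc m)" by (rule H_A) (auto simp: run_def)
      moreover have "same_cyl n ?x (\<lambda>_. i)" using that by (auto simp: same_cyl_def run_def)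
      ultimately show ?thesis using n by fastforce
    qed
    then show "\<exists>no. \<forall>n\<ge>no. norm (A i (Suc n) - H (\<lambda>_. i)) < e" by blast
  qed
qed

end

section \<open>Constancy of the eigenfunction on the cylinders [01] and [10]\<close>

locale gibbs_state = potential + nu: prob_space \<nu> for \<nu> :: "seq measure" +
  fixes \<beta> lam :: real and \<Phi> :: "seq \<Rightarrow> real"
  assumes beta_pos: "0 < \<beta>" and lam_pos: "0 < lam" and contPhi: "contS \<Phi>"
    and Phi_pos: "\<And>x. 0 < \<Phi> x" and Phi_le1: "\<And>x. \<Phi> x \<le> 1"
    and eigen: "\<And>x. transfer H \<beta> \<Phi> x = lam * \<Phi> x"
    and sets_nu: "sets \<nu> = sets Sigma_M"
    and dual: "\<And>f. contS f \<Longrightarrow> integral\<^sup>L \<nu> (transfer H \<beta> f) = lam * integral\<^sup>L \<nu> f"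
begin

lemma transfer_both: "transfer H \<beta> f = (\<lambda>x. exp (- \<beta> * H (pre i x)) * f (pre i x)
    + exp (- \<beta> * H (pre (\<not> i) x)) * f (pre (\<not> i) x))"
  by (cases i) (auto simp: transfer_def fun_eq_iff)

text \<open>The sequence of zeros is its own preimage, with weight 1 because \<open>H\<close>
  vanishes there, and its second preimage contributes a positive amount. Hence \<open>z\<close> lies
  below 1 and the series over run lengths converge.\<close>

lemma lam_gt1: "1 < lam"
proof -
  have "pre False (\<lambda>_. False) = (\<lambda>_. False)" by (auto simp: pre_def fun_eq_iff split: nat.splits)
  then have "lam * \<Phi> (\<lambda>_. False) = \<Phi> (\<lambda>_. False) +
      exp (- \<beta> * H (pre True (\<lambda>_. False))) * \<Phi> (pre True (\<lambda>_. False))"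
    using eigen[of "\<lambda>_. False"] by (simp add: transfer_def H_const_0)
  also have "\<dots> > \<Phi> (\<lambda>_. False)" by (simp add: Phi_pos)
  finally show ?thesis using Phi_pos[of "\<lambda>_. False"] by (simp add: mult_less_cancel_right1)
qed

definition z :: real where "z = 1 / lam"

lemma z_bounds: "0 < z" "z < 1" "lam * z = 1"
  using lam_gt1 by (auto simp: z_def)

definition w :: "bool \<Rightarrow> nat \<Rightarrow> real" where
  "w i n = z ^ Suc n * exp (- \<beta> * cost i n)"

lemma w_pos: "0 < w i n"
  using z_bounds by (simp add: w_def)

lemma w_le: "w i n \<le> z ^ Suc n"
proof -
  have "exp (- \<beta> * cost i n) \<le> 1" using cost_pos[of i n] beta_pos by (simp add: mult_nonneg_nonneg)
  then show ?thesis using z_bounds by (simp add: w_def mult_left_le)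
qed

lemma summable_w: "summable (w i)"
proof (rule summable_comparison_test')
  show "summable (\<lambda>n. z ^ Suc n)" using z_bounds by (intro summable_mult summable_geometric iffD2[OF summable_Suc_iff]) auto
  show "norm (w i n) \<le> z ^ Suc n" if "n \<ge> 0" for n using w_pos[of i n] w_le[of i n] by simp
qed

abbreviation FF :: "bool \<Rightarrow> real" where "FF i \<equiv> wsum (cost i) \<beta> z"

abbreviation GG :: "bool \<Rightarrow> real" where "GG i \<equiv> wmean (cost i) \<beta> z"

lemma w_sums: "w i sums FF i"
  using summable_w[of i] unfolding wsum_def w_def by (rule summable_sums)

lemma FF_pos: "0 < FF i"
  using suminf_pos[OF summable_w w_pos, of i] w_sums[of i] by (simp add: sums_iff)

lemma Phi_step:
  assumes "y 0 = (\<not> i)" "1 \<le> n"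
  shows "\<Phi> (run i n y) = z * exp (- \<beta> * A i n) * \<Phi> (run i (Suc n) y)
    + z * exp (- \<beta> * B (\<not> i) n) * \<Phi> (pre (\<not> i) (run i n y))"
proof -
  have "H (run i (Suc n) y) = A i n"
    using assms by (intro H_A) (auto simp: run_def)
  moreover have "H (pre (\<not> i) (run i n y)) = B (\<not> i) n"
    using assms by (intro H_B) (auto simp: run_def pre_def split: nat.splits)
  ultimately have "lam * \<Phi> (run i n y) = exp (- \<beta> * A i n) * \<Phi> (run i (Suc n) y)
    + exp (- \<beta> * B (\<not> i) n) * \<Phi> (pre (\<not> i) (run i n y))"
    using eigen[of "run i n y"] fun_cong[OF transfer_both[of \<Phi> i], of "run i n y"] by (simp add: pre_run)
  then show ?thesis using lam_pos by (simp add: z_def field_simps)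
qed

lemma exp_weight_add: "exp (- \<beta> * (u + v)) = exp (- \<beta> * u) * exp (- \<beta> * v)"
  by (simp add: distrib_left flip: exp_add)

text \<open>Iterates \<open>Phi_step\<close> along the branch that lengthens the run. Each iteration
  splits off the word in which the run is closed by the other symbol; the remainder sits on a run of
  length N + 1.\<close>

lemma Phi_expand:
  assumes "y 0 = (\<not> i)"
  shows "\<Phi> (run i 1 y) = (\<Sum>n<N. w i n * \<Phi> (pre (\<not> i) (run i (Suc n) y)))
    + z ^ N * exp (- \<beta> * (\<Sum>k=1..<Suc N. A i k)) * \<Phi> (run i (Suc N) y)"
proof (induction N)
  case (Suc N)
  have S: "(\<Sum>k=1..<Suc (Suc N). A i k) = (\<Sum>k=1..<Suc N. A i k) + A i (Suc N)" by simp
  show ?case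
    unfolding Suc.IH Phi_step[where i = i and y = y and n = "Suc N", OF assms le_add1[of 1 N, unfolded plus_1_eq_Suc]]
      S exp_weight_add w_def cost_def sum.lessThan_Suc power_Suc by (simp only: algebra_simps)
qed simp

lemma Phi_sums:
  assumes "y 0 = (\<not> i)"
  shows "(\<lambda>n. w i n * \<Phi> (pre (\<not> i) (run i (Suc n) y))) sums \<Phi> (run i 1 y)"
proof -
  have "(\<lambda>N. z ^ N * exp (- \<beta> * (\<Sum>k=1..<Suc N. A i k)) * \<Phi> (run i (Suc N) y)) \<longlonglongrightarrow> 0"
  proof (rule Lim_null_comparison)
    show "(\<lambda>N. z ^ N) \<longlonglongrightarrow> 0" using z_bounds by (intro LIMSEQ_power_zero) auto
    have "exp (- \<beta> * (\<Sum>k=1..<Suc N. A i k)) \<le> 1" for N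
      using beta_pos A_nonneg by (auto intro!: mult_nonneg_nonneg sum_nonneg simp del: sum.op_ivl_Suc)
    then have "\<bar>z ^ N * exp (- \<beta> * (\<Sum>k=1..<Suc N. A i k)) * \<Phi> (run i (Suc N) y)\<bar> \<le> z ^ N * 1 * 1" for N
      unfolding abs_mult using z_bounds Phi_pos[of "run i (Suc N) y"] Phi_le1[of "run i (Suc N) y"]
      by (intro mult_mono) auto
    then show "\<forall>\<^sub>F N in sequentially. norm (z ^ N * exp (- \<beta> * (\<Sum>k=1..<Suc N. A i k)) * \<Phi> (run i (Suc N) y)) \<le> z ^ N"
      by simp
  qed
  note lim = this
  have "(\<Sum>n<N. w i n * \<Phi> (pre (\<not> i) (run i (Suc n) y))) = \<Phi> (run i 1 y)
      - z ^ N * exp (- \<beta> * (\<Sum>k=1..<Suc N. A i k)) * \<Phi> (run i (Suc N) y)" for N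
    using Phi_expand[where i = i and y = y and N = N, OF assms] by linarith
  then show ?thesis
    unfolding sums_def using tendsto_diff[OF tendsto_const[of "\<Phi> (run i 1 y)"] lim] by simp
qed

definition edge :: "bool \<Rightarrow> seq set" where
  "edge i = {x. x 0 = i \<and> x 1 = (\<not> i)}"

text \<open>For \<open>x\<close> in \<open>edge i\<close> this puts n further symbols
  \<open>i\<close> and then the opposite symbol in front of \<open>x\<close>;
  \<open>left_shift\<close> removes the one \<open>i\<close> that \<open>run i (Suc n)\<close>
  restores. These are the inverse branches leading from \<open>edge i\<close> to
  \<open>edge (\<not> i)\<close>.\<close>

definition step :: "bool \<Rightarrow> nat \<Rightarrow> seq \<Rightarrow> seq" where
  "step i n x = pre (\<not> i) (run i (Suc n) (left_shift x))"

lemma step_edge: "step i n x \<in> edge (\<not> i)"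
  by (simp add: step_def edge_def run_def)

lemma step_cyl: "same_cyl (Suc k) x y \<Longrightarrow> same_cyl (Suc (Suc k)) (step i n x) (step i n y)"
  by (auto simp: step_def same_cyl_def run_def pre_def split: nat.splits)

lemma Phi_edge_sums:
  assumes "x \<in> edge i" shows "(\<lambda>n. w i n * \<Phi> (step i n x)) sums \<Phi> x"
proof -
  have "run i 1 (left_shift x) = x"
    using assms by (auto simp: edge_def run_def left_shift_def fun_eq_iff)
  then show ?thesis
    using Phi_sums[of "left_shift x" i] assms by (simp add: step_def edge_def)
qed

lemma edge_nonempty: "pre i (\<lambda>_. \<not> i) \<in> edge i"
  by (simp add: edge_def)

text \<open>Bounding every term of the expansion by the infimum over the opposite edge gives
  \<open>FF i * m (\<not> i) \<le> m i\<close>. Going round both edges and cancelling the infimum,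
  which is positive by compactness, leaves the product.\<close>

lemma FF_prod_le1: "FF False * FF True \<le> 1"
proof -
  obtain x0 where x0: "\<And>y. \<Phi> x0 \<le> \<Phi> y" using contS_attains_inf[OF contPhi] by blast
  define m where "m = (\<lambda>i. Inf (\<Phi> ` edge i))"
  have bdd: "bdd_below (\<Phi> ` edge i)" for i using x0 by (auto intro!: bdd_belowI[of _ "\<Phi> x0"])
  have m_pos: "0 < m i" for i
  proof -
    have "\<Phi> x0 \<le> m i" unfolding m_def using edge_nonempty x0 by (intro cINF_greatest) auto
    then show ?thesis using Phi_pos[of x0] by linarith
  qed
  have "FF i * m (\<not> i) \<le> m i" for i
    unfolding m_def
  proof (intro cINF_greatest)
    show "edge i \<noteq> {}" using edge_nonempty by blast
    fix x assume x: "x \<in> edge i"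
    have "(\<lambda>n. w i n * m (\<not> i)) sums (FF i * m (\<not> i))" by (intro sums_mult2 w_sums)
    moreover have "w i n * m (\<not> i) \<le> w i n * \<Phi> (step i n x)" for n
      unfolding m_def using w_pos[of i n] bdd step_edge by (intro mult_left_mono cINF_lower) auto
    ultimately show "FF i * Inf (\<Phi> ` edge (\<not> i)) \<le> \<Phi> x"
      unfolding m_def by (intro sums_le[OF _ _ Phi_edge_sums[OF x]])
  qed
  from this[of False] this[of True] have "FF False * m True \<le> m False" "FF True * m False \<le> m True"
    by auto
  then have "FF False * FF True * m False \<le> m False"
    using FF_pos[of False] by (smt (verit) mult.assoc mult_left_mono)
  then show ?thesis using m_pos[of False] by (simp add: mult_le_cancel_right1)
qed

text \<open>
  Expanding \<open>\<Phi>\<close> at two points of the same edge uses the same words in front of them, which makes them agree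
  to a greater depth. Since \<open>FF False * FF True \<le> 1\<close>, an oscillation bound valid for points agreeing to depth
  \<open>k + 2\<close> is thus inherited by points agreeing to depth \<open>k + 1\<close>, and uniform continuity makes it vanish.
\<close>

lemma Phi_contract:
  assumes hyp: "\<And>i x y. x \<in> edge i \<Longrightarrow> y \<in> edge i \<Longrightarrow> same_cyl (Suc (Suc k)) x y \<Longrightarrow>
      \<bar>\<Phi> x - \<Phi> y\<bar> \<le> e * (if i then 1 else FF False)"
    and e: "0 \<le> e" and xy: "x \<in> edge i" "y \<in> edge i" "same_cyl (Suc k) x y"
  shows "\<bar>\<Phi> x - \<Phi> y\<bar> \<le> e * (if i then 1 else FF False)"
proof -
  \<comment> \<open>The edges carry different weights so that
    \<open>FF i * r (\<not> i) \<le> r i\<close> holds for both \<open>i\<close>: with equality for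
    \<open>False\<close>, and by \<open>FF_prod_le1\<close> for \<open>True\<close>.\<close>
  define r where "r = (\<lambda>i. if i then 1 else FF False)"
  have D: "(\<lambda>n. w i n * \<Phi> (step i n x) - w i n * \<Phi> (step i n y)) sums (\<Phi> x - \<Phi> y)"
    using xy by (intro sums_diff Phi_edge_sums)
  have W: "(\<lambda>n. w i n * (e * r (\<not> i))) sums (FF i * (e * r (\<not> i)))" by (intro sums_mult2 w_sums)
  have le: "\<bar>w i n * \<Phi> (step i n x) - w i n * \<Phi> (step i n y)\<bar> \<le> w i n * (e * r (\<not> i))" for n
  proof -
    have "\<bar>w i n * \<Phi> (step i n x) - w i n * \<Phi> (step i n y)\<bar> = w i n * \<bar>\<Phi> (step i n x) - \<Phi> (step i n y)\<bar>"
      using w_pos[of i n] by (simp add: abs_mult flip: right_diff_distrib)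
    also have "\<dots> \<le> w i n * (e * r (\<not> i))"
      unfolding r_def using w_pos[of i n] xy(3)
      by (intro mult_left_mono hyp step_edge step_cyl) auto
    finally show ?thesis .
  qed
  have "\<Phi> x - \<Phi> y \<le> FF i * (e * r (\<not> i))"
    by (rule sums_le[OF _ D W]) (use le in \<open>auto simp: abs_le_iff\<close>)
  moreover have "- (FF i * (e * r (\<not> i))) \<le> \<Phi> x - \<Phi> y"
    by (rule sums_le[OF _ sums_minus[OF W] D]) (metis le abs_le_D2 minus_le_iff)
  ultimately have "\<bar>\<Phi> x - \<Phi> y\<bar> \<le> FF i * (e * r (\<not> i))" by linarith
  also have "\<dots> \<le> e * r i"
    using FF_prod_le1 mult_left_mono[OF FF_prod_le1 e] by (cases i) (auto simp: r_def mult_ac)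
  finally show ?thesis by (simp add: r_def)
qed

text \<open>Uniform continuity supplies the bound at some depth, \<open>Phi_contract\<close> carries
  it down one symbol at a time, and at depth 1 it applies to all pairs of points of the edge. Since
  e is arbitrary, the difference is 0.\<close>

lemma Phi_edge_const:
  assumes "x \<in> edge i" "y \<in> edge i" shows "\<Phi> x = \<Phi> y"
proof -
  define r where "r = (\<lambda>i. if i then 1 else FF False)"
  have r_pos: "0 < r i" for i using FF_pos by (simp add: r_def)
  have "\<bar>\<Phi> x - \<Phi> y\<bar> \<le> e * r i" if e: "0 < e" for e
  proof -
    have "0 < e * min 1 (FF False)" using e FF_pos by simp
    then obtain n where n: "\<And>x y. same_cyl n x y \<Longrightarrow> \<bar>\<Phi> x - \<Phi> y\<bar> < e * min 1 (FF False)"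
      using contS_uniform[OF contPhi] by blast
    let ?P = "\<lambda>k. \<forall>i x y. x \<in> edge i \<longrightarrow> y \<in> edge i \<longrightarrow> same_cyl (Suc k) x y \<longrightarrow> \<bar>\<Phi> x - \<Phi> y\<bar> \<le> e * r i"
    have base: "?P n"
    proof (intro allI impI)
      fix i x y assume "same_cyl (Suc n) x y"
      then have "\<bar>\<Phi> x - \<Phi> y\<bar> < e * min 1 (FF False)" by (intro n) (auto simp: same_cyl_def)
      also have "\<dots> \<le> e * r i" using e by (intro mult_left_mono) (auto simp: r_def)
      finally show "\<bar>\<Phi> x - \<Phi> y\<bar> \<le> e * r i" by simp
    qed
    have "?P m" if "?P (Suc m)" for m
    proof (intro allI impI)
      fix i x y assume xy: "x \<in> edge i" "y \<in> edge i" "same_cyl (Suc m) x y"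
      show "\<bar>\<Phi> x - \<Phi> y\<bar> \<le> e * r i"
        unfolding r_def by (rule Phi_contract[OF _ _ xy]) (use that e in \<open>auto simp: r_def\<close>)
    qed
    from zero_induct[of ?P, OF base this] have "?P 0" by blast
    moreover have "same_cyl (Suc 0) x y" using assms by (auto simp: same_cyl_def edge_def)
    ultimately show ?thesis using assms by blast
  qed
  then have "\<bar>\<Phi> x - \<Phi> y\<bar> / r i \<le> e" if "0 < e" for e
    using that r_pos[of i] by (simp add: field_simps)
  then have "\<bar>\<Phi> x - \<Phi> y\<bar> / r i \<le> 0" by (meson field_le_epsilon add_0 order_trans dense_ge)
  then show ?thesis using r_pos[of i] by (simp add: divide_le_0_iff)
qed

definition \<phi> :: "bool \<Rightarrow> real" where "\<phi> i = \<Phi> (pre i (\<lambda>_. \<not> i))"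

lemma Phi_edge: "x \<in> edge i \<Longrightarrow> \<Phi> x = \<phi> i"
  unfolding \<phi>_def by (rule Phi_edge_const[OF _ edge_nonempty])

lemma phi_pos: "0 < \<phi> i"
  by (simp add: \<phi>_def Phi_pos)

lemma phi_eq: "\<phi> i = FF i * \<phi> (\<not> i)"
proof -
  have "(\<lambda>n. w i n * \<phi> (\<not> i)) sums \<phi> i"
    using Phi_edge_sums[OF edge_nonempty, of i] by (simp add: Phi_edge[OF step_edge] Phi_edge[OF edge_nonempty])
  then show ?thesis using sums_mult2[OF w_sums] sums_unique2 by blast
qed

text \<open>The equation that determines the eigenvalue: by \<open>phi_eq\<close>, a passage from
  one edge to the other and back multiplies the edge value by this product.\<close>

lemma FF_prod: "FF False * FF True = 1"
  using phi_eq[of False] phi_eq[of True] phi_pos[of False] by (simp add: mult.assoc[symmetric])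


section \<open>Masses of runs and blocks under the Gibbs measure\<close>

lemma integrable_contS: "contS f \<Longrightarrow> integrable \<nu> f"
proof -
  assume f: "contS f"
  obtain C where "\<And>x. \<bar>f x\<bar> \<le> C" using contS_bounded[OF f] by blast
  then show ?thesis
    using contS_measurable[OF f] measurable_cong_sets[OF sets_nu refl, of borel]
    by (intro nu.integrable_const_bound[of _ C]) auto
qed

definition Z :: real where "Z = integral\<^sup>L \<nu> \<Phi>"

lemma Z_pos: "0 < Z"
proof -
  obtain x0 where x0: "\<And>y. \<Phi> x0 \<le> \<Phi> y" using contS_attains_inf[OF contPhi] by blast
  have "(\<integral>x. \<Phi> x0 \<partial>\<nu>) \<le> Z" unfolding Z_def using x0 by (intro integral_mono integrable_contS contPhi) auto
  then show ?thesis using Phi_pos[of x0] by (simp add: nu.prob_space)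
qed

definition M :: "(seq \<Rightarrow> real) \<Rightarrow> real" where
  "M f = integral\<^sup>L \<nu> (\<lambda>x. f x * \<Phi> x) / Z"

lemma M_density:
  assumes "contS f"
  shows "integral\<^sup>L (density \<nu> (\<lambda>x. ennreal (\<Phi> x / integral\<^sup>L \<nu> \<Phi>))) f = M f"
proof -
  have "integral\<^sup>L (density \<nu> (\<lambda>x. ennreal (\<Phi> x / Z))) f = (\<integral>x. (\<Phi> x / Z) *\<^sub>R f x \<partial>\<nu>)"
    using contS_measurable[OF assms] contS_measurable[OF contPhi] measurable_cong_sets[OF sets_nu refl, of borel]
      Phi_pos Z_pos by (intro integral_density) (auto intro!: AE_I2 divide_nonneg_pos simp: less_imp_le)
  also have "\<dots> = (\<integral>x. f x * \<Phi> x / Z \<partial>\<nu>)"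
    by (intro Bochner_Integration.integral_cong) auto
  also have "\<dots> = M f" by (simp add: M_def)
  finally show ?thesis by (simp add: Z_def)
qed

text \<open>Duality tested on a function supported on the cylinder of \<open>i\<close> keeps only
  the preimage \<open>pre i x\<close>. It thus computes the eigenmeasure of a cylinder from that of
  its shift, one symbol at a time.\<close>

lemma dual_pre:
  assumes "contS g"
  shows "(\<integral>x. exp (- \<beta> * H (pre i x)) * g x \<partial>\<nu>) = lam * (\<integral>x. of_bool (x 0 = i) * g (left_shift x) \<partial>\<nu>)"
proof -
  have "contS (\<lambda>x. of_bool (x 0 = i) :: real)" by (rule contS_cyl[of 1]) (auto simp: same_cyl_def)
  then have "contS (\<lambda>x. of_bool (x 0 = i) * g (left_shift x))"
    using contS_shift[OF assms] by (intro contS_mult) (auto simp: left_shift_def)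
  from dual[OF this] show ?thesis
    by (simp add: transfer_both[of _ i])
qed

lemma contS_run_cyl [simp]: "contS (\<lambda>x. of_bool (x \<in> run_cyl i n))"
  by (rule contS_cyl[of "Suc n"]) (auto simp: same_cyl_def run_cyl_def)

lemma contS_block [simp]: "contS (\<lambda>x. of_bool (x \<in> block i n))"
  by (rule contS_cyl[of n]) (auto simp: same_cyl_def block_def)

lemma run_cyl_shift: "x 0 = i \<and> left_shift x \<in> run_cyl i n \<longleftrightarrow> x \<in> run_cyl i (Suc n)"
  by (auto simp: run_cyl_def less_Suc_eq_0_disj)

lemma block_shift: "x 0 = i \<and> left_shift x \<in> block i n \<longleftrightarrow> x \<in> block i (Suc n)"
  by (auto simp: block_def less_Suc_eq_0_disj)

lemma H_pre_same: "1 \<le> n \<Longrightarrow> x \<in> run_cyl i n \<Longrightarrow> H (pre i x) = A i n"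
  by (rule H_A) (auto simp: run_cyl_def pre_def split: nat.splits)

lemma H_pre_other: "1 \<le> n \<Longrightarrow> x \<in> run_cyl i n \<Longrightarrow> H (pre (\<not> i) x) = B (\<not> i) n"
  by (rule H_B) (auto simp: run_cyl_def pre_def split: nat.splits)

text \<open>Indicator of a complete run: a block of n + 1 symbols \<open>i\<close> with the opposite
  symbol on either side.\<close>

abbreviation entry :: "bool \<Rightarrow> nat \<Rightarrow> seq \<Rightarrow> real" where
  "entry i n x \<equiv> of_bool (x 0 = (\<not> i)) * of_bool (left_shift x \<in> run_cyl i (Suc n))"

definition run_nu :: "bool \<Rightarrow> nat \<Rightarrow> real" where
  "run_nu i n = (\<integral>x. of_bool (x \<in> run_cyl i n) \<partial>\<nu>)"

lemma run_nu_Suc: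
  assumes "1 \<le> n" shows "run_nu i (Suc n) = z * exp (- \<beta> * A i n) * run_nu i n"
proof -
  have "(\<lambda>x. exp (- \<beta> * H (pre i x)) * of_bool (x \<in> run_cyl i n)) =
      (\<lambda>x. exp (- \<beta> * A i n) * of_bool (x \<in> run_cyl i n))"
    using H_pre_same[OF assms, of _ i] by (auto simp: fun_eq_iff)
  moreover have "(\<lambda>x. of_bool (x 0 = i) * of_bool (left_shift x \<in> run_cyl i n) :: real) =
      (\<lambda>x. of_bool (x \<in> run_cyl i (Suc n)))"
    by (simp add: fun_eq_iff flip: run_cyl_shift)
  ultimately have "exp (- \<beta> * A i n) * run_nu i n = lam * run_nu i (Suc n)"
    using dual_pre[OF contS_run_cyl, of i i n] by (simp add: run_nu_def)
  then show ?thesis using lam_pos by (simp add: z_def field_simps)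
qed

lemma run_nu_closed: "run_nu i (Suc n) = z ^ n * exp (- \<beta> * (\<Sum>k=1..<Suc n. A i k)) * run_nu i 1"
proof (induction n)
  case (Suc n)
  have S: "(\<Sum>k=1..<Suc (Suc n). A i k) = (\<Sum>k=1..<Suc n. A i k) + A i (Suc n)" by simp
  show ?case
    unfolding run_nu_Suc[of "Suc n", OF le_add1[of 1 n, unfolded plus_1_eq_Suc]] Suc.IH S exp_weight_add power_Suc
    by (simp only: algebra_simps)
qed simp

lemma run_nu_other:
  "(\<integral>x. entry i n x \<partial>\<nu>) = w i n * run_nu i 1"
proof -
  have "(\<lambda>x. exp (- \<beta> * H (pre (\<not> i) x)) * of_bool (x \<in> run_cyl i (Suc n))) =
      (\<lambda>x. exp (- \<beta> * B (\<not> i) (Suc n)) * of_bool (x \<in> run_cyl i (Suc n)))"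
    using H_pre_other[of "Suc n" _ i] by (auto simp: fun_eq_iff)
  then have "exp (- \<beta> * B (\<not> i) (Suc n)) * run_nu i (Suc n) =
      lam * (\<integral>x. entry i n x \<partial>\<nu>)"
    using dual_pre[OF contS_run_cyl, of "\<not> i" i "Suc n"] by (simp add: run_nu_def)
  then have "(\<integral>x. entry i n x \<partial>\<nu>) =
      z * (exp (- \<beta> * B (\<not> i) (Suc n)) * run_nu i (Suc n))"
    using lam_pos by (simp add: z_def field_simps)
  then show ?thesis
    unfolding run_nu_closed[of i n] w_def cost_def exp_weight_add power_Suc by (simp only: algebra_simps)
qed

text \<open>Each prepended symbol costs at least a factor \<open>z\<close>, since \<open>H\<close>
  is nonnegative. Because of this geometric decay the telescoping sums below lose no mass at the
  fixed points.\<close>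

lemma integral_block_le: "(\<integral>x. of_bool (x \<in> block i n) \<partial>\<nu>) \<le> z ^ n"
proof (induction n)
  case 0
  then show ?case by (simp add: block_def nu.prob_space)
next
  case (Suc n)
  have "(\<lambda>x. of_bool (x 0 = i) * of_bool (left_shift x \<in> block i n) :: real) =
      (\<lambda>x. of_bool (x \<in> block i (Suc n)))"
    by (simp add: fun_eq_iff flip: block_shift)
  then have "lam * (\<integral>x. of_bool (x \<in> block i (Suc n)) \<partial>\<nu>) =
      (\<integral>x. exp (- \<beta> * H (pre i x)) * of_bool (x \<in> block i n) \<partial>\<nu>)"
    using dual_pre[OF contS_block, of i i n] by simp
  also have "\<dots> \<le> (\<integral>x. of_bool (x \<in> block i n) \<partial>\<nu>)"
    using beta_pos H_nonneg
    by (intro integral_mono integrable_contS contS_mult contS_block contS_pre[of "\<lambda>x. exp (- \<beta> * H x)"]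
        contS_real_compose[OF contH]) (auto intro!: mult_left_le_one_le continuous_intros)
  also have "\<dots> \<le> z ^ n" by (rule Suc.IH)
  finally show ?case using lam_pos by (simp add: z_def field_simps)
qed

lemma M_add: "contS f \<Longrightarrow> contS g \<Longrightarrow> M (\<lambda>x. f x + g x) = M f + M g"
  by (simp add: M_def distrib_right add_divide_distrib integrable_contS contS_mult contPhi)

lemma M_mono: "contS f \<Longrightarrow> contS g \<Longrightarrow> (\<And>x. f x \<le> g x) \<Longrightarrow> M f \<le> M g"
  unfolding M_def using Z_pos Phi_pos
  by (intro divide_right_mono integral_mono integrable_contS contS_mult contPhi mult_right_mono)
    (auto simp: less_imp_le)

lemma M_scale: "M (\<lambda>x. c * f x) = c * M f"
  by (simp add: M_def mult.assoc)

lemma M_1: "M (\<lambda>x. 1) = 1"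
  using Z_pos by (simp add: M_def Z_def)

text \<open>A function of \<open>left_shift x\<close> factors out of the transfer operator, which
  leaves the eigenfunction equation for \<open>\<Phi>\<close>.\<close>

lemma M_invariant:
  assumes "contS f" shows "M (\<lambda>x. f (left_shift x)) = M f"
proof -
  have "contS (\<lambda>x. f (left_shift x) * \<Phi> x)"
    using contS_shift[OF assms] contPhi by (intro contS_mult) (auto simp: left_shift_def)
  moreover have "transfer H \<beta> (\<lambda>x. f (left_shift x) * \<Phi> x) = (\<lambda>x. lam * (f x * \<Phi> x))"
  proof
    fix x
    have "transfer H \<beta> (\<lambda>x. f (left_shift x) * \<Phi> x) x = f x * transfer H \<beta> \<Phi> x"
      by (simp add: transfer_def algebra_simps)
    then show "transfer H \<beta> (\<lambda>x. f (left_shift x) * \<Phi> x) x = lam * (f x * \<Phi> x)" by (simp add: eigen)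
  qed
  ultimately have "(\<integral>x. lam * (f x * \<Phi> x) \<partial>\<nu>) = lam * (\<integral>x. f (left_shift x) * \<Phi> x \<partial>\<nu>)"
    using dual[of "\<lambda>x. f (left_shift x) * \<Phi> x"] by metis
  moreover have "(\<integral>x. lam * (f x * \<Phi> x) \<partial>\<nu>) = lam * (\<integral>x. f x * \<Phi> x \<partial>\<nu>)" by simp
  ultimately have "lam * (\<integral>x. f (left_shift x) * \<Phi> x \<partial>\<nu>) = lam * (\<integral>x. f x * \<Phi> x \<partial>\<nu>)"
    by metis
  then have "(\<integral>x. f (left_shift x) * \<Phi> x \<partial>\<nu>) = (\<integral>x. f x * \<Phi> x \<partial>\<nu>)"
    using lam_pos by (metis mult_cancel_left less_irrefl)
  then show ?thesis by (simp add: M_def)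
qed

definition run_mass :: "bool \<Rightarrow> nat \<Rightarrow> real" where "run_mass i n = M (\<lambda>x. of_bool (x \<in> run_cyl i (Suc n)))"
definition block_mass :: "bool \<Rightarrow> nat \<Rightarrow> real" where "block_mass i n = M (\<lambda>x. of_bool (x \<in> block i (Suc n)))"
definition mass_const :: "bool \<Rightarrow> real" where "mass_const i = \<phi> (\<not> i) * run_nu i 1 / Z"

lemma M_of_bool_le: "contS (\<lambda>x. of_bool (x \<in> S)) \<Longrightarrow> S \<subseteq> block i n \<Longrightarrow> M (\<lambda>x. of_bool (x \<in> S)) \<le> z ^ n / Z"
  unfolding M_def using Z_pos Phi_le1 Phi_pos
  by (intro divide_right_mono order_trans[OF integral_mono integral_block_le] integrable_contS contS_mult contPhi)
    (auto simp: less_imp_le)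

lemma M_of_bool_nonneg: "0 \<le> M (\<lambda>x. of_bool (x \<in> S))"
  unfolding M_def using Z_pos Phi_pos by (intro divide_nonneg_pos integral_nonneg) (auto simp: less_imp_le)

text \<open>The cylinder of a complete run lies in \<open>edge (\<not> i)\<close>, where
  \<open>\<Phi>\<close> is constant. So the masses of complete runs are proportional to the weights
  \<open>w\<close>.\<close>

lemma M_other:
  "M (\<lambda>x. entry i n x) = mass_const i * w i n"
proof -
  have "(\<lambda>x. entry i n x * \<Phi> x) =
     (\<lambda>x. \<phi> (\<not> i) * (entry i n x))"
    using Phi_edge[of _ "\<not> i"] by (fastforce simp: fun_eq_iff run_cyl_def edge_def)
  then show ?thesis using run_nu_other[of i n] by (simp add: M_def mass_const_def)
qed

text \<open>By invariance the mass may be computed one position to the right; the symbol then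
  standing in front either lengthens the run or completes it.\<close>

lemma run_mass_step: "run_mass i n = run_mass i (Suc n) + mass_const i * w i n"
proof -
  have c: "contS (\<lambda>x. entry i n x)"
    by (rule contS_cyl[of "Suc (Suc (Suc n))"]) (auto simp: same_cyl_def run_cyl_def)
  have "run_mass i n = M (\<lambda>x. of_bool (left_shift x \<in> run_cyl i (Suc n)))"
    unfolding run_mass_def by (rule M_invariant[symmetric]) simp
  also have "(\<lambda>x. of_bool (left_shift x \<in> run_cyl i (Suc n)) :: real) = (\<lambda>x. of_bool (x \<in> run_cyl i (Suc (Suc n)))
      + entry i n x)"
    by (auto simp: fun_eq_iff simp flip: run_cyl_shift[of _ _ "Suc n"])
  also have "M \<dots> = run_mass i (Suc n) + mass_const i * w i n"
    unfolding run_mass_def M_other[symmetric] by (intro M_add c) simp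
  finally show ?thesis .
qed

lemma block_mass_step: "block_mass i n = run_mass i n + block_mass i (Suc n)"
proof -
  have "(\<lambda>x. of_bool (x \<in> block i (Suc n)) :: real) =
      (\<lambda>x. of_bool (x \<in> run_cyl i (Suc n)) + of_bool (x \<in> block i (Suc (Suc n))))"
    by (auto simp: fun_eq_iff block_def run_cyl_def less_Suc_eq)
  then show ?thesis unfolding run_mass_def block_mass_def by (simp add: M_add)
qed

lemma run_mass_bounds: "0 \<le> run_mass i n" "run_mass i n \<le> z ^ Suc n / Z"
  unfolding run_mass_def by (rule M_of_bool_nonneg, rule M_of_bool_le[where i = i and n = "Suc n"])
    (simp, auto simp: run_cyl_def block_def)

lemma block_mass_bounds: "0 \<le> block_mass i n" "block_mass i n \<le> z ^ Suc n / Z"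
  unfolding block_mass_def by (rule M_of_bool_nonneg, rule M_of_bool_le[where i = i and n = "Suc n"]) auto

lemma tendsto_z_Z: "(\<lambda>n. z ^ Suc n / Z) \<longlonglongrightarrow> 0" "(\<lambda>n. real n * (z ^ Suc n / Z)) \<longlonglongrightarrow> 0"
proof -
  have "(\<lambda>n. z ^ n * (z / Z)) \<longlonglongrightarrow> 0 * (z / Z)" using z_bounds by (intro tendsto_intros LIMSEQ_power_zero) auto
  then show "(\<lambda>n. z ^ Suc n / Z) \<longlonglongrightarrow> 0" by (simp add: mult_ac)
  have "(\<lambda>n. (real n * z ^ n) * (z / Z)) \<longlonglongrightarrow> 0 * (z / Z)"
    using z_bounds by (intro tendsto_intros powser_times_n_limit_0) auto
  then show "(\<lambda>n. real n * (z ^ Suc n / Z)) \<longlonglongrightarrow> 0" by (simp add: mult_ac)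
qed

lemma run_mass_0: "run_mass i 0 = mass_const i * FF i"
proof -
  have "run_mass i 0 = (\<Sum>n<N. mass_const i * w i n) + run_mass i N" for N
  proof (induction N)
    case (Suc N)
    then show ?case using run_mass_step[of i N] by simp
  qed simp
  then have e: "(\<Sum>n<N. mass_const i * w i n) = run_mass i 0 - run_mass i N" for N by (simp add: algebra_simps)
  have "run_mass i \<longlonglongrightarrow> 0"
    by (rule tendsto_sandwich[OF _ _ tendsto_const tendsto_z_Z(1)]) (auto simp: run_mass_bounds simp del: power_Suc)
  from tendsto_diff[OF tendsto_const[of "run_mass i 0"] this] have "(\<lambda>n. mass_const i * w i n) sums run_mass i 0"
    by (simp add: sums_def e)
  then show ?thesis using sums_mult[OF w_sums] sums_unique2 by blast
qed

text \<open>Two summations by parts: the block mass is the sum of the run masses, and these are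
  tails of the series of \<open>mass_const i * w i n\<close>, so each term is counted
  \<open>Suc n\<close> times. The geometric bound removes the boundary term
  \<open>N * run_mass i N\<close>.\<close>

lemma block_mass_0: "block_mass i 0 = mass_const i * GG i"
proof -
  have 1: "block_mass i 0 = (\<Sum>n<N. run_mass i n) + block_mass i N" for N
  proof (induction N)
    case (Suc N)
    then show ?case using block_mass_step[of i N] by simp
  qed simp
  have 2: "(\<Sum>n<N. run_mass i n) = (\<Sum>n<N. real (Suc n) * (mass_const i * w i n)) + real N * run_mass i N" for N
  proof (induction N)
    case (Suc N)
    then show ?case using run_mass_step[of i N] by (simp add: algebra_simps)
  qed simp
  have e: "(\<Sum>n<N. real (Suc n) * (mass_const i * w i n)) = block_mass i 0 - block_mass i N - real N * run_mass i N" for N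
    using 1[of N] 2[of N] by simp
  have "block_mass i \<longlonglongrightarrow> 0"
    by (rule tendsto_sandwich[OF _ _ tendsto_const tendsto_z_Z(1)]) (auto simp: block_mass_bounds simp del: power_Suc)
  moreover have "(\<lambda>N. real N * run_mass i N) \<longlonglongrightarrow> 0"
    by (rule tendsto_sandwich[OF _ _ tendsto_const tendsto_z_Z(2)])
      (intro always_eventually allI mult_left_mono mult_nonneg_nonneg run_mass_bounds of_nat_0_le_iff)+
  ultimately have "(\<lambda>N. block_mass i 0 - block_mass i N - real N * run_mass i N) \<longlonglongrightarrow> block_mass i 0 - 0 - 0"
    by (intro tendsto_intros)
  then have "(\<lambda>n. real (Suc n) * (mass_const i * w i n)) sums block_mass i 0"
    unfolding sums_def e by simp
  then have s: "(\<lambda>n. mass_const i * (real (Suc n) * w i n)) sums block_mass i 0" by (simp add: mult_ac)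
  show ?thesis
  proof (cases "mass_const i = 0")
    case True
    then show ?thesis using s sums_unique2[OF s, of 0] by simp
  next
    case False
    from sums_mult[OF s, of "1 / mass_const i"] False have "(\<lambda>n. real (Suc n) * w i n) sums (block_mass i 0 / mass_const i)"
      by simp
    then show ?thesis using False by (simp add: wmean_def w_def sums_iff)
  qed
qed

text \<open>The cylinders [01] and [10] are what remains of the events x_1 = 1 and x_0 = 1 when [11]
  is removed, and these two events have equal mass by invariance.\<close>

lemma run_mass_sym: "run_mass False 0 = run_mass True 0"
proof -
  have c: "contS (\<lambda>x. of_bool (x 0))" by (rule contS_cyl[of 1]) (auto simp: same_cyl_def)
  have c2: "contS (\<lambda>x. of_bool (x 0 \<and> x 1))" by (rule contS_cyl[of 2]) (auto simp: same_cyl_def)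
  have "M (\<lambda>x. of_bool (x 0)) = M (\<lambda>x. of_bool (x 0 \<and> x 1)) + run_mass True 0"
    unfolding run_mass_def M_add[OF c2 contS_run_cyl, symmetric]
    by (rule arg_cong[of _ _ M]) (auto simp: fun_eq_iff run_cyl_def)
  moreover have "M (\<lambda>x. of_bool (left_shift x 0)) = M (\<lambda>x. of_bool (x 0 \<and> x 1)) + run_mass False 0"
    unfolding run_mass_def M_add[OF c2 contS_run_cyl, symmetric]
    by (rule arg_cong[of _ _ M]) (auto simp: fun_eq_iff run_cyl_def)
  ultimately show ?thesis using M_invariant[OF c] by simp
qed

lemma block_mass_total: "block_mass False 0 + block_mass True 0 = 1"
  unfolding block_mass_def M_add[OF contS_block contS_block, symmetric]
  by (rule trans[OF arg_cong[of _ _ M] M_1]) (auto simp: fun_eq_iff block_def)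

lemma run_mass_antimono: "run_mass i n \<le> run_mass i 0"
proof (induction n)
  case (Suc n)
  have "0 \<le> mass_const i" using phi_pos[of "\<not> i"] Z_pos by (auto simp: mass_const_def run_nu_def intro!: divide_nonneg_pos mult_nonneg_nonneg integral_nonneg)
  then have "0 \<le> mass_const i * w i n" using w_pos[of i n] by simp
  then show ?case using Suc run_mass_step[of i n] by linarith
qed simp

lemma block_mass_eq: "block_mass i 0 = run_mass False 0 * (GG i / FF i)"
  using run_mass_0[of i] block_mass_0[of i] FF_pos[of i] run_mass_sym by (cases i) (auto simp: field_simps)

lemma M_abs_diff_le:
  assumes "contS f" "contS g" "contS h" "\<And>x. \<bar>f x - g x\<bar> \<le> h x"
  shows "\<bar>M f - M g\<bar> \<le> M h"
proof -
  have "M f \<le> M (\<lambda>x. g x + h x)" "M g \<le> M (\<lambda>x. f x + h x)"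
    using assms(4) by (auto intro!: M_mono contS_add assms(1-3) simp: abs_le_iff algebra_simps)
  then show ?thesis using assms(1-3) by (auto simp: M_add abs_le_iff)
qed

lemma M_sum: "finite I \<Longrightarrow> (\<And>k. k \<in> I \<Longrightarrow> contS (f k)) \<Longrightarrow>
    contS (\<lambda>x. \<Sum>k\<in>I. f k x) \<and> M (\<lambda>x. \<Sum>k\<in>I. f k x) = (\<Sum>k\<in>I. M (f k))"
proof (induction I rule: finite_induct)
  case empty
  then show ?case by (simp add: M_def)
next
  case (insert k I)
  then show ?case by (auto simp: M_add contS_add)
qed

text \<open>Compare \<open>f\<close> with the function equal to \<open>f zeros\<close> on [0] and to
  \<open>f ones\<close> on [1]. If the first n symbols of x agree, the error is at most e. Otherwise
  it is at most 2 C, and x lies in one of at most n cylinders for each initial symbol, each of mass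
  at most that of [01]; this accounts for the factor 4 C n.\<close>

lemma M_estimate:
  assumes f: "contS f" and C: "\<And>x. \<bar>f x\<bar> \<le> C" and e: "\<And>x y. same_cyl n x y \<Longrightarrow> \<bar>f x - f y\<bar> \<le> e"
  shows "\<bar>M f - (block_mass False 0 * f zeros + block_mass True 0 * f ones)\<bar> \<le> e + 4 * C * real n * run_mass False 0"
proof -
  define g where "g = (\<lambda>x. f zeros * of_bool (x \<in> block False (Suc 0)) + f ones * of_bool (x \<in> block True (Suc 0)))"
  define h where "h = (\<lambda>x. \<Sum>k<n. of_bool (x \<in> run_cyl False (Suc k)) + (of_bool (x \<in> run_cyl True (Suc k)) :: real))"
  have C0: "0 \<le> C" using C[of zeros] by linarith
  have cg: "contS g" unfolding g_def by (intro contS_add contS_mult) auto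
  have "M g = block_mass False 0 * f zeros + block_mass True 0 * f ones"
    unfolding g_def by (subst M_add) (auto intro!: contS_mult simp: M_scale block_mass_def)
  moreover have "\<bar>M f - M g\<bar> \<le> M (\<lambda>x. e + 2 * C * h x)"
  proof (rule M_abs_diff_le[OF f cg])
    show "contS (\<lambda>x. e + 2 * C * h x)"
      unfolding h_def by (intro contS_add contS_mult M_sum[THEN conjunct1]) auto
    fix x
    have h0: "0 \<le> h x" unfolding h_def by (intro sum_nonneg) auto
    have gx: "g x = f (\<lambda>_. x 0)"
      by (cases "x 0") (auto simp: g_def block_def zeros_def ones_def)
    show "\<bar>f x - g x\<bar> \<le> e + 2 * C * h x"
    proof (cases "\<forall>k<n. x k = x 0")
      case True
      then have "same_cyl n x (\<lambda>_. x 0)" unfolding same_cyl_def .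
      then have "\<bar>f x - g x\<bar> \<le> e" unfolding gx by (rule e)
      then show ?thesis using h0 C0 by (smt (verit) mult_nonneg_nonneg)
    next
      case False
      define m where "m = (LEAST k. x k \<noteq> x 0)"
      obtain k where k: "k < n" "x k \<noteq> x 0" using False by blast
      have m: "x m \<noteq> x 0" unfolding m_def by (rule LeastI[of "\<lambda>k. x k \<noteq> x 0", OF k(2)])
      have m_less: "m < n" unfolding m_def using Least_le[of "\<lambda>k. x k \<noteq> x 0", OF k(2)] k(1) by linarith
      have m_below: "x k = x 0" if "k < m" for k
        using not_less_Least[of k "\<lambda>k. x k \<noteq> x 0"] that unfolding m_def by blast
      from m obtain j where j: "m = Suc j" by (cases m) auto
      have "x \<in> run_cyl (x 0) (Suc j)"
        unfolding run_cyl_def mem_Collect_eq j[symmetric] using m m_below by blast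
      then have "1 \<le> of_bool (x \<in> run_cyl False (Suc j)) + (of_bool (x \<in> run_cyl True (Suc j)) :: real)"
        by (cases "x 0") auto
      also have "\<dots> \<le> h x"
        unfolding h_def using m_less j by (intro member_le_sum) auto
      finally have "2 * C * 1 \<le> 2 * C * h x" using C0 by (intro mult_left_mono) auto
      moreover have "\<bar>f x - g x\<bar> \<le> 2 * C" unfolding gx using C[of x] C[of "\<lambda>_. x 0"] by linarith
      moreover have "0 \<le> e" using e[of x x] by simp
      ultimately show ?thesis by linarith
    qed
  qed
  moreover have "M (\<lambda>x. e + 2 * C * h x) \<le> e + 4 * C * real n * run_mass False 0"
  proof -
    have "M (\<lambda>x. of_bool (x \<in> run_cyl False (Suc k)) + of_bool (x \<in> run_cyl True (Suc k))) \<le> 2 * run_mass False 0" for k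
      using run_mass_antimono[of False k] run_mass_antimono[of True k] run_mass_sym by (simp add: M_add run_mass_def)
    then have "M h \<le> real n * (2 * run_mass False 0)"
      unfolding h_def by (subst M_sum[THEN conjunct2]) (auto intro!: contS_add sum_bounded_above[of "{..<n}", simplified])
    moreover have "M (\<lambda>x. e + 2 * C * h x) = e + 2 * C * M h"
    proof -
      have "M (\<lambda>x. e * 1 + 2 * C * h x) = e * M (\<lambda>x. 1) + 2 * C * M h"
        unfolding M_scale[symmetric] h_def by (intro M_add contS_mult M_sum[THEN conjunct1]) (auto intro!: contS_add)
      then show ?thesis by (simp add: M_1)
    qed
    ultimately show ?thesis using C0 mult_left_mono[of "M h" "real n * (2 * run_mass False 0)" "2 * C"] by (simp add: mult_ac)
  qed
  ultimately show ?thesis by linarith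
qed

end

section \<open>The renewal description of a family of Gibbs measures\<close>

context potential
begin

abbreviation total_weight :: "real \<Rightarrow> real \<Rightarrow> real" where
  "total_weight \<beta> z \<equiv> wsum (cost False) \<beta> z * wsum (cost True) \<beta> z"

abbreviation mean_run :: "bool \<Rightarrow> real \<Rightarrow> real \<Rightarrow> real" where
  "mean_run i \<beta> z \<equiv> wmean (cost i) \<beta> z / wsum (cost i) \<beta> z"

text \<open>Here \<open>t\<close> is the common mass of [01] and [10]. The masses of [0] and [1] are
  \<open>t\<close> times the mean run lengths, so up to an error proportional to \<open>t\<close>
  the measure is a function of \<open>z\<close> alone.\<close>

lemma gibbs_renewal:
  assumes "gibbs H \<beta> \<mu>" "0 < \<beta>"
  obtains z t where "0 < z" "z < 1" "total_weight \<beta> z = 1"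
    "t * (mean_run False \<beta> z + mean_run True \<beta> z) = 1"
    "\<And>f C n e. \<lbrakk>contS f; \<And>x. \<bar>f x\<bar> \<le> C; \<And>x y. same_cyl n x y \<Longrightarrow> \<bar>f x - f y\<bar> \<le> e\<rbrakk> \<Longrightarrow>
      \<bar>integral\<^sup>L \<mu> f - (t * mean_run False \<beta> z * f zeros + t * mean_run True \<beta> z * f ones)\<bar>
        \<le> e + 4 * C * real n * t"
proof -
  obtain \<Phi> lam \<nu> where g: "0 < lam" "contS \<Phi>" "\<forall>x. 0 < \<Phi> x" "\<forall>x. \<Phi> x \<le> 1"
    "\<forall>x. transfer H \<beta> \<Phi> x = lam * \<Phi> x" "prob_space \<nu>" "sets \<nu> = sets Sigma_M"
    "\<forall>f. contS f \<longrightarrow> integral\<^sup>L \<nu> (transfer H \<beta> f) = lam * integral\<^sup>L \<nu> f"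
    "\<mu> = density \<nu> (\<lambda>x. ennreal (\<Phi> x / integral\<^sup>L \<nu> \<Phi>))"
    using assms(1) unfolding gibbs_def by blast
  interpret prob_space \<nu> by fact
  interpret gibbs_state H A B Binf \<nu> \<beta> lam \<Phi>
    by unfold_locales (use g assms(2) in auto)
  show thesis
  proof (rule that[OF z_bounds(1,2) FF_prod])
    show "run_mass False 0 * (GG False / FF False + GG True / FF True) = 1"
      using block_mass_total by (simp add: block_mass_eq distrib_left)
    fix f :: "seq \<Rightarrow> real" and C n e
    assume f: "contS f" "\<And>x. \<bar>f x\<bar> \<le> C" "\<And>x y. same_cyl n x y \<Longrightarrow> \<bar>f x - f y\<bar> \<le> e"
    have "integral\<^sup>L \<mu> f = M f" unfolding g(9) by (rule M_density) fact
    then show "\<bar>integral\<^sup>L \<mu> f - (run_mass False 0 * (GG False / FF False) * f zeros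
        + run_mass False 0 * (GG True / FF True) * f ones)\<bar> \<le> e + 4 * C * real n * run_mass False 0"
      using M_estimate[OF f] by (simp add: block_mass_eq)
  qed
qed


end

text \<open>The factor \<open>K\<close> may depend on e: it will contain the cylinder depth at which
  the test function varies by less than e.\<close>

lemma tendsto_by_epsilon_bound:
  fixes g :: "'a \<Rightarrow> real"
  assumes "\<And>e. 0 < e \<Longrightarrow> \<exists>K. \<forall>\<^sub>F s in F. \<bar>g s - l s\<bar> \<le> e + K * t s" "(t \<longlongrightarrow> 0) F" "(l \<longlongrightarrow> L) F"
  shows "(g \<longlongrightarrow> L) F"
proof -
  have "((\<lambda>s. g s - l s) \<longlongrightarrow> 0) F"
  proof (rule tendstoI)
    fix e :: real assume e: "0 < e"
    then obtain K where K: "\<forall>\<^sub>F s in F. \<bar>g s - l s\<bar> \<le> e / 2 + K * t s" using assms(1)[of "e/2"] by auto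
    have "((\<lambda>s. K * t s) \<longlongrightarrow> K * 0) F" by (intro tendsto_intros assms)
    then have "\<forall>\<^sub>F s in F. K * t s < e / 2" by (rule order_tendstoD) (use e in simp)
    with K show "\<forall>\<^sub>F s in F. dist (g s - l s) 0 < e" by eventually_elim (auto simp: dist_real_def)
  qed
  from tendsto_add[OF this assms(3)] show ?thesis by simp
qed

context potential
begin

text \<open>The filter is arbitrary, so that the statement serves both the full limit and limits
  along sequences. The fugacity is chosen once for every \<open>\<beta>\<close>, independently of
  the filter.\<close>

lemma gibbs_renewal_family:
  assumes "\<And>\<beta>. 0 < \<beta> \<Longrightarrow> gibbs H \<beta> (\<mu> \<beta>)"
  obtains z where "\<And>\<beta>. 0 < \<beta> \<Longrightarrow> 0 < z \<beta> \<and> z \<beta> < 1 \<and> total_weight \<beta> (z \<beta>) = 1"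
    "\<And>F g p. \<lbrakk>filterlim g at_top F;
        ((\<lambda>s. 1 / (mean_run False (g s) (z (g s)) + mean_run True (g s) (z (g s)))) \<longlongrightarrow> 0) F;
        ((\<lambda>s. mean_run True (g s) (z (g s)) / (mean_run False (g s) (z (g s)) + mean_run True (g s) (z (g s)))) \<longlongrightarrow> p) F\<rbrakk>
      \<Longrightarrow> weak_star (\<lambda>s. \<mu> (g s)) (\<lambda>f. (1 - p) * f zeros + p * f ones) F"
proof -
  define P where "P = (\<lambda>\<beta> z t. 0 < z \<and> z < 1 \<and> total_weight \<beta> z = 1 \<and>
    t * (mean_run False \<beta> z + mean_run True \<beta> z) = 1 \<and>
    (\<forall>f C n e. contS f \<longrightarrow> (\<forall>x. \<bar>f x\<bar> \<le> C) \<longrightarrow> (\<forall>x y. same_cyl n x y \<longrightarrow> \<bar>f x - f y\<bar> \<le> e) \<longrightarrow>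
      \<bar>integral\<^sup>L (\<mu> \<beta>) f - (t * mean_run False \<beta> z * f zeros + t * mean_run True \<beta> z * f ones)\<bar>
        \<le> e + 4 * C * real n * t))"
  have "\<exists>z t. P \<beta> z t" if "0 < \<beta>" for \<beta>
    using gibbs_renewal[OF assms[OF that] that] unfolding P_def by metis
  then obtain z t where zt: "\<And>\<beta>. 0 < \<beta> \<Longrightarrow> P \<beta> (z \<beta>) (t \<beta>)" by metis
  show thesis
  proof (rule that)
    show "0 < z \<beta> \<and> z \<beta> < 1 \<and> total_weight \<beta> (z \<beta>) = 1" if "0 < \<beta>" for \<beta>
      using zt[OF that] by (simp add: P_def)
    fix F g p
    define R where "R = (\<lambda>i s. mean_run i (g s) (z (g s)))"
    assume g: "filterlim g at_top F" and l0: "((\<lambda>s. 1 / (R False s + R True s)) \<longlongrightarrow> 0) F"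
      and l1: "((\<lambda>s. R True s / (R False s + R True s)) \<longlongrightarrow> p) F"
    have pos: "\<forall>\<^sub>F s in F. 0 < g s" using g by (simp add: filterlim_at_top_dense)
    have t: "t (g s) = 1 / (R False s + R True s)" if "0 < g s" for s
      using zt[OF that] unfolding P_def R_def by (metis mult_zero_right nonzero_eq_divide_eq zero_neq_one)
    show "weak_star (\<lambda>s. \<mu> (g s)) (\<lambda>f. (1 - p) * f zeros + p * f ones) F"
      unfolding weak_star_def
    proof (intro allI impI)
      fix f assume f: "contS f"
      obtain C where C: "\<And>x. \<bar>f x\<bar> \<le> C" using contS_bounded[OF f] by blast
      show "((\<lambda>s. integral\<^sup>L (\<mu> (g s)) f) \<longlongrightarrow> (1 - p) * f zeros + p * f ones) F"
      proof (rule tendsto_by_epsilon_bound)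
        show "((\<lambda>s. (1 - R True s / (R False s + R True s)) * f zeros
            + R True s / (R False s + R True s) * f ones) \<longlongrightarrow> (1 - p) * f zeros + p * f ones) F"
          by (intro tendsto_intros l1)
        fix e :: real assume "0 < e"
        then obtain n where n: "\<And>x y. same_cyl n x y \<Longrightarrow> \<bar>f x - f y\<bar> < e" using contS_uniform[OF f] by blast
        have "\<forall>\<^sub>F s in F. \<bar>integral\<^sup>L (\<mu> (g s)) f - ((1 - R True s / (R False s + R True s)) * f zeros
            + R True s / (R False s + R True s) * f ones)\<bar> \<le> e + (4 * C * real n) * (1 / (R False s + R True s))"
          using pos
        proof eventually_elim
          case (elim s)
          have 1: "t (g s) * (R False s + R True s) = 1"
            using zt[OF elim] by (simp add: P_def R_def)
          then have "R False s + R True s \<noteq> 0" by auto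
          then have "t (g s) * R True s = R True s / (R False s + R True s)"
            "t (g s) * R False s = 1 - R True s / (R False s + R True s)"
            using t[OF elim] by (auto simp: field_simps)
          moreover have "\<bar>integral\<^sup>L (\<mu> (g s)) f - (t (g s) * R False s * f zeros + t (g s) * R True s * f ones)\<bar>
              \<le> e + 4 * C * real n * t (g s)"
            using zt[OF elim] f C n unfolding P_def R_def by (meson less_imp_le)
          ultimately show ?case using t[OF elim] by simp
        qed
        then show "\<exists>K. \<forall>\<^sub>F s in F. \<bar>integral\<^sup>L (\<mu> (g s)) f - ((1 - R True s / (R False s + R True s)) * f zeros
            + R True s / (R False s + R True s) * f ones)\<bar> \<le> e + K * (1 / (R False s + R True s))" by blast
      qed (rule l0)
    qed
  qed
qed

end

section \<open>Asymptotics of the renewal equation\<close>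

lemma exp_weight_diff:
  fixes \<beta> :: real
  assumes "0 \<le> \<beta>" "\<eta> \<le> a" "\<eta> \<le> b"
  shows "\<bar>exp (- \<beta> * a) - exp (- \<beta> * b)\<bar> \<le> \<beta> * exp (- \<beta> * \<eta>) * \<bar>a - b\<bar>"
proof -
  have *: "\<bar>exp (- \<beta> * a) - exp (- \<beta> * b)\<bar> \<le> \<beta> * exp (- \<beta> * \<eta>) * \<bar>a - b\<bar>"
    if "\<eta> \<le> a" "a \<le> b" for a b
  proof -
    have "exp (- \<beta> * b) = exp (- \<beta> * a) * exp (- (\<beta> * (b - a)))" by (simp add: algebra_simps flip: exp_add)
    then have "exp (- \<beta> * a) - exp (- \<beta> * b) = exp (- \<beta> * a) * (1 - exp (- (\<beta> * (b - a))))"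
      by (simp add: right_diff_distrib)
    moreover have "1 - exp (- (\<beta> * (b - a))) \<le> \<beta> * (b - a)" using exp_ge_add_one_self[of "- (\<beta> * (b - a))"] by linarith
    moreover have "0 \<le> 1 - exp (- (\<beta> * (b - a)))" using that assms by simp
    moreover have "exp (- \<beta> * a) \<le> exp (- \<beta> * \<eta>)" using that assms by (simp add: mult_left_mono)
    ultimately have "0 \<le> exp (- \<beta> * a) - exp (- \<beta> * b)"
      "exp (- \<beta> * a) - exp (- \<beta> * b) \<le> exp (- \<beta> * \<eta>) * (\<beta> * (b - a))"
      using mult_mono[of "exp (- \<beta> * a)" "exp (- \<beta> * \<eta>)" "1 - exp (- (\<beta> * (b - a)))" "\<beta> * (b - a)"] by auto
    then show ?thesis using that by (simp add: mult_ac)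
  qed
  show ?thesis using *[of a b] *[of b a] assms by (cases "a \<le> b") (auto simp: abs_minus_commute)
qed

lemma summable_weighted:
  fixes v h :: "nat \<Rightarrow> real"
  assumes "summable v" "\<And>n. 0 \<le> v n" "\<And>n. 0 \<le> h n" "0 \<le> \<beta>"
  shows "summable (\<lambda>n. v n * exp (- \<beta> * h n))"
proof (rule summable_comparison_test'[OF assms(1)])
  show "norm (v n * exp (- \<beta> * h n)) \<le> v n" if "0 \<le> n" for n
    using assms(2-4) by (auto simp: abs_mult intro!: mult_left_le)
qed

lemma summable_dist_tendsto:
  fixes h :: "nat \<Rightarrow> real"
  assumes "summable (\<lambda>n. \<bar>h n - l\<bar>)" shows "h \<longlonglongrightarrow> l"
  using tendsto_rabs_zero_cancel[OF summable_LIMSEQ_zero[OF assms]] by (rule LIM_zero_cancel)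

text \<open>Beyond \<open>N\<close> the costs are replaced by their limit \<open>l\<close>; the
  first \<open>N\<close> terms stay exact, since after multiplication by
  \<open>exp (\<beta> * c)\<close> some of them need not be small. For \<open>c < \<eta>\<close> the
  error vanishes as \<open>\<beta>\<close> grows, and it does not depend on the weights
  \<open>v\<close>, hence not on the fugacity.\<close>

lemma weighted_sum_expand:
  fixes v h :: "nat \<Rightarrow> real"
  assumes v: "summable v" "\<And>n. 0 \<le> v n" "\<And>n. v n \<le> 1" and h: "\<And>n. 0 \<le> h n" "\<And>n. N \<le> n \<Longrightarrow> \<eta> \<le> h n"
    and s: "summable (\<lambda>n. \<bar>h n - l\<bar>)" and b: "0 \<le> \<beta>"
  shows "\<bar>exp (\<beta> * c) * (\<Sum>n. v n * exp (- \<beta> * h n)) - ((\<Sum>n<N. v n * exp (- \<beta> * (h n - c)))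
      + exp (- \<beta> * (l - c)) * (suminf v - (\<Sum>n<N. v n)))\<bar> \<le> \<beta> * exp (- \<beta> * (\<eta> - c)) * (\<Sum>n. \<bar>h n - l\<bar>)"
proof -
  have "\<forall>\<^sub>F n in sequentially. \<eta> \<le> h n" using h(2) eventually_sequentially by blast
  then have l: "\<eta> \<le> l" using tendsto_lowerbound[OF summable_dist_tendsto[OF s]] by simp
  have sw: "summable (\<lambda>n. v n * exp (- \<beta> * h n))" by (rule summable_weighted) (use v h b in auto)
  note sN = summable_iff_shift[THEN iffD2, of _ N]
  let ?d = "\<lambda>n. v (n + N) * (exp (- \<beta> * h (n + N)) - exp (- \<beta> * l))"
  let ?e = "\<lambda>n. \<beta> * exp (- \<beta> * \<eta>) * \<bar>h (n + N) - l\<bar>"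
  have de: "\<bar>?d n\<bar> \<le> ?e n" for n
  proof -
    have "\<bar>?d n\<bar> \<le> 1 * \<bar>exp (- \<beta> * h (n + N)) - exp (- \<beta> * l)\<bar>"
      unfolding abs_mult using v by (intro mult_right_mono) auto
    also have "\<dots> \<le> ?e n" using exp_weight_diff[OF b h(2)[of "n + N"] l] by simp
    finally show ?thesis .
  qed
  have se: "summable ?e" by (intro summable_mult sN s)
  have sd: "summable ?d" by (rule summable_comparison_test'[OF se]) (use de in auto)
  have "\<bar>suminf ?d\<bar> \<le> suminf ?e"
    using summable_rabs_comparison_test[of ?d ?e] de se
    by (intro order_trans[OF summable_rabs suminf_le]) auto
  also have "suminf ?e \<le> \<beta> * exp (- \<beta> * \<eta>) * (\<Sum>n. \<bar>h n - l\<bar>)"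
  proof -
    have "(\<Sum>n. \<bar>h (n + N) - l\<bar>) \<le> (\<Sum>n. \<bar>h n - l\<bar>)"
      using suminf_split_initial_segment[OF s, of N] by (simp add: sum_nonneg)
    then have "\<beta> * exp (- \<beta> * \<eta>) * (\<Sum>n. \<bar>h (n + N) - l\<bar>) \<le> \<beta> * exp (- \<beta> * \<eta>) * (\<Sum>n. \<bar>h n - l\<bar>)"
      using b by (intro mult_left_mono) auto
    then show ?thesis using suminf_mult[OF sN[OF s], of "\<beta> * exp (- \<beta> * \<eta>)"] by simp
  qed
  finally have D: "\<bar>suminf ?d\<bar> \<le> \<beta> * exp (- \<beta> * \<eta>) * (\<Sum>n. \<bar>h n - l\<bar>)" .
  have "suminf ?d = (\<Sum>n. v (n + N) * exp (- \<beta> * h (n + N))) - (\<Sum>n. v (n + N) * exp (- \<beta> * l))"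
    unfolding right_diff_distrib
    by (intro suminf_diff[symmetric] sN[OF sw] summable_mult2 sN[OF v(1)])
  also have "(\<Sum>n. v (n + N) * exp (- \<beta> * l)) = (suminf v - (\<Sum>n<N. v n)) * exp (- \<beta> * l)"
    using suminf_mult2[OF sN[OF v(1)], of "exp (- \<beta> * l)"] suminf_minus_initial_segment[OF v(1), of N] by simp
  also have "(\<Sum>n. v (n + N) * exp (- \<beta> * h (n + N))) =
      (\<Sum>n. v n * exp (- \<beta> * h n)) - (\<Sum>n<N. v n * exp (- \<beta> * h n))"
    by (rule suminf_minus_initial_segment[OF sw])
  finally have E: "(\<Sum>n. v n * exp (- \<beta> * h n)) = suminf ?d + (\<Sum>n<N. v n * exp (- \<beta> * h n))
      + (suminf v - (\<Sum>n<N. v n)) * exp (- \<beta> * l)" by simp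
  have ee: "exp (\<beta> * c) * exp (- \<beta> * a) = exp (- \<beta> * (a - c))" for a
    by (simp add: algebra_simps flip: exp_add)
  have "exp (\<beta> * c) * (\<Sum>n<N. v n * exp (- \<beta> * h n)) = (\<Sum>n<N. v n * exp (- \<beta> * (h n - c)))"
    unfolding sum_distrib_left ee[symmetric] by (intro sum.cong) (simp_all only: mult_ac)
  then have "exp (\<beta> * c) * (\<Sum>n. v n * exp (- \<beta> * h n)) - ((\<Sum>n<N. v n * exp (- \<beta> * (h n - c)))
      + exp (- \<beta> * (l - c)) * (suminf v - (\<Sum>n<N. v n))) = exp (\<beta> * c) * suminf ?d"
    unfolding E ee[of l, symmetric] by (simp only: algebra_simps)
  also have "\<bar>\<dots>\<bar> \<le> exp (\<beta> * c) * (\<beta> * exp (- \<beta> * \<eta>) * (\<Sum>n. \<bar>h n - l\<bar>))"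
    unfolding abs_mult using D by (simp add: mult_left_mono del: mult_minus_left)
  also have "\<dots> = \<beta> * exp (- \<beta> * (\<eta> - c)) * (\<Sum>n. \<bar>h n - l\<bar>)"
    unfolding ee[of \<eta>, symmetric] by (simp only: mult_ac)
  finally show ?thesis .
qed

text \<open>The factors of \<open>wmean\<close> rescaled by (1 - z) / z. In this normalisation they
  are at most 1 for every z, as \<open>weighted_sum_expand\<close> requires, and their sum 1 / (1 -
  z) is of the same order as that of the factors of \<open>wsum\<close>.\<close>

abbreviation len_weight :: "real \<Rightarrow> nat \<Rightarrow> real" where
  "len_weight z n \<equiv> (1 - z) * (real (Suc n) * z ^ n)"

lemma geometric_weights:
  fixes z :: real
  assumes "0 < z" "z < 1"
  shows "(\<lambda>n. z ^ Suc n) sums (z / (1 - z))" "z ^ Suc n \<le> 1"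
    and "(\<lambda>n. len_weight z n) sums (1 / (1 - z))" "len_weight z n \<le> 1"
proof -
  show "(\<lambda>n. z ^ Suc n) sums (z / (1 - z))"
    using sums_mult[OF geometric_sums[of z], of z] assms by simp
  show "z ^ Suc n \<le> 1" using assms by (intro power_le_one) auto
  have "(\<lambda>n. (1 - z) * (of_nat (Suc n) * z ^ n)) sums ((1 - z) * (1 / (1 - z) ^ 2))"
    using assms by (intro sums_mult geometric_deriv_sums) auto
  then show "(\<lambda>n. len_weight z n) sums (1 / (1 - z))"
    using assms by (simp add: power2_eq_square)
  have "real (Suc n) * z ^ n = (\<Sum>k<Suc n. z ^ n)" by simp
  also have "\<dots> \<le> (\<Sum>k<Suc n. z ^ k)" using assms by (intro sum_mono power_decreasing) auto
  finally have "len_weight z n \<le> (1 - z) * (\<Sum>k<Suc n. z ^ k)"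
    using assms by (intro mult_left_mono) auto
  also have "\<dots> = 1 - z ^ Suc n" by (rule one_diff_power_eq[symmetric])
  finally show "len_weight z n \<le> 1" using assms zero_le_power[of z "Suc n"] by linarith
qed

lemma summable_wsum:
  fixes h :: "nat \<Rightarrow> real"
  assumes "0 < z" "z < 1" "\<And>n. 0 \<le> h n" "0 \<le> \<beta>"
  shows "summable (\<lambda>n. z ^ Suc n * exp (- \<beta> * h n))"
  using geometric_weights(1)[OF assms(1,2)] assms by (intro summable_weighted) (auto simp: sums_iff)

lemma summable_wmean_scaled:
  assumes "0 < z" "z < 1" "\<And>n. 0 \<le> h n" "0 \<le> \<beta>"
  shows "summable (\<lambda>n. len_weight z n * exp (- \<beta> * h n))"
  using geometric_weights(3)[OF assms(1,2)] assms by (intro summable_weighted) (auto simp: sums_iff)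

lemma wmean_scaled:
  assumes "0 < z" "z < 1" "\<And>n. 0 \<le> h n" "0 \<le> \<beta>"
  shows "(1 - z) / z * wmean h \<beta> z = (\<Sum>n. len_weight z n * exp (- \<beta> * h n))"
proof -
  from summable_mult[OF summable_wmean_scaled[OF assms], of "z / (1 - z)"]
  have "summable (\<lambda>n. real (Suc n) * (z ^ Suc n * exp (- \<beta> * h n)))"
    using assms(1,2) by (simp add: mult_ac)
  from suminf_mult[OF this, of "(1 - z) / z"] show ?thesis
    using assms(1,2) by (simp add: wmean_def mult_ac)
qed

lemma wsum_pos:
  assumes "0 < z" "z < 1" "\<And>n. 0 \<le> h n" "0 \<le> \<beta>" shows "0 < wsum h \<beta> z"
  unfolding wsum_def by (rule suminf_pos[OF summable_wsum]) (use assms in auto)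

lemma wsum_mono:
  assumes "0 < z" "z \<le> z'" "z' < 1" "\<And>n. 0 \<le> h n" "0 \<le> \<beta>" shows "wsum h \<beta> z \<le> wsum h \<beta> z'"
  unfolding wsum_def
  by (intro suminf_le summable_wsum mult_right_mono power_mono) (use assms in auto)

lemma wsum_tendsto_0:
  fixes z :: real
  assumes z: "0 < z" "z < 1" and h: "\<And>n. 0 < h n" and g: "filterlim g at_top F"
  shows "((\<lambda>s. wsum h (g s) z) \<longlongrightarrow> 0) F"
proof (rule tendstoI)
  fix e :: real assume e: "0 < e"
  have "(\<lambda>N. z ^ N * (z / (1 - z))) \<longlonglongrightarrow> 0 * (z / (1 - z))"
    using z by (intro tendsto_intros LIMSEQ_power_zero) auto
  then have "\<forall>\<^sub>F N in sequentially. z ^ N * (z / (1 - z)) < e / 2" using e by (intro order_tendstoD) auto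
  then obtain N where N: "z ^ N * (z / (1 - z)) < e / 2" by (auto simp: eventually_sequentially)
  have pos: "\<forall>\<^sub>F s in F. 0 < g s" using g by (simp add: filterlim_at_top_dense)
  have "((\<lambda>s. exp (- (g s * h n))) \<longlongrightarrow> 0) F" for n
  proof -
    have "filterlim (\<lambda>s. g s * h n) at_top F"
      using filterlim_tendsto_pos_mult_at_top[OF tendsto_const[of "h n"] h g] by (simp add: mult.commute)
    then show ?thesis by (intro filterlim_compose[OF exp_at_bot] filterlim_compose[OF filterlim_uminus_at_bot_at_top])
  qed
  then have "((\<lambda>s. \<Sum>n<N. z ^ Suc n * exp (- (g s * h n))) \<longlongrightarrow> (\<Sum>n<N. z ^ Suc n * 0)) F"
    by (intro tendsto_intros)
  then have "\<forall>\<^sub>F s in F. (\<Sum>n<N. z ^ Suc n * exp (- (g s * h n))) < e / 2"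
    using e by (intro order_tendstoD) auto
  with pos show "\<forall>\<^sub>F s in F. dist (wsum h (g s) z) 0 < e"
  proof eventually_elim
    case (elim s)
    have h0: "0 \<le> h n" for n using h[of n] by simp
    have sm: "summable (\<lambda>n. z ^ Suc n * exp (- g s * h n))"
      using z h0 elim by (intro summable_wsum) auto
    have gs: "(\<lambda>n. z ^ N * z ^ Suc n) sums (z ^ N * (z / (1 - z)))"
      by (intro sums_mult geometric_weights z)
    have "(\<Sum>n. z ^ Suc (n + N) * exp (- g s * h (n + N))) \<le> (\<Sum>n. z ^ N * z ^ Suc n)"
    proof (rule suminf_le[OF _ summable_iff_shift[THEN iffD2, OF sm] sums_summable[OF gs]])
      show "z ^ Suc (n + N) * exp (- g s * h (n + N)) \<le> z ^ N * z ^ Suc n" for n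
        using elim z h0[of "n + N"] mult_left_le[of "exp (- g s * h (n + N))" "z ^ Suc (n + N)"]
        by (simp add: power_add mult_ac)
    qed
    then have "(\<Sum>n. z ^ Suc (n + N) * exp (- g s * h (n + N))) < e / 2"
      unfolding sums_unique[OF gs, symmetric] using N by linarith
    moreover have "0 < wsum h (g s) z" using z h0 elim by (intro wsum_pos) auto
    ultimately show ?case
      using elim suminf_split_initial_segment[OF sm, of N] by (simp add: wsum_def dist_real_def)
  qed
qed

text \<open>If \<open>z\<close> were at most some a' below 1, monotonicity would bound the product
  by its value at a', which tends to 0 because all costs are positive. But the product is 1.\<close>

lemma fugacity_tendsto_1:
  fixes z :: "'a \<Rightarrow> real"
  assumes h: "\<And>n. 0 < h0 n" "\<And>n. 0 < h1 n" and g: "filterlim g at_top F"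
    and z: "\<And>s. 0 < g s \<Longrightarrow> 0 < z s \<and> z s < 1 \<and> wsum h0 (g s) (z s) * wsum h1 (g s) (z s) = 1"
  shows "(z \<longlongrightarrow> 1) F"
proof (rule order_tendstoI)
  have pos: "\<forall>\<^sub>F s in F. 0 < g s" using g by (simp add: filterlim_at_top_dense)
  show "\<forall>\<^sub>F s in F. z s < b" if "1 < b" for b
    using pos by eventually_elim (use z that in force)
  fix a :: real assume a: "a < 1"
  define a' where "a' = max a (1/2)"
  have a': "0 < a'" "a' < 1" "a \<le> a'" using a by (auto simp: a'_def)
  have "((\<lambda>s. wsum h0 (g s) a' * wsum h1 (g s) a') \<longlongrightarrow> 0 * 0) F"
    by (intro tendsto_intros wsum_tendsto_0 a' h g)
  then have "\<forall>\<^sub>F s in F. wsum h0 (g s) a' * wsum h1 (g s) a' < 1" by (intro order_tendstoD) auto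
  with pos show "\<forall>\<^sub>F s in F. a < z s"
  proof eventually_elim
    case (elim s)
    show ?case
    proof (rule ccontr)
      assume "\<not> a < z s"
      then have le: "z s \<le> a'" using a' by simp
      have h': "0 \<le> h0 n" "0 \<le> h1 n" for n using h[of n] by auto
      have "wsum h0 (g s) (z s) * wsum h1 (g s) (z s) \<le> wsum h0 (g s) a' * wsum h1 (g s) a'"
        using z[OF elim(1)] le a' elim(1) h'
        by (intro mult_mono wsum_mono less_imp_le[OF wsum_pos]) auto
      then show False using z[OF elim(1)] elim(2) by simp
    qed
  qed
qed

lemma eventually_gt_limit:
  fixes h :: "nat \<Rightarrow> real"
  assumes "summable (\<lambda>n. \<bar>h n - l\<bar>)" "c < l"
  obtains N \<eta> where "c < \<eta>" "\<And>n. N \<le> n \<Longrightarrow> \<eta> \<le> h n"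
proof -
  have "\<forall>\<^sub>F n in sequentially. (c + l) / 2 < h n"
    using assms(2) by (intro order_tendstoD(1)[OF summable_dist_tendsto[OF assms(1)]]) simp
  then obtain N where N: "\<forall>n\<ge>N. (c + l) / 2 < h n" unfolding eventually_sequentially by blast
  show thesis
  proof (rule that)
    show "c < (c + l) / 2" using assms(2) by simp
    show "(c + l) / 2 \<le> h n" if "N \<le> n" for n using N that by (meson less_imp_le)
  qed
qed

lemma positive_lower_bound:
  fixes h :: "nat \<Rightarrow> real"
  assumes "summable (\<lambda>n. \<bar>h n - l\<bar>)" "0 < l" "\<And>n. 0 < h n"
  obtains \<eta> where "0 < \<eta>" "\<And>n. \<eta> \<le> h n"
proof -
  obtain N \<eta> where N: "0 < \<eta>" "\<And>n. N \<le> n \<Longrightarrow> \<eta> \<le> h n"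
    using eventually_gt_limit[OF assms(1,2)] by metis
  define m where "m = Min (insert \<eta> (h ` {..<N}))"
  have "0 < m" unfolding m_def using N(1) assms(3) by (subst Min_gr_iff) auto
  moreover have "m \<le> h n" for n
  proof (cases "n < N")
    case True
    then show ?thesis unfolding m_def by (intro Min_le) auto
  next
    case False
    then have "\<eta> \<le> h n" using N by simp
    moreover have "m \<le> \<eta>" unfolding m_def by (intro Min_le) auto
    ultimately show ?thesis by simp
  qed
  ultimately show thesis using that by blast
qed

lemma lin_exp_tendsto_0:
  assumes "0 < c" "filterlim g at_top F"
  shows "((\<lambda>s. g s * exp (- g s * c) * D) \<longlongrightarrow> (0::real)) F"
proof -
  have "((\<lambda>x::real. x * exp (- x * c) * D) \<longlongrightarrow> 0) at_top" using assms(1) by real_asymp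
  from filterlim_compose[OF this assms(2)] show ?thesis .
qed

lemma exp_tendsto_0:
  assumes "0 < c" "filterlim g at_top F"
  shows "((\<lambda>s. exp (- g s * c)) \<longlongrightarrow> (0::real)) F"
proof -
  have "((\<lambda>x::real. exp (- x * c)) \<longlongrightarrow> 0) at_top" using assms(1) by real_asymp
  from filterlim_compose[OF this assms(2)] show ?thesis .
qed

lemma tendsto_of_abs_le:
  fixes f l e :: "'a \<Rightarrow> real"
  assumes "\<forall>\<^sub>F s in F. \<bar>f s - l s\<bar> \<le> e s" "(e \<longlongrightarrow> 0) F"
  shows "((\<lambda>s. f s - l s) \<longlongrightarrow> 0) F"
  by (rule Lim_null_comparison[OF _ assms(2)]) (use assms(1) in simp)

text \<open>An a priori bound on \<open>X\<close> makes all error terms vanish. What remains is X^2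
  + k X - 1 = (X - x0) (X + x0 + k), whose second factor is at least \<open>x0\<close>.\<close>

lemma quadratic_root_stable:
  fixes X e1 e2 u :: "'a \<Rightarrow> real"
  assumes pos: "\<forall>\<^sub>F s in F. 0 < X s" and eq: "\<forall>\<^sub>F s in F. (X s + e1 s) * (X s * u s + k + e2 s) = 1"
    and lim: "(e1 \<longlongrightarrow> 0) F" "(e2 \<longlongrightarrow> 0) F" "(u \<longlongrightarrow> 1) F"
    and k: "0 \<le> k" and x0: "0 < x0" "x0\<^sup>2 + k * x0 = 1"
  shows "(X \<longlongrightarrow> x0) F"
proof -
  have "\<forall>\<^sub>F s in F. \<bar>e1 s\<bar> < 1/2" "\<forall>\<^sub>F s in F. \<bar>e2 s\<bar> < 1/2"
    using tendstoD[OF lim(1), of "1/2"] tendstoD[OF lim(2), of "1/2"] by simp_all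
  moreover have "\<forall>\<^sub>F s in F. 1/2 < u s" using lim(3) by (intro order_tendstoD) auto
  ultimately have bd: "\<forall>\<^sub>F s in F. \<bar>X s\<bar> \<le> 4"
    using pos eq
  proof eventually_elim
    case (elim s)
    have "X s \<le> 4"
    proof (rule ccontr)
      \<comment> \<open>Beyond 4 the first factor exceeds 3 and the second exceeds 1, because both
        errors are below 1/2 and \<open>u\<close> is above 1/2; their product could not be
        1.\<close>
      assume X: "\<not> X s \<le> 4"
      have "X s * (1/2) \<le> X s * u s" using elim by (intro mult_left_mono) auto
      then have "1 \<le> X s * u s + k + e2 s" using X elim k by linarith
      moreover have "3 \<le> X s + e1 s" using X elim by linarith
      ultimately have "3 * 1 \<le> (X s + e1 s) * (X s * u s + k + e2 s)" by (intro mult_mono) auto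
      then show False using elim by simp
    qed
    then show ?case using elim by simp
  qed
  have small: "((\<lambda>s. X s * v s) \<longlongrightarrow> 0) F" if "(v \<longlongrightarrow> 0) F" for v
  proof (rule Lim_null_comparison)
    show "\<forall>\<^sub>F s in F. norm (X s * v s) \<le> 4 * \<bar>v s\<bar>"
      using bd by eventually_elim (auto simp: abs_mult intro!: mult_right_mono)
    show "((\<lambda>s. 4 * \<bar>v s\<bar>) \<longlongrightarrow> 0) F" using tendsto_mult[OF tendsto_const[of 4] tendsto_rabs[OF that]] by simp
  qed
  have "((\<lambda>s. X s * (X s * (1 - u s)) - X s * e2 s - (X s * (e1 s * u s) + e1 s * (k + e2 s))) \<longlongrightarrow> 0 - 0 - (0 + 0 * (k + 0))) F"
    using tendsto_diff[OF tendsto_const[of 1] lim(3)] tendsto_mult[OF lim(1) lim(3)]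
    by (intro tendsto_intros small lim) auto
  moreover have "\<forall>\<^sub>F s in F. X s * (X s * (1 - u s)) - X s * e2 s - (X s * (e1 s * u s) + e1 s * (k + e2 s))
      = (X s - x0) * (X s + x0 + k)"
    using eq
  proof eventually_elim
    case (elim s)
    have "(X s - x0) * (X s + x0 + k) = X s * X s + k * X s - 1"
      using x0(2) by (simp add: algebra_simps power2_eq_square)
    then show ?case using elim by (simp add: algebra_simps)
  qed
  ultimately have p: "((\<lambda>s. (X s - x0) * (X s + x0 + k)) \<longlongrightarrow> 0) F"
    using Lim_transform_eventually by force
  have "((\<lambda>s. X s - x0) \<longlongrightarrow> 0) F"
  proof (rule Lim_null_comparison)
    show "((\<lambda>s. \<bar>(X s - x0) * (X s + x0 + k)\<bar> / x0) \<longlongrightarrow> 0) F"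
      using tendsto_divide[OF tendsto_rabs[OF p] tendsto_const[of x0]] x0 by simp
    show "\<forall>\<^sub>F s in F. norm (X s - x0) \<le> \<bar>(X s - x0) * (X s + x0 + k)\<bar> / x0"
      using pos
    proof eventually_elim
      case (elim s)
      have "\<bar>X s - x0\<bar> * x0 \<le> \<bar>X s - x0\<bar> * \<bar>X s + x0 + k\<bar>"
        using elim k x0 by (intro mult_left_mono) auto
      then show ?case by (simp only: real_norm_def abs_mult pos_le_divide_eq[OF x0(1)])
    qed
  qed
  then show ?thesis by (simp add: LIM_zero_iff)
qed

section \<open>Two wells with limit costs \<open>l0\<close> and \<open>l1\<close>\<close>

locale two_wells =
  fixes h0 h1 :: "nat \<Rightarrow> real" and l0 l1 :: real and z :: "real \<Rightarrow> real"
  assumes h_pos: "\<And>n. 0 < h0 n" "\<And>n. 0 < h1 n"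
    and h_lim: "summable (\<lambda>n. \<bar>h0 n - l0\<bar>)" "summable (\<lambda>n. \<bar>h1 n - l1\<bar>)"
    and le: "l1 \<le> l0"
    and z: "\<And>\<beta>. 0 < \<beta> \<Longrightarrow> 0 < z \<beta> \<and> z \<beta> < 1 \<and> wsum h0 \<beta> (z \<beta>) * wsum h1 \<beta> (z \<beta>) = 1"
begin

abbreviation "D0 \<equiv> (\<Sum>n. \<bar>h0 n - l0\<bar>)"
abbreviation "D1 \<equiv> (\<Sum>n. \<bar>h1 n - l1\<bar>)"

text \<open>Indices refer to the symbol of the run: \<open>h0\<close> stands for H_n^1 and
  \<open>l0\<close> for H_\<infinity>^1, so \<open>le\<close> is the hypothesis H_\<infinity>^0
  \<le> H_\<infinity>^1. The equation \<open>h0 n = \<theta>\<close> is the coincidence condition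
  counted by \<kappa>, and tilting by \<open>\<theta>\<close> moves both limit costs to (l0 + l1) /
  2.\<close>

definition "\<theta> = (l0 - l1) / 2"

lemma theta_nonneg: "0 \<le> \<theta>"
  using le by (simp add: \<theta>_def)

lemma h_nonneg: "0 \<le> h0 n" "0 \<le> h1 n"
  using h_pos[of n] by auto

lemma l_nonneg: "0 \<le> l0" "0 \<le> l1"
  using tendsto_lowerbound[OF summable_dist_tendsto[OF h_lim(1)], of 0]
    tendsto_lowerbound[OF summable_dist_tendsto[OF h_lim(2)], of 0] h_nonneg by auto

abbreviation "fin0 N \<beta> \<equiv> (\<Sum>n<N. z \<beta> ^ Suc n * exp (- \<beta> * (h0 n - \<theta>)))"
abbreviation "fin1 N \<beta> \<equiv> (\<Sum>n<N. len_weight (z \<beta>) n * exp (- \<beta> * (h0 n - \<theta>)))"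

lemma beta_pos: "\<forall>\<^sub>F \<beta> in at_top. (0::real) < \<beta>"
  by (rule eventually_gt_at_top)

lemma z_lim: "(z \<longlongrightarrow> 1) at_top"
  using h_pos z by (intro fugacity_tendsto_1[of h0 h1 "\<lambda>\<beta>. \<beta>"] filterlim_ident) auto

definition eps :: "real \<Rightarrow> real" where "eps \<beta> = (1 - z \<beta>) / z \<beta>"

lemma eps_lim: "(eps \<longlongrightarrow> 0) at_top"
proof -
  have "((\<lambda>\<beta>. (1 - z \<beta>) / z \<beta>) \<longlongrightarrow> (1 - 1) / 1) at_top" by (intro tendsto_intros z_lim) auto
  then show ?thesis by (simp add: eps_def[abs_def])
qed

lemma eps_pos: "0 < \<beta> \<Longrightarrow> 0 < eps \<beta>"
  using z[of \<beta>] by (simp add: eps_def)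

definition X :: "real \<Rightarrow> real" where "X \<beta> = exp (- \<beta> * ((l0 + l1) / 2)) / eps \<beta>"

lemma X_pos: "0 < \<beta> \<Longrightarrow> 0 < X \<beta>"
  using eps_pos[of \<beta>] by (simp add: X_def)

definition "f0 \<beta> = exp (\<beta> * \<theta>) * wsum h0 \<beta> (z \<beta>)"
definition "f1 \<beta> = exp (\<beta> * (- \<theta>)) * wsum h1 \<beta> (z \<beta>)"
definition "g0 \<beta> = exp (\<beta> * \<theta>) * (eps \<beta> * wmean h0 \<beta> (z \<beta>))"
definition "g1 \<beta> = exp (\<beta> * (- \<theta>)) * (eps \<beta> * wmean h1 \<beta> (z \<beta>))"

lemma f_prod: "0 < \<beta> \<Longrightarrow> f1 \<beta> * f0 \<beta> = 1"
  using z[of \<beta>] by (simp add: f0_def f1_def exp_minus field_simps)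

lemma f_pos: "0 < \<beta> \<Longrightarrow> 0 < f0 \<beta>" "0 < \<beta> \<Longrightarrow> 0 < f1 \<beta>"
  unfolding f0_def f1_def using z[of \<beta>] h_nonneg by (auto intro!: mult_pos_pos wsum_pos)

lemma l_theta: "l0 - \<theta> = (l0 + l1) / 2" "l1 - (- \<theta>) = (l0 + l1) / 2"
  by (simp_all add: \<theta>_def field_simps)

lemma gz: "0 < \<beta> \<Longrightarrow> z \<beta> / (1 - z \<beta>) = 1 / eps \<beta>" "0 < \<beta> \<Longrightarrow> 1 / (1 - z \<beta>) = 1 / (eps \<beta> * z \<beta>)"
  using z[of \<beta>] by (auto simp: eps_def)

lemmas gsum = geometric_weights(1)[THEN sums_unique, symmetric] geometric_weights(3)[THEN sums_unique, symmetric]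
lemmas gsumm = geometric_weights(1)[THEN sums_summable] geometric_weights(3)[THEN sums_summable]

lemma f0_expand:
  assumes "\<And>n. N \<le> n \<Longrightarrow> \<eta> \<le> h0 n" "0 < \<beta>"
  shows "\<bar>f0 \<beta> - (fin0 N \<beta>
    + X \<beta> * (1 - eps \<beta> * (\<Sum>n<N. z \<beta> ^ Suc n)))\<bar> \<le> \<beta> * exp (- \<beta> * (\<eta> - \<theta>)) * D0"
proof -
  have zz: "0 < z \<beta>" "z \<beta> < 1" using z[OF assms(2)] by auto
  have "\<bar>f0 \<beta> - (fin0 N \<beta>
    + exp (- \<beta> * (l0 - \<theta>)) * (1 / eps \<beta> - (\<Sum>n<N. z \<beta> ^ Suc n)))\<bar> \<le> \<beta> * exp (- \<beta> * (\<eta> - \<theta>)) * D0"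
    unfolding f0_def wsum_def gz(1)[OF assms(2), symmetric] gsum(1)[OF zz, symmetric]
    using assms zz h_nonneg geometric_weights(2)[OF zz]
    by (intro weighted_sum_expand gsumm h_lim) (auto simp del: power_Suc)
  moreover have "exp (- \<beta> * (l0 - \<theta>)) * (1 / eps \<beta> - (\<Sum>n<N. z \<beta> ^ Suc n)) = X \<beta> * (1 - eps \<beta> * (\<Sum>n<N. z \<beta> ^ Suc n))"
    unfolding l_theta X_def using eps_pos[OF assms(2)] by (simp add: field_simps)
  ultimately show ?thesis by simp
qed

lemma g0_expand:
  assumes "\<And>n. N \<le> n \<Longrightarrow> \<eta> \<le> h0 n" "0 < \<beta>"
  shows "\<bar>g0 \<beta> - (fin1 N \<beta>
    + X \<beta> * (1 / z \<beta> - eps \<beta> * (\<Sum>n<N. len_weight (z \<beta>) n)))\<bar>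
    \<le> \<beta> * exp (- \<beta> * (\<eta> - \<theta>)) * D0"
proof -
  have zz: "0 < z \<beta>" "z \<beta> < 1" using z[OF assms(2)] by auto
  have b: "0 \<le> \<beta>" using assms(2) by simp
  have "\<bar>g0 \<beta> - (fin1 N \<beta>
    + exp (- \<beta> * (l0 - \<theta>)) * (1 / (eps \<beta> * z \<beta>) - (\<Sum>n<N. len_weight (z \<beta>) n)))\<bar>
    \<le> \<beta> * exp (- \<beta> * (\<eta> - \<theta>)) * D0"
    unfolding g0_def eps_def[of \<beta>, symmetric] gz(2)[OF assms(2), symmetric] gsum(2)[OF zz, symmetric]
      wmean_scaled[OF zz h_nonneg(1) b, folded eps_def]
    using assms zz h_nonneg geometric_weights(4)[OF zz]
    by (intro weighted_sum_expand gsumm h_lim) auto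
  moreover have "exp (- \<beta> * (l0 - \<theta>)) * (1 / (eps \<beta> * z \<beta>) - (\<Sum>n<N. len_weight (z \<beta>) n))
     = X \<beta> * (1 / z \<beta> - eps \<beta> * (\<Sum>n<N. len_weight (z \<beta>) n))"
    unfolding l_theta X_def using eps_pos[OF assms(2)] zz by (simp add: field_simps)
  ultimately show ?thesis by simp
qed

text \<open>The tilt raises the costs of runs of ones by \<open>\<theta>\<close>. Where the estimate
  is applied they are then bounded below by a positive constant, so no initial terms have to be
  kept.\<close>

lemma f1_expand:
  assumes "\<And>n. \<eta> \<le> h1 n" "0 < \<beta>"
  shows "\<bar>f1 \<beta> - X \<beta>\<bar> \<le> \<beta> * exp (- \<beta> * (\<eta> + \<theta>)) * D1"
proof -
  have zz: "0 < z \<beta>" "z \<beta> < 1" using z[OF assms(2)] by auto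
  have "\<bar>f1 \<beta> - ((\<Sum>n<0. z \<beta> ^ Suc n * exp (- \<beta> * (h1 n - (- \<theta>))))
    + exp (- \<beta> * (l1 - (- \<theta>))) * (1 / eps \<beta> - (\<Sum>n<0. z \<beta> ^ Suc n)))\<bar>
    \<le> \<beta> * exp (- \<beta> * (\<eta> - (- \<theta>))) * D1"
    unfolding f1_def wsum_def gz(1)[OF assms(2), symmetric] gsum(1)[OF zz, symmetric]
    using assms zz h_nonneg geometric_weights(2)[OF zz]
    by (intro weighted_sum_expand gsumm h_lim) (auto simp del: power_Suc)
  then show ?thesis unfolding l_theta X_def by simp
qed

lemma g1_expand:
  assumes "\<And>n. \<eta> \<le> h1 n" "0 < \<beta>"
  shows "\<bar>g1 \<beta> - X \<beta> / z \<beta>\<bar> \<le> \<beta> * exp (- \<beta> * (\<eta> + \<theta>)) * D1"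
proof -
  have zz: "0 < z \<beta>" "z \<beta> < 1" using z[OF assms(2)] by auto
  have b: "0 \<le> \<beta>" using assms(2) by simp
  have "\<bar>g1 \<beta> - ((\<Sum>n<0. len_weight (z \<beta>) n * exp (- \<beta> * (h1 n - (- \<theta>))))
    + exp (- \<beta> * (l1 - (- \<theta>))) * (1 / (eps \<beta> * z \<beta>) - (\<Sum>n<0. len_weight (z \<beta>) n)))\<bar>
    \<le> \<beta> * exp (- \<beta> * (\<eta> - (- \<theta>))) * D1"
    unfolding g1_def gz(2)[OF assms(2), symmetric] gsum(2)[OF zz, symmetric]
      wmean_scaled[OF zz h_nonneg(2) b, folded eps_def]
    using assms zz h_nonneg geometric_weights(4)[OF zz]
    by (intro weighted_sum_expand gsumm h_lim) auto
  then show ?thesis unfolding l_theta X_def by simp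
qed

lemma f0_ge_sum:
  assumes "finite I" "0 < \<beta>"
  shows "(\<Sum>n\<in>I. z \<beta> ^ Suc n * exp (- \<beta> * (h0 n - \<theta>))) \<le> f0 \<beta>"
proof -
  have zz: "0 < z \<beta>" "z \<beta> < 1" using z[OF assms(2)] by auto
  have "(\<Sum>n\<in>I. z \<beta> ^ Suc n * exp (- \<beta> * h0 n)) \<le> wsum h0 \<beta> (z \<beta>)"
    unfolding wsum_def using assms zz h_nonneg by (intro sum_le_suminf summable_wsum) auto
  then have "exp (\<beta> * \<theta>) * (\<Sum>n\<in>I. z \<beta> ^ Suc n * exp (- \<beta> * h0 n)) \<le> f0 \<beta>"
    unfolding f0_def by (intro mult_left_mono) auto
  moreover have "exp (\<beta> * \<theta>) * exp (- \<beta> * a) = exp (- \<beta> * (a - \<theta>))" for a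
    by (simp add: algebra_simps flip: exp_add)
  ultimately show ?thesis by (simp only: sum_distrib_left mult.left_commute[of "exp (\<beta> * \<theta>)"])
qed

lemma finite_sum_tendsto_0:
  fixes v :: "nat \<Rightarrow> real \<Rightarrow> real"
  assumes "\<And>n. (v n \<longlongrightarrow> c n) at_top"
  shows "((\<lambda>\<beta>. 1 - eps \<beta> * (\<Sum>n<N. v n \<beta>)) \<longlongrightarrow> 1) at_top"
proof -
  have "((\<lambda>\<beta>. 1 - eps \<beta> * (\<Sum>n<N. v n \<beta>)) \<longlongrightarrow> 1 - 0 * (\<Sum>n<N. c n)) at_top"
    by (intro tendsto_intros eps_lim assms)
  then show ?thesis by simp
qed

lemma v_lims:
  shows "((\<lambda>\<beta>. z \<beta> ^ Suc n) \<longlongrightarrow> 1) at_top"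
    and "((\<lambda>\<beta>. len_weight (z \<beta>) n) \<longlongrightarrow> 0) at_top"
proof -
  have "((\<lambda>\<beta>. z \<beta> ^ Suc n) \<longlongrightarrow> 1 ^ Suc n) at_top" by (intro tendsto_intros z_lim)
  then show "((\<lambda>\<beta>. z \<beta> ^ Suc n) \<longlongrightarrow> 1) at_top" by simp
  have "((\<lambda>\<beta>. len_weight (z \<beta>) n) \<longlongrightarrow> (1 - 1) * (real (Suc n) * 1 ^ n)) at_top"
    by (intro tendsto_intros z_lim)
  then show "((\<lambda>\<beta>. len_weight (z \<beta>) n) \<longlongrightarrow> 0) at_top" by simp
qed

lemma s_lim: "((\<lambda>\<beta>. 1 / z \<beta> - eps \<beta> * (\<Sum>n<N. len_weight (z \<beta>) n)) \<longlongrightarrow> 1) at_top"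
proof -
  have "((\<lambda>\<beta>. 1 / z \<beta> - eps \<beta> * (\<Sum>n<N. len_weight (z \<beta>) n)) \<longlongrightarrow> 1 / 1 - 0 * (\<Sum>n<N. 0)) at_top"
    by (intro tendsto_intros z_lim eps_lim v_lims) simp
  then show ?thesis by simp
qed

definition "r0 \<beta> = eps \<beta> * wmean h0 \<beta> (z \<beta>) / wsum h0 \<beta> (z \<beta>)"
definition "r1 \<beta> = eps \<beta> * wmean h1 \<beta> (z \<beta>) / wsum h1 \<beta> (z \<beta>)"

lemma r_eq: "r0 \<beta> = g0 \<beta> / f0 \<beta>" "r1 \<beta> = g1 \<beta> / f1 \<beta>"
  by (simp_all add: r0_def r1_def g0_def f0_def g1_def f1_def)

text \<open>\<open>X\<close> and \<open>f1\<close> tend to x0, and \<open>f0\<close> tends to x0 +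
  \<kappa> = 1 / x0. Both \<open>g0\<close> and \<open>g1\<close> tend to x0: for bounded lengths
  \<open>len_weight\<close> vanishes as z tends to 1, so the coincident lengths count in
  \<open>f0\<close> but not in \<open>g0\<close>. The quotients are x0^2 and 1.\<close>

theorem balanced_limits:
  assumes ge: "\<And>n. \<theta> \<le> h0 n" and pos: "0 < l0 + l1"
    and x0: "0 < x0" "x0\<^sup>2 + real (card {n. h0 n = \<theta>}) * x0 = 1"
  shows "(r0 \<longlongrightarrow> x0\<^sup>2) at_top" "(r1 \<longlongrightarrow> 1) at_top"
proof -
  define k where "k = real (card {n. h0 n = \<theta>})"
  have "\<theta> < l0" using pos by (simp add: \<theta>_def field_simps)
  then obtain N \<eta> where N: "\<theta> < \<eta>" "\<And>n. N \<le> n \<Longrightarrow> \<eta> \<le> h0 n"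
    using eventually_gt_limit[OF h_lim(1)] by metis
  \<comment> \<open>For positive \<open>\<theta>\<close> the trivial lower bound 0 of
    \<open>h1\<close> suffices. For \<open>\<theta> = 0\<close> both limits are equal and positive,
    which keeps \<open>h1\<close> away from 0.\<close>
  obtain \<eta>1 where e1: "0 < \<eta>1 + \<theta>" "\<And>n. \<eta>1 \<le> h1 n"
  proof (cases "\<theta> = 0")
    case True
    then have "0 < l1" using pos by (simp add: \<theta>_def)
    then show ?thesis using positive_lower_bound[OF h_lim(2) _ h_pos(2)] that True by (metis add.right_neutral)
  next
    case False
    then show ?thesis using theta_nonneg h_nonneg that[of 0] by simp
  qed
  have L: "((\<lambda>\<beta>. exp (- \<beta> * (h0 n - \<theta>))) \<longlongrightarrow> (if h0 n = \<theta> then 1 else 0)) at_top" for n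
    using exp_tendsto_0[of "h0 n - \<theta>" "\<lambda>\<beta>. \<beta>" at_top] ge[of n] by (auto simp: filterlim_ident)
  have fin: "((\<lambda>\<beta>. fin0 N \<beta>) \<longlongrightarrow> k) at_top"
  proof -
    have "((\<lambda>\<beta>. fin0 N \<beta>) \<longlongrightarrow> (\<Sum>n<N. 1 * (if h0 n = \<theta> then 1 else 0))) at_top"
      by (intro tendsto_intros v_lims L)
    moreover have "(\<Sum>n<N. 1 * (if h0 n = \<theta> then 1 else 0 :: real)) = k"
    \<comment> \<open>From \<open>N\<close> on the costs are at least \<open>\<eta>\<close>, which
      exceeds \<open>\<theta>\<close>; so the coincidence set is finite and is counted completely by
      the first \<open>N\<close> terms.\<close>
    proof -
      have "n < N" if "h0 n = \<theta>" for n
        using N(1) N(2)[of n] that by (cases "n < N") auto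
      then have "{n. h0 n = \<theta>} = {n \<in> {..<N}. h0 n = \<theta>}" by auto
      then show ?thesis unfolding k_def by (simp add: sum.If_cases Int_def)
    qed
    ultimately show ?thesis by simp
  qed
  define u where "u = (\<lambda>\<beta>. 1 - eps \<beta> * (\<Sum>n<N. z \<beta> ^ Suc n))"
  have u: "(u \<longlongrightarrow> 1) at_top" unfolding u_def by (rule finite_sum_tendsto_0[OF v_lims(1)])
  have d1: "((\<lambda>\<beta>. f1 \<beta> - X \<beta>) \<longlongrightarrow> 0) at_top"
    by (rule tendsto_of_abs_le[OF eventually_mono[OF beta_pos] lin_exp_tendsto_0[OF e1(1) filterlim_ident]])
      (rule f1_expand[OF e1(2)])
  have d2: "((\<lambda>\<beta>. f0 \<beta> - (fin0 N \<beta> + X \<beta> * u \<beta>)) \<longlongrightarrow> 0) at_top"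
    unfolding u_def
    by (rule tendsto_of_abs_le[OF eventually_mono[OF beta_pos] lin_exp_tendsto_0[of "\<eta> - \<theta>", OF _ filterlim_ident]])
      (rule f0_expand[OF N(2)], auto simp: N(1))
  have d2': "((\<lambda>\<beta>. f0 \<beta> - X \<beta> * u \<beta> - k) \<longlongrightarrow> 0) at_top"
    using tendsto_add[OF d2 tendsto_diff[OF fin tendsto_const[of k]]] by (simp add: algebra_simps)
  have X: "(X \<longlongrightarrow> x0) at_top"
  proof (rule quadratic_root_stable[OF _ _ d1 d2' u])
    show "\<forall>\<^sub>F \<beta> in at_top. 0 < X \<beta>" using beta_pos by eventually_elim (rule X_pos)
    show "\<forall>\<^sub>F \<beta> in at_top. (X \<beta> + (f1 \<beta> - X \<beta>)) * (X \<beta> * u \<beta> + k + (f0 \<beta> - X \<beta> * u \<beta> - k)) = 1"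
      using beta_pos by eventually_elim (simp add: f_prod)
  qed (use x0 in \<open>simp_all add: k_def\<close>)
  have x0': "x0 * 1 + k = 1 / x0" using x0 by (simp add: k_def field_simps power2_eq_square)
  have f1: "(f1 \<longlongrightarrow> x0) at_top" using tendsto_add[OF d1 X] by simp
  have f0: "(f0 \<longlongrightarrow> 1 / x0) at_top"
    using tendsto_add[OF d2' tendsto_add[OF tendsto_mult[OF X u] tendsto_const[of k]]] unfolding x0' by simp
  have "((\<lambda>\<beta>. g1 \<beta> - X \<beta> / z \<beta>) \<longlongrightarrow> 0) at_top"
    by (rule tendsto_of_abs_le[OF eventually_mono[OF beta_pos] lin_exp_tendsto_0[OF e1(1) filterlim_ident]])
      (rule g1_expand[OF e1(2)])
  from tendsto_add[OF this tendsto_divide[OF X z_lim]] have g1: "(g1 \<longlongrightarrow> x0) at_top" by simp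
  have d3: "((\<lambda>\<beta>. g0 \<beta> - (fin1 N \<beta>
    + X \<beta> * (1 / z \<beta> - eps \<beta> * (\<Sum>n<N. len_weight (z \<beta>) n)))) \<longlongrightarrow> 0) at_top"
    by (rule tendsto_of_abs_le[OF eventually_mono[OF beta_pos] lin_exp_tendsto_0[of "\<eta> - \<theta>", OF _ filterlim_ident]])
      (rule g0_expand[OF N(2)], auto simp: N(1))
  have "((\<lambda>\<beta>. fin1 N \<beta>) \<longlongrightarrow>
      (\<Sum>n<N. 0 * (if h0 n = \<theta> then 1 else 0))) at_top"
    by (intro tendsto_intros v_lims L)
  from tendsto_add[OF d3 tendsto_add[OF this tendsto_mult[OF X s_lim[of N]]]]
  have g0: "(g0 \<longlongrightarrow> x0) at_top" by simp
  show "(r0 \<longlongrightarrow> x0\<^sup>2) at_top"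
    using tendsto_divide[OF g0 f0] x0 by (simp add: r_eq[abs_def] power2_eq_square)
  show "(r1 \<longlongrightarrow> 1) at_top"
    using tendsto_divide[OF g1 f1] x0 by (simp add: r_eq[abs_def])
qed

text \<open>Now \<open>f1\<close> and \<open>X\<close> tend to 0, and \<open>r1 = g1 / f1\<close> is
  a quotient of vanishing quantities. It is rewritten as \<open>g1 * f0\<close>, which is compared
  with \<open>f1 * f0 = 1\<close> through \<open>X * f0\<close>. In \<open>r0\<close> the lengths up
  to \<open>N\<close> contribute at most \<open>eps \<beta> * N\<close>, and the longer ones carry
  the vanishing factor \<open>f1\<close>.\<close>

theorem dominated_limits:
  assumes n0: "h0 n0 < \<theta>"
  shows "(r0 \<longlongrightarrow> 0) at_top" "(r1 \<longlongrightarrow> 1) at_top"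
proof -
  have th: "0 < \<theta>" using n0 h_pos(1)[of n0] by simp
  then have l0: "0 < l0" "\<theta> < l0" using l_nonneg by (auto simp: \<theta>_def field_simps)
  obtain \<eta>0 where e0: "0 < \<eta>0" "\<And>n. \<eta>0 \<le> h0 n"
    using positive_lower_bound[OF h_lim(1) l0(1) h_pos(1)] by metis
  obtain N \<eta> where N: "\<theta> < \<eta>" "\<And>n. N \<le> n \<Longrightarrow> \<eta> \<le> h0 n"
    using eventually_gt_limit[OF h_lim(1) l0(2)] by metis
  have inv: "1 / f0 \<beta> = f1 \<beta>" "1 / f1 \<beta> = f0 \<beta>" if "0 < \<beta>" for \<beta>
    using f_prod[OF that] f_pos[OF that] by (auto simp: field_simps)
  have f1: "(f1 \<longlongrightarrow> 0) at_top"
  proof (rule tendsto_sandwich[OF _ _ tendsto_const])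
    show "\<forall>\<^sub>F \<beta> in at_top. 0 \<le> f1 \<beta>" using beta_pos by eventually_elim (simp add: f_pos less_imp_le)
    show "\<forall>\<^sub>F \<beta> in at_top. f1 \<beta> \<le> exp (- \<beta> * (\<theta> - h0 n0)) / z \<beta> ^ Suc n0"
      using beta_pos
    proof eventually_elim
      case (elim \<beta>)
      have zz: "0 < z \<beta> ^ Suc n0" using z[OF elim] by (intro zero_less_power) auto
      have "z \<beta> ^ Suc n0 * exp (- \<beta> * (h0 n0 - \<theta>)) \<le> f0 \<beta>" using f0_ge_sum[of "{n0}", OF _ elim] by simp
      then have "1 / f0 \<beta> \<le> 1 / (z \<beta> ^ Suc n0 * exp (- \<beta> * (h0 n0 - \<theta>)))"
        using zz by (intro divide_left_mono mult_pos_pos) (auto simp: f_pos elim)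
      also have "\<dots> = exp (- \<beta> * (\<theta> - h0 n0)) / z \<beta> ^ Suc n0"
      proof -
        have "1 / (a * p) = q / a" if "p * q = 1" "p \<noteq> 0" for a p q :: real
          using that by (cases "a = 0") (auto simp: field_simps)
        moreover have "exp (- \<beta> * (h0 n0 - \<theta>)) * exp (- \<beta> * (\<theta> - h0 n0)) = 1"
          by (simp add: algebra_simps flip: exp_add)
        ultimately show ?thesis by (meson exp_not_eq_zero)
      qed
      finally show ?case using inv[OF elim] by simp
    qed
    show "((\<lambda>\<beta>. exp (- \<beta> * (\<theta> - h0 n0)) / z \<beta> ^ Suc n0) \<longlongrightarrow> 0) at_top"
      using tendsto_divide[OF exp_tendsto_0[of "\<theta> - h0 n0", OF _ filterlim_ident] v_lims(1)] n0 by simp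
  qed
  have d1: "((\<lambda>\<beta>. f1 \<beta> - X \<beta>) \<longlongrightarrow> 0) at_top"
    by (rule tendsto_of_abs_le[OF eventually_mono[OF beta_pos] lin_exp_tendsto_0[of "0 + \<theta>", OF _ filterlim_ident]])
      (rule f1_expand[OF h_nonneg(2)], auto simp: th)
  have X: "(X \<longlongrightarrow> 0) at_top" using tendsto_diff[OF f1 d1] by simp
  \<comment> \<open>The errors of \<open>f1\<close> and \<open>g1\<close> are multiplied by
    \<open>f0\<close>, which is unbounded. With a positive lower bound \<open>\<eta>0\<close> of all
    costs, \<open>f0\<close> is at most X plus a multiple of \<beta> exp (\<beta> (\<theta> -
    \<eta>0)), so the factor exp (- \<beta> \<theta>) still leaves the decay exp (- \<beta>
    \<eta>0).\<close>
  have small: "((\<lambda>\<beta>. \<beta> * exp (- \<beta> * (0 + \<theta>)) * D * f0 \<beta>) \<longlongrightarrow> 0) at_top" if D: "0 \<le> D" for D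
  proof (rule tendsto_sandwich[OF _ _ tendsto_const])
    show "\<forall>\<^sub>F \<beta> in at_top. 0 \<le> \<beta> * exp (- \<beta> * (0 + \<theta>)) * D * f0 \<beta>"
      using beta_pos by eventually_elim (use D f_pos in \<open>auto intro!: mult_nonneg_nonneg simp: less_imp_le\<close>)
    show "\<forall>\<^sub>F \<beta> in at_top. \<beta> * exp (- \<beta> * (0 + \<theta>)) * D * f0 \<beta> \<le> \<beta> * exp (- \<beta> * \<theta>) * D * X \<beta>
        + \<beta> * \<beta> * exp (- \<beta> * \<eta>0) * (D * D0)"
      using beta_pos
    proof eventually_elim
      case (elim \<beta>)
      have "f0 \<beta> \<le> X \<beta> + \<beta> * exp (- \<beta> * (\<eta>0 - \<theta>)) * D0"
        using f0_expand[of 0 \<eta>0, OF e0(2) elim] by (simp add: abs_le_iff)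
      then have "\<beta> * exp (- \<beta> * \<theta>) * D * f0 \<beta> \<le> \<beta> * exp (- \<beta> * \<theta>) * D * (X \<beta> + \<beta> * exp (- \<beta> * (\<eta>0 - \<theta>)) * D0)"
        using elim D by (intro mult_left_mono) auto
      also have "\<dots> = \<beta> * exp (- \<beta> * \<theta>) * D * X \<beta> + \<beta> * \<beta> * (exp (- \<beta> * \<theta>) * exp (- \<beta> * (\<eta>0 - \<theta>))) * (D * D0)"
        by (simp add: algebra_simps)
      also have "exp (- \<beta> * \<theta>) * exp (- \<beta> * (\<eta>0 - \<theta>)) = exp (- \<beta> * \<eta>0)"
        by (simp add: algebra_simps flip: exp_add)
      finally show ?case by simp
    qed
    have "((\<lambda>\<beta>. \<beta> * \<beta> * exp (- \<beta> * \<eta>0) * C) \<longlongrightarrow> 0) at_top" for C using e0(1) by real_asymp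
    from tendsto_add[OF tendsto_mult[OF lin_exp_tendsto_0[OF th filterlim_ident, of D] X] this[of "D * D0"]]
    show "((\<lambda>\<beta>. \<beta> * exp (- \<beta> * \<theta>) * D * X \<beta> + \<beta> * \<beta> * exp (- \<beta> * \<eta>0) * (D * D0)) \<longlongrightarrow> 0) at_top" by simp
  qed
  have D1: "0 \<le> D1" by (intro suminf_nonneg h_lim) auto
  have a1: "((\<lambda>\<beta>. f1 \<beta> * f0 \<beta> - X \<beta> * f0 \<beta>) \<longlongrightarrow> 0) at_top"
  proof (rule tendsto_of_abs_le[OF _ small[OF D1]])
    show "\<forall>\<^sub>F \<beta> in at_top. \<bar>f1 \<beta> * f0 \<beta> - X \<beta> * f0 \<beta>\<bar> \<le> \<beta> * exp (- \<beta> * (0 + \<theta>)) * D1 * f0 \<beta>"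
      using beta_pos
    proof eventually_elim
      case (elim \<beta>)
      have "\<bar>f1 \<beta> - X \<beta>\<bar> * f0 \<beta> \<le> \<beta> * exp (- \<beta> * (0 + \<theta>)) * D1 * f0 \<beta>"
        using f_pos(1)[OF elim] by (intro mult_right_mono f1_expand h_nonneg elim) auto
      then show ?case
        unfolding left_diff_distrib[symmetric] abs_mult abs_of_pos[OF f_pos(1)[OF elim]] .
    qed
  qed
  have a2: "((\<lambda>\<beta>. g1 \<beta> * f0 \<beta> - X \<beta> / z \<beta> * f0 \<beta>) \<longlongrightarrow> 0) at_top"
  proof (rule tendsto_of_abs_le[OF _ small[OF D1]])
    show "\<forall>\<^sub>F \<beta> in at_top. \<bar>g1 \<beta> * f0 \<beta> - X \<beta> / z \<beta> * f0 \<beta>\<bar> \<le> \<beta> * exp (- \<beta> * (0 + \<theta>)) * D1 * f0 \<beta>"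
      using beta_pos
    proof eventually_elim
      case (elim \<beta>)
      have "\<bar>g1 \<beta> - X \<beta> / z \<beta>\<bar> * f0 \<beta> \<le> \<beta> * exp (- \<beta> * (0 + \<theta>)) * D1 * f0 \<beta>"
        using f_pos(1)[OF elim] by (intro mult_right_mono g1_expand h_nonneg elim) auto
      then show ?case
        unfolding left_diff_distrib[symmetric] abs_mult abs_of_pos[OF f_pos(1)[OF elim]] .
    qed
  qed
  have "((\<lambda>\<beta>. f1 \<beta> * f0 \<beta>) \<longlongrightarrow> 1) at_top"
    by (intro tendsto_eventually eventually_mono[OF beta_pos] f_prod)
  from tendsto_diff[OF this a1] have Xf: "((\<lambda>\<beta>. X \<beta> * f0 \<beta>) \<longlongrightarrow> 1) at_top" by simp
  have "((\<lambda>\<beta>. g1 \<beta> * f0 \<beta>) \<longlongrightarrow> 1) at_top"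
    using tendsto_add[OF a2 tendsto_divide[OF Xf z_lim]] by simp
  moreover have "\<forall>\<^sub>F \<beta> in at_top. g1 \<beta> * f0 \<beta> = r1 \<beta>"
    using beta_pos
  proof eventually_elim
    case (elim \<beta>)
    show ?case unfolding r_eq inv(2)[OF elim, symmetric] by simp
  qed
  ultimately show "(r1 \<longlongrightarrow> 1) at_top" by (rule Lim_transform_eventually)
  show "(r0 \<longlongrightarrow> 0) at_top"
  proof (rule tendsto_sandwich[OF _ _ tendsto_const])
    let ?s = "\<lambda>\<beta>. 1 / z \<beta> - eps \<beta> * (\<Sum>n<N. len_weight (z \<beta>) n)"
    let ?e = "\<lambda>\<beta>. \<beta> * exp (- \<beta> * (\<eta> - \<theta>)) * D0"
    show "\<forall>\<^sub>F \<beta> in at_top. 0 \<le> r0 \<beta>"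
      using beta_pos
    proof eventually_elim
      case (elim \<beta>)
      have zz: "0 < z \<beta>" "z \<beta> < 1" "0 \<le> \<beta>" using z[OF elim] elim by auto
      have "0 \<le> eps \<beta> * wmean h0 \<beta> (z \<beta>)"
        unfolding eps_def wmean_scaled[OF zz(1,2) h_nonneg(1) zz(3)]
        using zz h_nonneg by (intro suminf_nonneg summable_wmean_scaled) auto
      then show ?case unfolding r_eq g0_def using f_pos(1)[OF elim] by simp
    qed
    show "\<forall>\<^sub>F \<beta> in at_top. r0 \<beta> \<le> eps \<beta> * real N + (X \<beta> * ?s \<beta> + ?e \<beta>) * f1 \<beta>"
      using beta_pos
    proof eventually_elim
      case (elim \<beta>)
      have zz: "0 < z \<beta>" "z \<beta> < 1" "0 < eps \<beta>" using z[OF elim] eps_pos[OF elim] by auto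
      have "fin1 N \<beta>
          \<le> (\<Sum>n<N. eps \<beta> * real N * (z \<beta> ^ Suc n * exp (- \<beta> * (h0 n - \<theta>))))"
      proof (rule sum_mono)
        fix n assume n: "n \<in> {..<N}"
        have "len_weight (z \<beta>) n * exp (- \<beta> * (h0 n - \<theta>)) =
            eps \<beta> * real (Suc n) * (z \<beta> ^ Suc n * exp (- \<beta> * (h0 n - \<theta>)))"
          using zz by (simp add: eps_def)
        also have "\<dots> \<le> eps \<beta> * real N * (z \<beta> ^ Suc n * exp (- \<beta> * (h0 n - \<theta>)))"
          using n zz by (intro mult_right_mono mult_left_mono) auto
        finally show "len_weight (z \<beta>) n * exp (- \<beta> * (h0 n - \<theta>)) \<le> \<dots>" .
      qed
      also have "\<dots> \<le> eps \<beta> * real N * f0 \<beta>"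
        unfolding sum_distrib_left[symmetric] using zz by (intro mult_left_mono f0_ge_sum elim) auto
      finally have "g0 \<beta> \<le> eps \<beta> * real N * f0 \<beta> + (X \<beta> * ?s \<beta> + ?e \<beta>)"
        using g0_expand[of N \<eta>, OF N(2) elim] unfolding abs_le_iff by linarith
      then have "g0 \<beta> / f0 \<beta> \<le> (eps \<beta> * real N * f0 \<beta> + (X \<beta> * ?s \<beta> + ?e \<beta>)) / f0 \<beta>"
        using f_pos(1)[OF elim] by (intro divide_right_mono) auto
      also have "\<dots> = eps \<beta> * real N + (X \<beta> * ?s \<beta> + ?e \<beta>) * (1 / f0 \<beta>)"
        using f_pos(1)[OF elim] by (simp add: add_divide_distrib)
      finally show ?case unfolding r_eq inv[OF elim] .
    qed
    have "((\<lambda>\<beta>. eps \<beta> * real N + (X \<beta> * ?s \<beta> + ?e \<beta>) * f1 \<beta>) \<longlongrightarrow> 0 * real N + (0 * 1 + 0) * 0) at_top"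
      using N(1) by (intro tendsto_add tendsto_mult X s_lim eps_lim f1 tendsto_const lin_exp_tendsto_0 filterlim_ident) auto
    then show "((\<lambda>\<beta>. eps \<beta> * real N + (X \<beta> * ?s \<beta> + ?e \<beta>) * f1 \<beta>) \<longlongrightarrow> 0) at_top" by simp
  qed
qed

lemma mean_ratio_limits:
  assumes "(r0 \<longlongrightarrow> a) at_top" "(r1 \<longlongrightarrow> 1) at_top" "0 \<le> a"
  defines "m0 \<equiv> \<lambda>\<beta>. wmean h0 \<beta> (z \<beta>) / wsum h0 \<beta> (z \<beta>)" and "m1 \<equiv> \<lambda>\<beta>. wmean h1 \<beta> (z \<beta>) / wsum h1 \<beta> (z \<beta>)"
  shows "((\<lambda>\<beta>. 1 / (m0 \<beta> + m1 \<beta>)) \<longlongrightarrow> 0) at_top"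
    and "((\<lambda>\<beta>. m1 \<beta> / (m0 \<beta> + m1 \<beta>)) \<longlongrightarrow> 1 / (1 + a)) at_top"
proof -
  have e: "m0 \<beta> + m1 \<beta> = (r0 \<beta> + r1 \<beta>) / eps \<beta>" "m1 \<beta> = r1 \<beta> / eps \<beta>" if "0 < \<beta>" for \<beta>
    using eps_pos[OF that] by (simp_all add: m0_def m1_def r0_def r1_def field_simps)
  have "((\<lambda>\<beta>. eps \<beta> / (r0 \<beta> + r1 \<beta>)) \<longlongrightarrow> 0 / (a + 1)) at_top"
    using assms(3) by (intro tendsto_intros assms(1,2) eps_lim) auto
  then have "((\<lambda>\<beta>. eps \<beta> / (r0 \<beta> + r1 \<beta>)) \<longlongrightarrow> 0) at_top" by simp
  then show "((\<lambda>\<beta>. 1 / (m0 \<beta> + m1 \<beta>)) \<longlongrightarrow> 0) at_top"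
  proof (rule Lim_transform_eventually)
    show "\<forall>\<^sub>F \<beta> in at_top. eps \<beta> / (r0 \<beta> + r1 \<beta>) = 1 / (m0 \<beta> + m1 \<beta>)"
      using beta_pos
    proof eventually_elim
      case (elim \<beta>)
      show ?case unfolding e(1)[OF elim] by simp
    qed
  qed
  have "((\<lambda>\<beta>. r1 \<beta> / (r0 \<beta> + r1 \<beta>)) \<longlongrightarrow> 1 / (a + 1)) at_top"
    using assms(3) by (intro tendsto_intros assms(1,2)) auto
  then have "((\<lambda>\<beta>. m1 \<beta> / (m0 \<beta> + m1 \<beta>)) \<longlongrightarrow> 1 / (a + 1)) at_top"
  proof (rule Lim_transform_eventually)
    show "\<forall>\<^sub>F \<beta> in at_top. r1 \<beta> / (r0 \<beta> + r1 \<beta>) = m1 \<beta> / (m0 \<beta> + m1 \<beta>)"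
      using beta_pos
    proof eventually_elim
      case (elim \<beta>)
      show ?case unfolding e(1)[OF elim] by (subst e(2)[OF elim]) (use eps_pos[OF elim] in simp)
    qed
  qed
  then show "((\<lambda>\<beta>. m1 \<beta> / (m0 \<beta> + m1 \<beta>)) \<longlongrightarrow> 1 / (1 + a)) at_top" by (simp add: add.commute)
qed

end

section \<open>Convergence of the Gibbs measures\<close>

text \<open>This is what the summability of n a_n provides: H_n differs from its limit by a tail of
  the a_n besides a difference of b's, and summation by parts makes these tails summable.\<close>

lemma summable_tails:
  fixes c :: "nat \<Rightarrow> real"
  assumes c: "\<And>n. 0 \<le> c n" and s: "summable (\<lambda>n. real (Suc n) * c n)"
  shows "summable c" "summable (\<lambda>n. \<Sum>k. c (k + n))"
proof -
  have le: "c n \<le> real (Suc n) * c n" for n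
    using mult_right_mono[of 1 "real (Suc n)" "c n"] c[of n] by simp
  show sc: "summable c"
    by (rule summable_comparison_test'[OF s, of 0]) (use c le in auto)
  define r where "r = (\<lambda>n. \<Sum>k. c (k + n))"
  note sh = summable_iff_shift[THEN iffD2]
  have r_nonneg: "0 \<le> r n" for n unfolding r_def by (intro suminf_nonneg sh sc c)
  have step: "r n = c n + r (Suc n)" for n
    using suminf_split_head[OF sh[OF sc, of n]] by (simp add: r_def)
  have eq: "(\<Sum>n<M. r n) = (\<Sum>n<M. real (Suc n) * c n) + real M * r M" for M
  proof (induction M)
    case (Suc M)
    then show ?case using step[of M] by (simp add: algebra_simps)
  qed simp
  have tail: "real M * r M \<le> (\<Sum>k. real (Suc (k + M)) * c (k + M))" for M
  proof -
    have "real M * r M = (\<Sum>k. real M * c (k + M))"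
      unfolding r_def by (rule suminf_mult[symmetric, OF sh[OF sc]])
    also have "\<dots> \<le> (\<Sum>k. real (Suc (k + M)) * c (k + M))"
      using c by (intro suminf_le mult_right_mono summable_mult sh[OF sc] sh[OF s]) auto
    finally show ?thesis .
  qed
  have "(\<Sum>n<M. r n) \<le> (\<Sum>n. real (Suc n) * c n)" for M
    using eq[of M] tail[of M] suminf_split_initial_segment[OF s, of M] by simp
  then show "summable (\<lambda>n. \<Sum>k. c (k + n))"
    using r_nonneg unfolding r_def[symmetric] by (intro summableI_nonneg_bounded)
qed

lemma summable_osc_lim:
  assumes "summable_osc b"
  shows "b \<longlonglongrightarrow> lim b" "summable (\<lambda>n. \<bar>b (Suc n) - lim b\<bar>)"
proof -
  define S where "S = (\<lambda>k. SUP n. \<bar>b (Suc k) - b (Suc k + n)\<bar>)"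
  have S: "summable S" and bdd: "\<And>k. bdd_above (range (\<lambda>n. \<bar>b (Suc k) - b (Suc k + n)\<bar>))"
    using assms by (auto simp: summable_osc_def S_def)
  have S_ge: "\<bar>b (Suc k) - b (Suc k + n)\<bar> \<le> S k" for k n
    unfolding S_def by (rule cSUP_upper[OF UNIV_I bdd])
  have "Cauchy b"
    unfolding Cauchy_def
  proof (intro allI impI)
    fix e :: real assume "0 < e"
    then have "\<forall>\<^sub>F k in sequentially. S k < e / 2"
      by (intro order_tendstoD[OF summable_LIMSEQ_zero[OF S]]) simp
    then obtain K where K: "S K < e / 2" by (auto simp: eventually_sequentially)
    have "dist (b m) (b n) < e" if "m \<ge> Suc K" "n \<ge> Suc K" for m n
      using S_ge[of K "m - Suc K"] S_ge[of K "n - Suc K"] that K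
      unfolding dist_real_def le_add_diff_inverse[OF that(1)] le_add_diff_inverse[OF that(2)] by linarith
    then show "\<exists>M. \<forall>m\<ge>M. \<forall>n\<ge>M. dist (b m) (b n) < e" by blast
  qed
  then show lim: "b \<longlonglongrightarrow> lim b" by (simp add: Cauchy_convergent_iff convergent_LIMSEQ_iff)
  have "\<bar>b (Suc k) - lim b\<bar> \<le> S k" for k
  proof (rule tendsto_upperbound)
    show "(\<lambda>n. \<bar>b (Suc k) - b (Suc k + n)\<bar>) \<longlonglongrightarrow> \<bar>b (Suc k) - lim b\<bar>"
      using LIMSEQ_ignore_initial_segment[OF lim, of "Suc k"]
      by (intro tendsto_intros) (simp add: add.commute)
  qed (use S_ge in auto)
  then show "summable (\<lambda>n. \<bar>b (Suc n) - lim b\<bar>)"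
    by (intro summable_comparison_test'[OF S, of 0]) auto
qed

lemma double_well_potential:
  assumes "double_well H a0 a1 b0 b1"
  shows "potential H (\<lambda>i. if i then a1 else a0) (\<lambda>i. if i then b1 else b0) (\<lambda>i. if i then lim b1 else lim b0)"
proof -
  note D = assms[unfolded double_well_def]
  show ?thesis
  proof
    show "contS H" "0 \<le> H x" for x using D by auto
    show "H x = (if i then a1 else a0) n" if "1 \<le> n" "\<forall>k\<le>n. x k = i" "x (Suc n) = (\<not> i)" for n x i
      using that D by (cases i) auto
    show "H x = (if i then b1 else b0) n"
      if "1 \<le> n" "x 0 = i" "\<forall>k\<in>{1..n}. x k = (\<not> i)" "x (Suc n) = i" for n x i
      using that D by (cases i) auto
    show "0 \<le> (if i then a1 else a0) n" "0 < (if i then b1 else b0) n" if "1 \<le> n" for n i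
      using that D by (cases i; auto)+
    show "summable (\<lambda>n. real (Suc n) * (if i then a1 else a0) (Suc n))" for i
      using D by (cases i) auto
    show "summable (\<lambda>n. \<bar>(if i then b1 else b0) (Suc n) - (if i then lim b1 else lim b0)\<bar>)" for i
      using D summable_osc_lim(2)[of b0] summable_osc_lim(2)[of b1] by (cases i) auto
  qed
qed

context potential
begin

definition cost_inf :: "bool \<Rightarrow> real" where
  "cost_inf i = Binf (\<not> i) + (\<Sum>n. A i (Suc n))"

lemma cost_summable: "summable (\<lambda>n. \<bar>cost i n - cost_inf i\<bar>)"
proof -
  have A: "0 \<le> A i (Suc n)" for n by (rule A_nonneg) simp
  note T = summable_tails[of "\<lambda>n. A i (Suc n)", OF A summable_A]
  have sh: "summable (\<lambda>k. A i (Suc (k + n)))" for n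
    using summable_iff_shift[THEN iffD2, OF T(1), of n] by simp
  have e: "cost i n - cost_inf i = (B (\<not> i) (Suc n) - Binf (\<not> i)) - (\<Sum>k. A i (Suc (k + n)))" for n
  proof -
    have "(\<Sum>k=1..<Suc n. A i k) = (\<Sum>k<n. A i (Suc k))"
      unfolding One_nat_def sum.shift_bounds_Suc_ivl lessThan_atLeast0 ..
    then show ?thesis
      using suminf_split_initial_segment[OF T(1), of n] by (simp add: cost_def cost_inf_def del: sum.op_ivl_Suc)
  qed
  show ?thesis
  proof (rule summable_comparison_test')
    show "summable (\<lambda>n. \<bar>B (\<not> i) (Suc n) - Binf (\<not> i)\<bar> + (\<Sum>k. A i (Suc (k + n))))"
      using summable_B T(2) by (intro summable_add) auto
    show "norm \<bar>cost i n - cost_inf i\<bar> \<le> \<bar>B (\<not> i) (Suc n) - Binf (\<not> i)\<bar> + (\<Sum>k. A i (Suc (k + n)))" for n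
      using suminf_nonneg[OF sh[of n]] A unfolding e by simp
  qed
qed

theorem weak_star_limits:
  assumes "\<And>\<beta>. 0 < \<beta> \<Longrightarrow> gibbs H \<beta> (\<mu> \<beta>)" and le: "cost_inf True \<le> cost_inf False"
  defines "\<theta> \<equiv> (cost_inf False - cost_inf True) / 2"
  shows "(\<exists>n. cost False n < \<theta>) \<Longrightarrow> weak_star \<mu> (\<lambda>f. f ones) at_top"
    and "\<lbrakk>\<And>n. \<theta> \<le> cost False n; 0 < cost_inf False + cost_inf True; 0 < x0;
        x0\<^sup>2 + real (card {n. cost False n = \<theta>}) * x0 = 1\<rbrakk> \<Longrightarrow>
      weak_star \<mu> (\<lambda>f. (1 - 1 / (1 + x0\<^sup>2)) * f zeros + 1 / (1 + x0\<^sup>2) * f ones) at_top"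
proof -
  obtain z where z: "\<And>\<beta>. 0 < \<beta> \<Longrightarrow> 0 < z \<beta> \<and> z \<beta> < 1 \<and> total_weight \<beta> (z \<beta>) = 1"
    and w: "\<And>F (g :: real \<Rightarrow> real) p. \<lbrakk>filterlim g at_top F;
        ((\<lambda>s. 1 / (mean_run False (g s) (z (g s)) + mean_run True (g s) (z (g s)))) \<longlongrightarrow> 0) F;
        ((\<lambda>s. mean_run True (g s) (z (g s)) / (mean_run False (g s) (z (g s)) + mean_run True (g s) (z (g s)))) \<longlongrightarrow> p) F\<rbrakk>
      \<Longrightarrow> weak_star (\<lambda>s. \<mu> (g s)) (\<lambda>f. (1 - p) * f zeros + p * f ones) F"
    using gibbs_renewal_family[OF assms(1)] by blast
  interpret T: two_wells "cost False" "cost True" "cost_inf False" "cost_inf True" z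
    by unfold_locales (use cost_pos cost_summable le z in auto)
  have th: "T.\<theta> = \<theta>" by (simp add: T.\<theta>_def \<theta>_def)
  have W: "weak_star \<mu> (\<lambda>f. (1 - 1 / (1 + a)) * f zeros + 1 / (1 + a) * f ones) at_top"
    if "(T.r0 \<longlongrightarrow> a) at_top" "(T.r1 \<longlongrightarrow> 1) at_top" "0 \<le> a" for a
    by (rule w[of "\<lambda>\<beta>. \<beta>", OF filterlim_ident T.mean_ratio_limits[OF that]])
  show "weak_star \<mu> (\<lambda>f. f ones) at_top" if "\<exists>n. cost False n < \<theta>"
    using W[OF T.dominated_limits] that th by auto
  show "weak_star \<mu> (\<lambda>f. (1 - 1 / (1 + x0\<^sup>2)) * f zeros + 1 / (1 + x0\<^sup>2) * f ones) at_top"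
    if "\<And>n. \<theta> \<le> cost False n" "0 < cost_inf False + cost_inf True" "0 < x0"
      "x0\<^sup>2 + real (card {n. cost False n = \<theta>}) * x0 = 1"
    by (rule W[OF T.balanced_limits]) (use that th in auto)
qed

end

text \<open>The reciprocal of c is the positive root of x^2 + \<kappa> x = 1, which is the limit of
  \<open>X\<close> in the balanced case.\<close>

lemma cnum_root: "0 < cnum k" "(1 / cnum k)\<^sup>2 + real k * (1 / cnum k) = 1"
proof -
  have s: "real k < sqrt (real k ^ 2 + 4)" by (rule real_less_rsqrt) simp
  then show pos: "0 < cnum k" unfolding cnum_def by simp
  have "(cnum k)\<^sup>2 = real k * cnum k + 1"
    unfolding cnum_def by (simp add: power2_eq_square field_simps)
  moreover have "(1 / cnum k)\<^sup>2 + real k * (1 / cnum k) = (real k * cnum k + 1) / (cnum k)\<^sup>2"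
    using pos by (simp add: add_divide_distrib power2_eq_square)
  ultimately show "(1 / cnum k)\<^sup>2 + real k * (1 / cnum k) = 1"
    using pos by (metis divide_self less_irrefl power_not_zero)
qed

lemma double_well_weak_star:
  assumes "double_well H a0 a1 b0 b1" "Hinf b0 a1 \<le> Hinf b1 a0" "\<And>\<beta>. 0 < \<beta> \<Longrightarrow> gibbs H \<beta> (\<mu> \<beta>)"
  shows "Hmin b1 a0 + Hinf b0 a1 < (Hinf b1 a0 + Hinf b0 a1) / 2 \<Longrightarrow> weak_star \<mu> (\<lambda>f. f ones) at_top"
    and "\<lbrakk>(Hinf b1 a0 + Hinf b0 a1) / 2 \<le> Hmin b1 a0 + Hinf b0 a1; 0 < (Hinf b1 a0 + Hinf b0 a1) / 2;
        c = cnum (kappa a0 a1 b0 b1)\<rbrakk> \<Longrightarrow>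
      weak_star \<mu> (\<lambda>f. 1 / (1 + c\<^sup>2) * f zeros + c\<^sup>2 / (1 + c\<^sup>2) * f ones) at_top"
proof -
  interpret potential H "\<lambda>i. if i then a1 else a0" "\<lambda>i. if i then b1 else b0" "\<lambda>i. if i then lim b1 else lim b0"
    by (rule double_well_potential) fact
  have inf: "cost_inf False = Hinf b1 a0" "cost_inf True = Hinf b0 a1"
    by (simp_all add: cost_inf_def Hinf_def)
  have cost: "cost False n = Hn b1 a0 (Suc n)" for n
    by (simp add: cost_def Hn_def)
  have ge1: "\<exists>m. n = Suc m" if "n \<in> {1..}" for n using that by (cases n) auto
  have bdd: "bdd_below (Hn b1 a0 ` {1..})"
    using cost_pos[of False, unfolded cost] ge1 by (intro bdd_belowI[of _ 0]) (force simp: less_imp_le)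
  let ?t = "(cost_inf False - cost_inf True) / 2"
  note L = weak_star_limits[OF assms(3) assms(2)[folded inf]]
  show "weak_star \<mu> (\<lambda>f. f ones) at_top" if h: "Hmin b1 a0 + Hinf b0 a1 < (Hinf b1 a0 + Hinf b0 a1) / 2"
  proof (rule L(1))
    have "Hmin b1 a0 < ?t" using h unfolding inf by (simp add: field_simps)
    then obtain n where "n \<in> {1..}" "Hn b1 a0 n < ?t"
      unfolding Hmin_def using bdd by (subst (asm) cINF_less_iff) auto
    then show "\<exists>n. cost False n < ?t" unfolding cost using ge1 by blast
  qed
  assume h: "(Hinf b1 a0 + Hinf b0 a1) / 2 \<le> Hmin b1 a0 + Hinf b0 a1" "0 < (Hinf b1 a0 + Hinf b0 a1) / 2"
    and c: "c = cnum (kappa a0 a1 b0 b1)"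
  have k: "kappa a0 a1 b0 b1 = card {n. cost False n = ?t}"
  proof -
    have "{n. 1 \<le> n \<and> (Hinf b1 a0 + Hinf b0 a1) / 2 = Hn b1 a0 n + Hinf b0 a1} = Suc ` {n. cost False n = ?t}"
      unfolding inf cost using ge1 by (force simp: field_simps)
    then show ?thesis unfolding kappa_def by (simp add: card_image)
  qed
  have c0: "0 < c" unfolding c by (rule cnum_root)
  have "weak_star \<mu> (\<lambda>f. (1 - 1 / (1 + (1 / c)\<^sup>2)) * f zeros + 1 / (1 + (1 / c)\<^sup>2) * f ones) at_top"
  proof (rule L(2))
    show "?t \<le> cost False n" for n
    proof -
      have "Hmin b1 a0 \<le> cost False n" unfolding Hmin_def cost by (rule cINF_lower[OF bdd]) simp
      then show ?thesis using h(1) unfolding inf by (simp add: field_simps)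
    qed
    show "0 < cost_inf False + cost_inf True" using h(2) unfolding inf by simp
    show "(1 / c)\<^sup>2 + real (card {n. cost False n = ?t}) * (1 / c) = 1"
      unfolding c k by (rule cnum_root)
    show "0 < 1 / c" using c0 by simp
  qed
  moreover have e: "1 / (1 + (1 / c)\<^sup>2) = c\<^sup>2 / (1 + c\<^sup>2)"
    using c0 by (simp add: field_simps power2_eq_square)
  moreover have "1 - 1 / (1 + (1 / c)\<^sup>2) = 1 / (1 + c\<^sup>2)"
  proof -
    have "1 + c\<^sup>2 \<noteq> 0" using zero_le_power2[of c] by linarith
    then show ?thesis unfolding e by (simp add: diff_divide_eq_iff)
  qed
  ultimately show "weak_star \<mu> (\<lambda>f. 1 / (1 + c\<^sup>2) * f zeros + c\<^sup>2 / (1 + c\<^sup>2) * f ones) at_top" by simp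
qed

section \<open>Existence of Gibbs measures\<close>

lemma measurable_Sigma_M:
  assumes "\<And>k. (\<lambda>x. f x k) \<in> measurable M (count_space UNIV)" shows "f \<in> measurable M Sigma_M"
  unfolding Sigma_M_def by (rule measurable_PiM_single') (use assms in auto)

lemma measurable_run [measurable]: "run i n \<in> measurable Sigma_M Sigma_M"
proof (rule measurable_Sigma_M)
  show "(\<lambda>x. run i n x k) \<in> measurable Sigma_M (count_space UNIV)" for k
    using measurable_coord[of "k - n"] by (cases "k < n") (simp_all add: run_def)
qed

lemma measurable_pre [measurable]: "pre i \<in> measurable Sigma_M Sigma_M"
proof -
  have "pre i = run i 1" using pre_run[of i 0] by (simp add: fun_eq_iff)
  then show ?thesis by simp
qed

text \<open>The entries of \<open>\<omega>\<close> are the lengths minus one of a run of zeros and of the following run of ones.\<close>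

function renewal_seq :: "(nat \<Rightarrow> nat \<times> nat) \<Rightarrow> seq" where
  "renewal_seq \<omega> j = (if j \<le> fst (\<omega> 0) then False else if j \<le> Suc (fst (\<omega> 0) + snd (\<omega> 0)) then True
     else renewal_seq (\<lambda>k. \<omega> (Suc k)) (j - Suc (Suc (fst (\<omega> 0) + snd (\<omega> 0)))))"
  by auto
termination by (relation "Wellfounded.measure snd") auto

declare renewal_seq.simps [simp del]

lemma renewal_seq_Cons:
  "renewal_seq (case_nat (n, m) \<omega>) = run False (Suc n) (run True (Suc m) (renewal_seq \<omega>))"
proof
  fix j
  have "j - Suc n - Suc m = j - Suc (Suc (n + m))" by simp
  then show "renewal_seq (case_nat (n, m) \<omega>) j = run False (Suc n) (run True (Suc m) (renewal_seq \<omega>)) j"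
    by (subst renewal_seq.simps) (auto simp: run_def simp del: diff_diff_left)
qed

lemma renewal_seq_0 [simp]: "renewal_seq \<omega> 0 = False"
  by (subst renewal_seq.simps) simp

locale renewal_law =
  fixes p :: "bool \<Rightarrow> nat pmf"
begin

abbreviation base :: "(nat \<times> nat) measure" where "base \<equiv> measure_pmf (pair_pmf (p False) (p True))"

sublocale sequence_space base
  by unfold_locales

text \<open>Strong induction on the coordinate: given the first pair of lengths, which takes
  countably many values, coordinate j is either determined or a smaller coordinate of the sequence
  built from the remaining pairs.\<close>

lemma measurable_renewal_seq [measurable]: "renewal_seq \<in> measurable S Sigma_M"
proof (rule measurable_Sigma_M)
  fix j show "(\<lambda>\<omega>. renewal_seq \<omega> j) \<in> measurable S (count_space UNIV)"
  proof (induction j rule: less_induct)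
    case (less j)
    have sh: "(\<lambda>\<omega> k. \<omega> (Suc k)) \<in> measurable S S"
      by (rule measurable_PiM_single') (auto intro!: measurable_component_singleton simp: space_PiM)
    have c: "(\<lambda>\<omega>. \<omega> 0) \<in> measurable S (count_space UNIV)"
      using measurable_component_singleton[of 0 UNIV "\<lambda>_. base"] by simp
    let ?f = "\<lambda>a \<omega>. if j \<le> fst a then False else if j \<le> Suc (fst a + snd a) then True
      else renewal_seq (\<lambda>k. \<omega> (Suc k)) (j - Suc (Suc (fst a + snd a)))"
    have "?f a \<in> measurable S (count_space UNIV)" for a
      using measurable_compose[OF sh less.IH[of "j - Suc (Suc (fst a + snd a))"]] by auto
    from measurable_compose_countable[where f = ?f, OF this c]
    have "(\<lambda>\<omega>. ?f (\<omega> 0) \<omega>) \<in> measurable S (count_space UNIV)" .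
    moreover have "(\<lambda>\<omega>. renewal_seq \<omega> j) = (\<lambda>\<omega>. ?f (\<omega> 0) \<omega>)"
      by (rule ext, subst renewal_seq.simps, rule refl)
    ultimately show ?case by (simp only:)
  qed
qed

text \<open>Expectation of \<open>f\<close> over random sequences that begin with a complete run of
  the symbol \<open>i\<close>. Since \<open>renewal_seq\<close> begins with zeros, the case
  \<open>True\<close> prepends one run of ones.\<close>

definition law :: "bool \<Rightarrow> (seq \<Rightarrow> ennreal) \<Rightarrow> ennreal" where
  "law i f = (if i then \<integral>\<^sup>+m. (\<integral>\<^sup>+\<omega>. f (run True (Suc m) (renewal_seq \<omega>)) \<partial>S) \<partial>measure_pmf (p True)
     else \<integral>\<^sup>+\<omega>. f (renewal_seq \<omega>) \<partial>S)"

lemma law_cong: "(\<And>y. y 0 = i \<Longrightarrow> f y = g y) \<Longrightarrow> law i f = law i g"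
  unfolding law_def by (cases i) (auto intro!: nn_integral_cong simp: run_def)

lemma law_cmult:
  assumes [measurable]: "f \<in> borel_measurable Sigma_M" shows "law i (\<lambda>y. c * f y) = c * law i f"
  unfolding law_def by (simp add: nn_integral_cmult)

lemma law_add:
  assumes [measurable]: "f \<in> borel_measurable Sigma_M" "g \<in> borel_measurable Sigma_M"
  shows "law i (\<lambda>y. f y + g y) = law i f + law i g"
  unfolding law_def by (simp add: nn_integral_add)

text \<open>The renewal property: the first run is independent of the rest, which follows the law
  started with the opposite symbol. For \<open>True\<close> this is the definition; for
  \<open>False\<close> it holds because prepending an independent pair preserves the product measure
  (\<open>PiM_iter\<close>).\<close>

lemma law_step:
  assumes [measurable]: "f \<in> borel_measurable Sigma_M"
  shows "law i f = (\<integral>\<^sup>+n. law (\<not> i) (\<lambda>y. f (run i (Suc n) y)) \<partial>measure_pmf (p i))"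
proof (cases i)
  case True
  then show ?thesis by (simp add: law_def)
next
  case False
  have m: "(\<lambda>(s, \<omega>). case_nat s \<omega>) \<in> measurable (base \<Otimes>\<^sub>M S) S"
    by measurable
  have "law False f = (\<integral>\<^sup>+\<omega>. f (renewal_seq \<omega>) \<partial>distr (base \<Otimes>\<^sub>M S) S (\<lambda>(s, \<omega>). case_nat s \<omega>))"
    unfolding PiM_iter by (simp add: law_def)
  also have "\<dots> = (\<integral>\<^sup>+x. f (renewal_seq (case x of (s, \<omega>) \<Rightarrow> case_nat s \<omega>)) \<partial>(base \<Otimes>\<^sub>M S))"
    by (rule nn_integral_distr[OF m]) measurable
  also have "\<dots> = (\<integral>\<^sup>+s. \<integral>\<^sup>+\<omega>. f (renewal_seq (case_nat s \<omega>)) \<partial>S \<partial>base)"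
    using measurable_compose[OF m, of "\<lambda>\<omega>. f (renewal_seq \<omega>)" borel]
    by (subst P.nn_integral_fst[symmetric]) (auto simp: split_beta')
  also have "\<dots> = (\<integral>\<^sup>+n. \<integral>\<^sup>+m. \<integral>\<^sup>+\<omega>. f (renewal_seq (case_nat (n, m) \<omega>)) \<partial>S \<partial>measure_pmf (p True) \<partial>measure_pmf (p False))"
    by (rule nn_integral_pair_pmf')
  finally show ?thesis using False by (simp add: law_def renewal_seq_Cons)
qed

text \<open>
  Only the first run of the dual eigenmeasure has a special law (geometric, as its left end is cut off); all
  later runs are independent with the renewal weights.
\<close>

abbreviation start_seq :: "bool \<times> nat \<times> nat \<Rightarrow> (nat \<Rightarrow> nat \<times> nat) \<Rightarrow> seq" where
  "start_seq a \<omega> \<equiv> run (fst a) (Suc (fst (snd a)))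
     (if fst a then renewal_seq \<omega> else run True (Suc (snd (snd a))) (renewal_seq \<omega>))"

abbreviation "start_pmf b g \<equiv> measure_pmf (pair_pmf b (pair_pmf g (p True)))"

definition start_measure :: "bool pmf \<Rightarrow> nat pmf \<Rightarrow> seq measure" where
  "start_measure b g = distr (start_pmf b g \<Otimes>\<^sub>M S) Sigma_M
     (\<lambda>(a, \<omega>). start_seq a \<omega>)"

lemma start_map_measurable:
  "(\<lambda>(a, \<omega>). start_seq a \<omega>)
    \<in> measurable (start_pmf b g \<Otimes>\<^sub>M S) Sigma_M" (is "?F \<in> measurable ?M _")
proof -
  let ?f = "\<lambda>a x. run (fst a) (Suc (fst (snd a))) (if fst a then renewal_seq (snd x)
      else run True (Suc (snd (snd a))) (renewal_seq (snd x)))"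
  have "fst \<in> measurable ?M (count_space UNIV)"
    using measurable_fst[of "start_pmf b g" S] by simp
  moreover have "?f a \<in> measurable ?M Sigma_M" for a :: "bool \<times> nat \<times> nat"
    by (cases "fst a") simp_all
  ultimately have "(\<lambda>x. ?f (fst x) x) \<in> measurable ?M Sigma_M"
    by (rule measurable_compose_countable[where f = ?f and g = fst, rotated])
  then show ?thesis by (simp add: split_beta')
qed

lemma prob_space_start: "prob_space (start_measure b g)"
proof -
  have "prob_space (start_pmf b g \<Otimes>\<^sub>M S)"
    by (intro prob_space_pair prob_space_measure_pmf P.prob_space_axioms)
  then show ?thesis unfolding start_measure_def by (rule prob_space.prob_space_distr[OF _ start_map_measurable])
qed

lemma sets_start: "sets (start_measure b g) = sets Sigma_M"
  by (simp add: start_measure_def)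

lemma nn_integral_start:
  assumes [measurable]: "f \<in> borel_measurable Sigma_M"
  shows "integral\<^sup>N (start_measure b g) f =
    (\<integral>\<^sup>+i. \<integral>\<^sup>+n. law (\<not> i) (\<lambda>y. f (run i (Suc n) y)) \<partial>measure_pmf g \<partial>measure_pmf b)"
proof -
  let ?h = "\<lambda>a \<omega>. f (start_seq a \<omega>)"
  have "integral\<^sup>N (start_measure b g) f = (\<integral>\<^sup>+x. ?h (fst x) (snd x) \<partial>(start_pmf b g \<Otimes>\<^sub>M S))"
    unfolding start_measure_def by (subst nn_integral_distr[OF start_map_measurable]) (auto simp: split_beta')
  also have "\<dots> = (\<integral>\<^sup>+a. \<integral>\<^sup>+\<omega>. ?h a \<omega> \<partial>S \<partial>start_pmf b g)"
    using measurable_compose[OF start_map_measurable assms, of b g]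
      P.nn_integral_fst[of "\<lambda>x. ?h (fst x) (snd x)" "start_pmf b g", symmetric]
    by (simp add: split_beta' cong: if_cong)
  also have "\<dots> = (\<integral>\<^sup>+i. \<integral>\<^sup>+n. \<integral>\<^sup>+m. \<integral>\<^sup>+\<omega>. ?h (i, n, m) \<omega> \<partial>S \<partial>measure_pmf (p True) \<partial>measure_pmf g \<partial>measure_pmf b)"
    by (simp only: nn_integral_pair_pmf')
  finally have E: "integral\<^sup>N (start_measure b g) f = \<dots>" .
  have "(\<integral>\<^sup>+m. \<integral>\<^sup>+\<omega>. ?h (i, n, m) \<omega> \<partial>S \<partial>measure_pmf (p True)) = law (\<not> i) (\<lambda>y. f (run i (Suc n) y))" for i n
    by (cases i) (auto simp: law_def)
  then show ?thesis unfolding E by simp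
qed

end

lemma nn_integral_nat_pmf:
  fixes g :: "nat pmf"
  shows "(\<integral>\<^sup>+n. f n \<partial>measure_pmf g) = (\<Sum>n. ennreal (pmf g n) * f n)"
  by (simp add: nn_integral_measure_pmf nn_integral_count_space_nat)

lemma embed_pmf_nat:
  fixes f :: "nat \<Rightarrow> real"
  assumes "\<And>n. 0 \<le> f n" "f sums 1" shows "pmf (embed_pmf f) n = f n"
proof (rule pmf_embed_pmf)
  have "(\<Sum>n. ennreal (f n)) = ennreal 1" by (rule suminf_ennreal_eq[OF assms])
  then show "(\<integral>\<^sup>+n. ennreal (f n) \<partial>count_space UNIV) = 1" by (simp add: nn_integral_count_space_nat)
qed (use assms in auto)

section \<open>The dual eigenmeasure when all a_n vanish\<close>

definition nn_transfer :: "(seq \<Rightarrow> real) \<Rightarrow> real \<Rightarrow> (seq \<Rightarrow> ennreal) \<Rightarrow> seq \<Rightarrow> ennreal" where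
  "nn_transfer H \<beta> f x = ennreal (exp (- \<beta> * H (pre False x))) * f (pre False x)
     + ennreal (exp (- \<beta> * H (pre True x))) * f (pre True x)"

text \<open>Duality is verified for nonnegative extended functions, where series can be rearranged
  freely. A continuous \<open>f\<close> is reduced to this case by adding a constant that makes it
  nonnegative, since the operator is linear.\<close>

lemma dual_of_nn_dual:
  assumes P: "prob_space \<nu>" and sets: "sets \<nu> = sets Sigma_M" and H: "contS H" "\<And>x. 0 \<le> H x" and b: "0 \<le> \<beta>" and l: "0 \<le> l"
    and nn: "\<And>f. f \<in> borel_measurable Sigma_M \<Longrightarrow> integral\<^sup>N \<nu> (nn_transfer H \<beta> f) = ennreal l * integral\<^sup>N \<nu> f"
    and f: "contS f"
  shows "integral\<^sup>L \<nu> (transfer H \<beta> f) = l * integral\<^sup>L \<nu> f"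
proof -
  interpret prob_space \<nu> by fact
  have int: "integrable \<nu> f" if cf: "contS f" for f
  proof -
    obtain C where "\<And>x. \<bar>f x\<bar> \<le> C" using contS_bounded[OF cf] by blast
    then show ?thesis
      using contS_measurable[OF cf] measurable_cong_sets[OF sets refl, of borel]
      by (intro integrable_const_bound[of _ C]) auto
  qed
  have cT: "contS (transfer H \<beta> f)" if "contS f" for f
  proof -
    have "contS (\<lambda>x. exp (- \<beta> * H x) * f x)"
      by (intro contS_mult that contS_real_compose[OF H(1), of "\<lambda>a. exp (- \<beta> * a)"] continuous_intros)
    from contS_add[OF contS_pre[OF this, of False] contS_pre[OF this, of True]]
    show ?thesis by (simp add: transfer_def[abs_def])
  qed
  have pos: "integral\<^sup>L \<nu> (transfer H \<beta> f) = l * integral\<^sup>L \<nu> f" if f: "contS f" "\<And>x. 0 \<le> f x" for f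
  proof -
    have "ennreal (integral\<^sup>L \<nu> (transfer H \<beta> f)) = (\<integral>\<^sup>+x. ennreal (transfer H \<beta> f x) \<partial>\<nu>)"
      using f(2) by (intro nn_integral_eq_integral[symmetric] int cT f) (auto simp: transfer_def)
    also have "\<dots> = integral\<^sup>N \<nu> (nn_transfer H \<beta> (\<lambda>x. ennreal (f x)))"
      using f(2) by (intro nn_integral_cong) (simp add: nn_transfer_def transfer_def ennreal_mult)
    also have "\<dots> = ennreal l * (\<integral>\<^sup>+x. ennreal (f x) \<partial>\<nu>)"
      using contS_measurable[OF f(1)] by (intro nn) simp
    also have "(\<integral>\<^sup>+x. ennreal (f x) \<partial>\<nu>) = ennreal (integral\<^sup>L \<nu> f)"
      using f(2) by (intro nn_integral_eq_integral int f) auto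
    finally have "ennreal (integral\<^sup>L \<nu> (transfer H \<beta> f)) = ennreal (l * integral\<^sup>L \<nu> f)"
      using l by (simp add: ennreal_mult integral_nonneg f(2))
    then show ?thesis
      using l f(2) by (subst (asm) ennreal_inj) (auto intro!: integral_nonneg mult_nonneg_nonneg simp: transfer_def)
  qed
  obtain C where C: "\<And>x. \<bar>f x\<bar> \<le> C" using contS_bounded[OF f] by blast
  have C0: "0 \<le> C" using C[of undefined] by linarith
  have c: "contS (\<lambda>x. f x + C)" by (intro contS_add f) simp
  have "0 \<le> f x + C" for x using C[of x] by linarith
  from pos[OF c this] have "integral\<^sup>L \<nu> (\<lambda>x. transfer H \<beta> f x + transfer H \<beta> (\<lambda>x. C) x) = l * integral\<^sup>L \<nu> (\<lambda>x. f x + C)"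
    by (simp add: transfer_def[abs_def] algebra_simps)
  moreover have "integral\<^sup>L \<nu> (\<lambda>x. transfer H \<beta> f x + transfer H \<beta> (\<lambda>x. C) x) =
      integral\<^sup>L \<nu> (transfer H \<beta> f) + integral\<^sup>L \<nu> (transfer H \<beta> (\<lambda>x. C))"
    by (intro Bochner_Integration.integral_add int cT f) simp
  moreover have "integral\<^sup>L \<nu> (transfer H \<beta> (\<lambda>x. C)) = l * C"
    using pos[of "\<lambda>x. C"] C0 by (simp add: prob_space)
  moreover have "integral\<^sup>L \<nu> (\<lambda>x. f x + C) = integral\<^sup>L \<nu> f + C"
    using int[OF f] by (simp add: prob_space)
  ultimately show ?thesis by (simp add: algebra_simps)
qed

context potential
begin

text \<open>On a first run of n + 1 symbols \<open>i\<close> the operator either lengthens the run,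
  with weight 1 because \<open>A\<close> vanishes, or closes it with weight
  \<open>exp (- \<beta> * cost i n)\<close>. Lengthening shifts a geometric first run and so
  reproduces it up to its shortest term; closing turns its law into the weights \<open>w\<close>,
  the law of the complete runs, and supplies that term.\<close>

lemma dual_eigenmeasure_exists:
  assumes A0: "\<And>i n. 1 \<le> n \<Longrightarrow> A i n = 0" and b: "0 < \<beta>" and z: "0 < z" "z < 1"
    and F: "total_weight \<beta> z = 1"
  obtains \<nu> where "prob_space \<nu>" "sets \<nu> = sets Sigma_M"
    "\<And>f. contS f \<Longrightarrow> integral\<^sup>L \<nu> (transfer H \<beta> f) = 1 / z * integral\<^sup>L \<nu> f"
proof -
  define FF where "FF = (\<lambda>i. wsum (cost i) \<beta> z)"
  define w where "w = (\<lambda>i n. z ^ Suc n * exp (- \<beta> * cost i n))"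
  have b0: "0 \<le> \<beta>" using b by simp
  have c0: "0 \<le> cost i n" for i n using cost_pos[of i n] by simp
  have w: "w i sums FF i" for i
    unfolding w_def FF_def wsum_def by (intro summable_sums summable_wsum z c0 b0)
  have FF_pos: "0 < FF i" for i unfolding FF_def by (intro wsum_pos z c0 b0)
  have FF_prod: "FF i * FF (\<not> i) = 1" for i using F by (cases i) (auto simp: FF_def mult.commute)
  define p where "p = (\<lambda>i. embed_pmf (\<lambda>n. w i n / FF i))"
  have p: "pmf (p i) n = w i n / FF i" for i n
    unfolding p_def
  proof (rule embed_pmf_nat)
    show "0 \<le> w i n / FF i" for n using z FF_pos[of i] by (simp add: w_def)
    show "(\<lambda>n. w i n / FF i) sums 1" using sums_divide[OF w[of i], of "FF i"] FF_pos[of i] by simp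
  qed
  interpret R: renewal_law p .
  \<comment> \<open>The probability that the first symbol is 1. It balances the passage between the
    symbols, \<open>bw i * FF i = bw (\<not> i)\<close> for both \<open>i\<close>, which is
    consistent because \<open>FF False * FF True = 1\<close>.\<close>
  define t where "t = FF False / (1 + FF False)"
  have t: "0 \<le> t" "t \<le> 1" "1 - t = 1 / (1 + FF False)"
    using FF_pos[of False] by (auto simp: t_def field_simps)
  define bw where "bw = (\<lambda>i. if i then t else 1 - t)"
  have bw0: "0 \<le> bw i" for i using t(1,2) by (auto simp: bw_def)
  have bw: "bw (\<not> i) * FF (\<not> i) = bw i" for i
  proof (cases i)
    case True
    then show ?thesis using t FF_pos[of False] by (simp add: bw_def t_def)
  next
    case False
    have "t * FF True = (FF False * FF True) / (1 + FF False)" by (simp add: t_def)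
    then show ?thesis using False FF_prod[of False] t by (simp add: bw_def)
  qed
  define g where "g = geometric_pmf (1 - z)"
  have g: "pmf g n = z ^ n * (1 - z)" for n using z by (simp add: g_def pmf_geometric)
  define \<nu> where "\<nu> = R.start_measure (bernoulli_pmf t) g"
  have N: "integral\<^sup>N \<nu> f = (\<Sum>i\<in>UNIV. ennreal (bw i) * (\<Sum>n. ennreal (z ^ n * (1 - z)) * R.law (\<not> i) (\<lambda>y. f (run i (Suc n) y))))"
    if "f \<in> borel_measurable Sigma_M" for f
    unfolding \<nu>_def R.nn_integral_start[OF that] nn_integral_nat_pmf g
    using t by (subst nn_integral_bernoulli_pmf) (simp_all add: UNIV_bool bw_def mult.commute add.commute ennreal_minus)
  have dual: "integral\<^sup>N \<nu> (nn_transfer H \<beta> f) = ennreal (1 / z) * integral\<^sup>N \<nu> f"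
    if f[measurable]: "f \<in> borel_measurable Sigma_M" for f
  proof -
    have [measurable]: "H \<in> borel_measurable Sigma_M" by (rule contS_measurable[OF contH])
    have Tm: "nn_transfer H \<beta> f \<in> borel_measurable Sigma_M"
      unfolding nn_transfer_def[abs_def] by measurable
    define G where "G = (\<lambda>n i. R.law (\<not> i) (\<lambda>y. f (run i (Suc n) y)))"
    define U where "U = (\<lambda>i. \<Sum>n. ennreal (z ^ n * (1 - z)) * G (Suc n) i)"
    have lawT: "R.law (\<not> i) (\<lambda>y. nn_transfer H \<beta> f (run i (Suc n) y)) =
        G (Suc n) i + ennreal (exp (- \<beta> * cost i n)) * R.law (\<not> i) (\<lambda>y. f (pre (\<not> i) (run i (Suc n) y)))" for i n
    proof -
      have "R.law (\<not> i) (\<lambda>y. nn_transfer H \<beta> f (run i (Suc n) y)) =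
          R.law (\<not> i) (\<lambda>y. f (run i (Suc (Suc n)) y) + ennreal (exp (- \<beta> * cost i n)) * f (pre (\<not> i) (run i (Suc n) y)))"
      proof (rule R.law_cong)
        fix y :: seq assume y: "y 0 = (\<not> i)"
        have "H (run i (Suc (Suc n)) y) = A i (Suc n)" using y by (intro H_A) (auto simp: run_def)
        then have 1: "H (pre i (run i (Suc n) y)) = 0" using A0[of "Suc n" i] by (simp add: pre_run)
        have "H (pre (\<not> i) (run i (Suc n) y)) = B (\<not> i) (Suc n)"
          using y by (intro H_B) (auto simp: run_def pre_def split: nat.splits)
        also have "\<dots> = cost i n" using A0 by (simp add: cost_def del: sum.op_ivl_Suc)
        finally have 2: "H (pre (\<not> i) (run i (Suc n) y)) = cost i n" .
        have "nn_transfer H \<beta> f x = ennreal (exp (- \<beta> * H (pre i x))) * f (pre i x)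
            + ennreal (exp (- \<beta> * H (pre (\<not> i) x))) * f (pre (\<not> i) x)" for x
          by (cases i) (auto simp: nn_transfer_def add.commute)
        then show "nn_transfer H \<beta> f (run i (Suc n) y) =
          f (run i (Suc (Suc n)) y) + ennreal (exp (- \<beta> * cost i n)) * f (pre (\<not> i) (run i (Suc n) y))"
          using 1 2 by (simp add: pre_run)
      qed
      then show ?thesis by (simp add: R.law_add R.law_cmult G_def)
    qed
    \<comment> \<open>Closing the geometric run makes it a complete run with law \<open>p i\<close>,
      preceded by a single opposite symbol; \<open>law_step\<close> joins that complete run to what
      follows it.\<close>
    have other: "(\<Sum>n. ennreal (z ^ n * (1 - z)) * (ennreal (exp (- \<beta> * cost i n)) *
        R.law (\<not> i) (\<lambda>y. f (pre (\<not> i) (run i (Suc n) y))))) = ennreal ((1 - z) / z * FF i) * G 0 (\<not> i)" for i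
    proof -
      have "ennreal (z ^ n * (1 - z)) * (ennreal (exp (- \<beta> * cost i n)) * c) =
          ennreal ((1 - z) / z * FF i) * (ennreal (pmf (p i) n) * c)" for n c
      proof -
        have "z ^ n * (1 - z) * exp (- \<beta> * cost i n) = (1 - z) / z * FF i * pmf (p i) n"
          using z FF_pos[of i] by (simp add: p w_def)
        then have "ennreal (z ^ n * (1 - z)) * ennreal (exp (- \<beta> * cost i n)) =
            ennreal ((1 - z) / z * FF i) * ennreal (pmf (p i) n)"
          using z FF_pos[of i] by (simp flip: ennreal_mult)
        then show ?thesis by (simp flip: mult.assoc)
      qed
      then have "(\<Sum>n. ennreal (z ^ n * (1 - z)) * (ennreal (exp (- \<beta> * cost i n)) *
          R.law (\<not> i) (\<lambda>y. f (pre (\<not> i) (run i (Suc n) y))))) =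
          ennreal ((1 - z) / z * FF i) * (\<Sum>n. ennreal (pmf (p i) n) * R.law (\<not> i) (\<lambda>y. f (pre (\<not> i) (run i (Suc n) y))))"
        by simp
      also have "(\<Sum>n. ennreal (pmf (p i) n) * R.law (\<not> i) (\<lambda>y. f (pre (\<not> i) (run i (Suc n) y)))) =
          R.law i (\<lambda>y. f (pre (\<not> i) y))"
        by (subst R.law_step[of _ i]) (auto simp: nn_integral_nat_pmf)
      also have "\<dots> = G 0 (\<not> i)"
        unfolding G_def pre_run[of _ 0, symmetric] by simp
      finally show ?thesis .
    qed
    have "integral\<^sup>N \<nu> (nn_transfer H \<beta> f) =
        (\<Sum>i\<in>UNIV. ennreal (bw i) * (U i + ennreal ((1 - z) / z * FF i) * G 0 (\<not> i)))"
      unfolding N[OF Tm] lawT distrib_left U_def other[symmetric]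
      by (intro sum.cong refl arg_cong2[of _ _ _ _ "(+)"]) (simp add: suminf_add[symmetric] distrib_left)
    also have "\<dots> = (\<Sum>i\<in>UNIV. ennreal (bw i) * U i + ennreal ((1 - z) / z) * (ennreal (bw (\<not> i)) * G 0 (\<not> i)))"
    proof (intro sum.cong refl)
      fix i
      have "ennreal (bw i) * ennreal ((1 - z) / z * FF i) = ennreal ((1 - z) / z) * ennreal (bw (\<not> i))"
        using bw[of "\<not> i"] bw0 z FF_pos[of i] by (simp add: mult_ac flip: ennreal_mult)
      then show "ennreal (bw i) * (U i + ennreal ((1 - z) / z * FF i) * G 0 (\<not> i)) =
          ennreal (bw i) * U i + ennreal ((1 - z) / z) * (ennreal (bw (\<not> i)) * G 0 (\<not> i))"
        by (simp add: distrib_left flip: mult.assoc)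
    qed
    also have "\<dots> = (\<Sum>i\<in>UNIV. ennreal (bw i) * U i + ennreal ((1 - z) / z) * (ennreal (bw i) * G 0 i))"
      by (simp add: UNIV_bool add_ac)
    also have "\<dots> = ennreal (1 / z) * (\<Sum>i\<in>UNIV. ennreal (bw i) * (ennreal z * U i + ennreal (1 - z) * G 0 i))"
    proof -
      have "ennreal (bw i) * U i + ennreal ((1 - z) / z) * (ennreal (bw i) * G 0 i) =
          ennreal (1 / z) * (ennreal (bw i) * (ennreal z * U i + ennreal (1 - z) * G 0 i))" for i
      proof -
        have e: "ennreal (1 / z) * ennreal z = 1" "ennreal (1 / z) * ennreal (1 - z) = ennreal ((1 - z) / z)"
          using z by (simp_all flip: ennreal_mult)
        have "a * (v * (b * U i + c * G 0 i)) = (a * b) * (v * U i) + (a * c) * (v * G 0 i)" for a b c v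
          by (simp only: distrib_left mult_ac)
        from this[of "ennreal (1 / z)" "ennreal (bw i)" "ennreal z" "ennreal (1 - z)"]
        show ?thesis unfolding e by simp
      qed
      then show ?thesis by (simp add: sum_distrib_left)
    qed
    also have "(\<Sum>i\<in>UNIV. ennreal (bw i) * (ennreal z * U i + ennreal (1 - z) * G 0 i)) = integral\<^sup>N \<nu> f"
    proof -
      have "ennreal z * U i + ennreal (1 - z) * G 0 i = (\<Sum>n. ennreal (z ^ n * (1 - z)) * G n i)" for i
      proof -
        have "(\<lambda>n. ennreal (z ^ Suc n * (1 - z)) * G (Suc n) i) sums (ennreal z * U i)"
        proof -
          have "ennreal (z ^ Suc n * (1 - z)) * c = ennreal z * (ennreal (z ^ n * (1 - z)) * c)" for n c
            using z by (simp add: mult.assoc[symmetric] flip: ennreal_mult)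
          then show ?thesis unfolding U_def by (simp add: sums_iff del: power_Suc)
        qed
        from sums_Suc[OF this] show ?thesis by (simp add: sums_iff)
      qed
      then show ?thesis unfolding N[OF f] G_def by simp
    qed
    finally show ?thesis .
  qed
  show thesis
  proof (rule that)
    show P: "prob_space \<nu>" and sets: "sets \<nu> = sets Sigma_M"
      unfolding \<nu>_def by (rule R.prob_space_start, rule R.sets_start)
    show "integral\<^sup>L \<nu> (transfer H \<beta> f) = 1 / z * integral\<^sup>L \<nu> f" if "contS f" for f
      using z by (intro dual_of_nn_dual[OF P sets contH H_nonneg b0 _ dual that]) auto
  qed
qed

section \<open>The fugacity and the eigenfunction\<close>

lemma cost_bounded: "\<exists>C. 0 < C \<and> (\<forall>i n. cost i n \<le> C)"
proof -
  have "\<exists>C>0. \<forall>n. norm (cost i n) \<le> C" for i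
    using convergent_imp_Bseq[OF convergentI[OF summable_dist_tendsto[OF cost_summable]], of i] by (simp add: Bseq_def)
  then obtain C where C: "\<And>i. 0 < C i" "\<And>i n. norm (cost i n) \<le> C i" by metis
  have "cost i n \<le> max (C False) (C True)" for i n using C(2)[of i n] by (cases i) auto
  then show ?thesis using C(1)[of False] by (intro exI[of _ "max (C False) (C True)"]) auto
qed

lemma fugacity_exists:
  assumes b: "0 \<le> \<beta>"
  obtains z where "0 < z" "z < 1" "total_weight \<beta> z = 1"
proof -
  obtain C where C: "0 < C" "\<And>i n. cost i n \<le> C" using cost_bounded by metis
  define m where "m = exp (- \<beta> * C)"
  have m: "0 < m" "\<And>i n. m \<le> exp (- \<beta> * cost i n)"
    using C b by (auto simp: m_def mult_left_mono)
  have c0: "0 \<le> cost i n" for i n using cost_pos[of i n] by simp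
  \<comment> \<open>Right end for the intermediate value theorem: with every exponential replaced by
    its lower bound \<open>m\<close> the sum is geometric, and at \<open>z1\<close> it equals
    1.\<close>
  define z1 where "z1 = 1 / (1 + m)"
  have z1: "0 < z1" "z1 < 1" "z1 / (1 - z1) * m = 1" using m(1) by (auto simp: z1_def field_simps)
  have big: "1 \<le> wsum (cost i) \<beta> z1" for i
  proof -
    have "(\<lambda>n. z1 ^ Suc n * m) sums (z1 / (1 - z1) * m)" by (intro sums_mult2 geometric_weights z1)
    moreover have "z1 ^ Suc n * m \<le> z1 ^ Suc n * exp (- \<beta> * cost i n)" for n
      using z1 m by (intro mult_left_mono) auto
    ultimately have "z1 / (1 - z1) * m \<le> wsum (cost i) \<beta> z1"
      unfolding wsum_def by (intro sums_le[OF _ _ summable_sums[OF summable_wsum[OF z1(1,2) c0 b]]])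
    then show ?thesis unfolding z1(3) .
  qed
  have cont: "isCont (\<lambda>z. wsum (cost i) \<beta> z) z" if "0 \<le> z" "z \<le> z1" for z i
  proof -
    define K where "K = (z1 + 1) / 2"
    have K: "0 < K" "K < 1" "z1 < K" using z1 by (auto simp: K_def)
    \<comment> \<open>The coefficients are shifted by one, with constant term 0, so that
      \<open>wsum\<close> becomes a power series in \<open>z\<close>.\<close>
    define c where "c = (\<lambda>n. if n = 0 then 0 else exp (- \<beta> * cost i (n - 1)))"
    have "summable (\<lambda>n. c (Suc n) * K ^ Suc n)"
      using summable_wsum[OF K(1,2) c0 b] by (simp add: c_def mult_ac)
    then have sK: "summable (\<lambda>n. c n * K ^ n)" using summable_Suc_iff[of "\<lambda>n. c n * K ^ n"] by blast
    have "isCont (\<lambda>z. \<Sum>n. c n * z ^ n) z"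
      by (rule isCont_powser[OF sK]) (use that K in auto)
    moreover have "\<forall>\<^sub>F x in nhds z. wsum (cost i) \<beta> x = (\<Sum>n. c n * x ^ n)"
    proof -
      have "open {-K<..<K}" "z \<in> {-K<..<K}" using that K by auto
      then have "\<forall>\<^sub>F x in nhds z. x \<in> {-K<..<K}" by (rule eventually_nhds_in_open)
      then show ?thesis
      proof eventually_elim
        case (elim x)
        have "summable (\<lambda>n. c n * x ^ n)" by (rule powser_inside[OF sK]) (use elim K in auto)
        from suminf_split_head[OF this] show ?case by (simp add: wsum_def c_def mult.commute)
      qed
    qed
    ultimately show ?thesis
      using isCont_cong[of "wsum (cost i) \<beta>" "\<lambda>x. \<Sum>n. c n * x ^ n" z] by simp
  qed
  let ?P = "total_weight \<beta>"
  have "\<exists>z\<ge>0. z \<le> z1 \<and> ?P z = 1"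
  proof (rule IVT)
    show "?P 0 \<le> 1" by (simp add: wsum_def)
    show "1 \<le> ?P z1" using mult_mono[OF big[of False] big[of True]] big[of False] by simp
  qed (use z1 cont in auto)
  then obtain z where z: "0 \<le> z" "z \<le> z1" "?P z = 1" by blast
  moreover have "z \<noteq> 0" using z(3) by (auto simp: wsum_def)
  ultimately show thesis using that[of z] z1 by simp
qed

text \<open>The eigenfunction is the sum over all ways to lengthen the first run by m symbols and
  then to close it, weighted by prescribed values on the edges. The Lipschitz bound gives its
  continuity, and division by its maximum normalises it.\<close>

lemma gibbs_exists:
  assumes A0: "\<And>i n. 1 \<le> n \<Longrightarrow> A i n = 0" and H0: "\<And>x. x 0 = x 1 \<Longrightarrow> H x = 0"
    and lip: "\<And>k x y. same_cyl k x y \<Longrightarrow> \<bar>H x - H y\<bar> \<le> C * (1/2) ^ k" and b: "0 < \<beta>"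
  shows "\<exists>\<mu>. gibbs H \<beta> \<mu>"
proof -
  have b0: "0 \<le> \<beta>" using b by simp
  obtain z where z: "0 < z" "z < 1" and F: "total_weight \<beta> z = 1"
    using fugacity_exists[OF b0] by blast
  obtain \<nu> where nu: "prob_space \<nu>" "sets \<nu> = sets Sigma_M"
    "\<And>f. contS f \<Longrightarrow> integral\<^sup>L \<nu> (transfer H \<beta> f) = 1 / z * integral\<^sup>L \<nu> f"
    using dual_eigenmeasure_exists[OF A0 b z F] by blast
  have C0: "0 \<le> C" using lip[of 0 undefined undefined] by simp
  define FF where "FF = (\<lambda>i. wsum (cost i) \<beta> z)"
  have c0: "0 \<le> cost i n" for i n using cost_pos[of i n] by simp
  have FF_pos: "0 < FF i" for i unfolding FF_def by (intro wsum_pos z c0 b0)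
  \<comment> \<open>The edge values up to scale: \<open>c (\<not> i) = FF (\<not> i) * c i\<close>
    for both \<open>i\<close>, the relation that \<open>phi_eq\<close> imposes on an
    eigenfunction.\<close>
  define c where "c = (\<lambda>i. if i then 1 else FF False)"
  have c_pos: "0 < c i" for i using FF_pos by (simp add: c_def)
  have c_eq: "c i * FF (\<not> i) = c (\<not> i)" for i
    using F by (cases i) (auto simp: c_def FF_def mult.commute)
  define G where "G = (\<lambda>i x m. z ^ Suc m * exp (- \<beta> * H (pre (\<not> i) (run i m x))))"
  define T where "T = (\<lambda>i x. \<Sum>m. G i x m)"
  have sG: "summable (G i x)" for i x
    unfolding G_def by (rule summable_wsum[OF z H_nonneg b0])
  have T_pos: "0 < T i x" for i x
    unfolding T_def using sG z by (intro suminf_pos) (auto simp: G_def)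
  define Ps where "Ps = (\<lambda>x. c (\<not> x 0) * T (x 0) x)"
  have Ps_pos: "0 < Ps x" for x unfolding Ps_def using c_pos T_pos by simp
  have cont: "contS Ps"
    unfolding contS_iff_cyl_uc cyl_uc_def
  proof (intro allI impI)
    fix e :: real assume e: "0 < e"
    define D where "D = max (c False) (c True) * (\<beta> * C * (z / (1 - z)))"
    have "(\<lambda>k. D * (1/2) ^ k) \<longlonglongrightarrow> D * 0" by (intro tendsto_intros LIMSEQ_power_zero) simp
    then have "\<forall>\<^sub>F k in sequentially. D * (1/2) ^ k < e" using e by (intro order_tendstoD) auto
    then obtain k where k: "D * (1/2) ^ k < e" by (auto simp: eventually_sequentially)
    have "\<bar>Ps x - Ps y\<bar> < e" if xy: "same_cyl (Suc k) x y" for x y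
    proof -
      have h: "x 0 = y 0" using xy by (simp add: same_cyl_def)
      define i where "i = x 0"
      have d: "\<bar>G i x m - G i y m\<bar> \<le> z ^ Suc m * (\<beta> * C * (1/2) ^ k)" for m
      proof -
        have "same_cyl k (pre (\<not> i) (run i m x)) (pre (\<not> i) (run i m y))"
          using xy by (auto simp: same_cyl_def pre_def run_def split: nat.splits)
        then have "\<bar>H (pre (\<not> i) (run i m x)) - H (pre (\<not> i) (run i m y))\<bar> \<le> C * (1/2) ^ k" by (rule lip)
        then have "\<beta> * exp (- \<beta> * 0) * \<bar>H (pre (\<not> i) (run i m x)) - H (pre (\<not> i) (run i m y))\<bar> \<le> \<beta> * (C * (1/2) ^ k)"
          using b0 by (simp add: mult_left_mono)
        with exp_weight_diff[OF b0 H_nonneg H_nonneg]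
        have "\<bar>exp (- \<beta> * H (pre (\<not> i) (run i m x))) - exp (- \<beta> * H (pre (\<not> i) (run i m y)))\<bar> \<le> \<beta> * C * (1/2) ^ k"
          by (metis (no_types, lifting) mult.assoc order_trans)
        then show ?thesis
          unfolding G_def right_diff_distrib[symmetric] abs_mult using z by (simp add: mult_left_mono)
      qed
      have g: "(\<lambda>m. z ^ Suc m * (\<beta> * C * (1/2) ^ k)) sums (z / (1 - z) * (\<beta> * C * (1/2) ^ k))"
        by (intro sums_mult2 geometric_weights z)
      have "\<bar>T i x - T i y\<bar> \<le> z / (1 - z) * (\<beta> * C * (1/2) ^ k)"
      proof -
        have D: "(\<lambda>m. G i x m - G i y m) sums (T i x - T i y)"
          unfolding T_def by (intro sums_diff summable_sums sG)
        have "T i x - T i y \<le> z / (1 - z) * (\<beta> * C * (1/2) ^ k)"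
          by (rule sums_le[OF _ D g]) (use d in \<open>auto simp: abs_le_iff\<close>)
        moreover have "- (z / (1 - z) * (\<beta> * C * (1/2) ^ k)) \<le> T i x - T i y"
          by (rule sums_le[OF _ sums_minus[OF g] D]) (metis d abs_le_D2 minus_le_iff)
        ultimately show ?thesis by linarith
      qed
      then have "c (\<not> i) * \<bar>T i x - T i y\<bar> \<le> c (\<not> i) * (z / (1 - z) * (\<beta> * C * (1/2) ^ k))"
        using c_pos[of "\<not> i"] by (intro mult_left_mono) auto
      also have "\<dots> \<le> max (c False) (c True) * (z / (1 - z) * (\<beta> * C * (1/2) ^ k))"
        using z b0 C0 by (intro mult_right_mono) (cases i; auto)+
      also have "\<dots> = D * (1/2) ^ k" by (simp add: D_def)
      finally have "c (\<not> i) * \<bar>T i x - T i y\<bar> < e" using k by linarith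
      moreover have "Ps x - Ps y = c (\<not> i) * (T i x - T i y)"
        by (simp add: Ps_def i_def h right_diff_distrib)
      ultimately show ?thesis using c_pos[of "\<not> i"] by (simp add: abs_mult)
    qed
    then show "\<exists>n. \<forall>x y. same_cyl n x y \<longrightarrow> \<bar>Ps x - Ps y\<bar> < e" by blast
  qed
  have eig: "transfer H \<beta> Ps x = 1 / z * Ps x" for x
  proof -
    define i where "i = x 0"
    have tr: "transfer H \<beta> Ps x = exp (- \<beta> * H (pre i x)) * Ps (pre i x) + exp (- \<beta> * H (pre (\<not> i) x)) * Ps (pre (\<not> i) x)"
      by (cases i) (auto simp: transfer_def)
    have H1: "H (pre i x) = 0"
      using H0[of "pre i x"] by (simp add: i_def)
    have G1: "G i (pre i x) m = 1 / z * G i x (Suc m)" for m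
    proof -
      have "run i m (pre i x) = run i (Suc m) x"
        by (auto simp: run_def pre_def fun_eq_iff split: nat.splits)
          (metis Suc_diff_Suc Suc_lessI diff_Suc_Suc less_SucE not_less_eq old.nat.inject zero_less_diff zero_neq_one)+
      then show ?thesis using z by (simp add: G_def)
    qed
    have "T i (pre i x) = 1 / z * (T i x - G i x 0)"
      unfolding T_def G1 suminf_split_head[OF sG, symmetric]
      by (rule suminf_mult[OF summable_Suc_iff[THEN iffD2, OF sG]])
    \<comment> \<open>Since \<open>x\<close> begins with \<open>i\<close>, the prepended symbol
      opens a fresh run of length one, and its prolongations are complete runs with the costs
      \<open>cost (\<not> i)\<close>.\<close>
    moreover have "T (\<not> i) (pre (\<not> i) x) = FF (\<not> i)"
    proof -
      have "H (pre i (run (\<not> i) m (pre (\<not> i) x))) = cost (\<not> i) m" for m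
      proof -
        have "H (pre i (run (\<not> i) m (pre (\<not> i) x))) = B i (Suc m)"
          by (rule H_B) (auto simp: run_def pre_def i_def split: nat.splits)
        then show ?thesis using A0 by (simp add: cost_def del: sum.op_ivl_Suc)
      qed
      then show ?thesis by (simp add: T_def G_def FF_def wsum_def)
    qed
    moreover have "G i x 0 = z * exp (- \<beta> * H (pre (\<not> i) x))" by (simp add: G_def)
    ultimately show ?thesis
      unfolding tr H1 using z c_eq[of i]
      by (simp add: Ps_def i_def[symmetric]) (simp add: field_simps)
  qed
  obtain x1 where x1: "\<And>y. Ps y \<le> Ps x1" using contS_attains_sup[OF cont] by blast
  define \<Phi> where "\<Phi> = (\<lambda>x. Ps x / Ps x1)"
  have "contS (\<lambda>x. Ps x * (1 / Ps x1))" by (intro contS_mult cont) simp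
  then have cPhi: "contS \<Phi>" by (simp add: \<Phi>_def)
  have "transfer H \<beta> \<Phi> x = 1 / z * \<Phi> x" for x
  proof -
    have "transfer H \<beta> \<Phi> x = transfer H \<beta> Ps x / Ps x1" by (simp add: \<Phi>_def transfer_def add_divide_distrib)
    then show ?thesis by (simp add: eig \<Phi>_def)
  qed
  then have "gibbs H \<beta> (density \<nu> (\<lambda>x. ennreal (\<Phi> x / integral\<^sup>L \<nu> \<Phi>)))"
    unfolding gibbs_def using nu z cPhi Ps_pos x1
    by (intro exI[of _ \<Phi>] exI[of _ "1 / z"] exI[of _ \<nu>]) (auto simp: \<Phi>_def divide_le_eq intro!: exI[of _ x1] less_imp_neq[symmetric])
  then show ?thesis by blast
qed

end

section \<open>An oscillating example\<close>

text \<open>Runs of length at most N have total weight at most N exp (- N); every other run counts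
  with a length above N.\<close>

lemma mean_long_ge:
  assumes z: "0 < z" "z < 1" and b: "0 \<le> \<beta>" and h: "\<And>n. 0 \<le> h n" and N: "\<And>n. n < N \<Longrightarrow> real N \<le> \<beta> * h n"
  shows "real N * (wsum h \<beta> z - real N * exp (- real N)) \<le> wmean h \<beta> z"
proof -
  let ?u = "\<lambda>n. z ^ Suc n * exp (- \<beta> * h n)"
  have s: "summable ?u" by (rule summable_wsum[OF z h b])
  have s2: "summable (\<lambda>n. real (Suc n) * ?u n)"
    using summable_mult[OF summable_wmean_scaled[OF z h b], of "z / (1 - z)"] z by (simp add: mult_ac)
  have u0: "0 \<le> ?u n" for n using z by simp
  have "(\<Sum>n<N. ?u n) \<le> (\<Sum>n<N. exp (- real N))"
  proof (rule sum_mono)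
    fix n assume "n \<in> {..<N}"
    then have "exp (- \<beta> * h n) \<le> exp (- real N)" using N[of n] by simp
    moreover have "z ^ Suc n \<le> 1" by (rule geometric_weights(2)[OF z])
    ultimately show "?u n \<le> exp (- real N)" using z mult_mono[of "z ^ Suc n" 1 "exp (- \<beta> * h n)" "exp (- real N)"] by simp
  qed
  then have "wsum h \<beta> z - real N * exp (- real N) \<le> (\<Sum>n. ?u (n + N))"
    unfolding wsum_def using suminf_split_initial_segment[OF s, of N] by simp
  then have "real N * (wsum h \<beta> z - real N * exp (- real N)) \<le> real N * (\<Sum>n. ?u (n + N))"
    by (intro mult_left_mono) auto
  also have "\<dots> = (\<Sum>n. real N * ?u (n + N))"
    by (rule suminf_mult[symmetric, OF summable_iff_shift[THEN iffD2, OF s]])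
  also have "\<dots> \<le> (\<Sum>n. real (Suc (n + N)) * ?u (n + N))"
    by (intro suminf_le summable_mult mult_right_mono u0 summable_iff_shift[THEN iffD2, OF s] summable_iff_shift[THEN iffD2, OF s2]) auto
  also have "\<dots> \<le> wmean h \<beta> z"
    unfolding wmean_def using suminf_split_initial_segment[OF s2, of N] u0
    by (simp add: sum_nonneg)
  finally show ?thesis .
qed

lemma wsum_ge_tail:
  assumes z: "0 < z" "z < 1" and b: "0 \<le> \<beta>" and h: "\<And>n. 0 \<le> h n" and N: "\<And>n. N \<le> n \<Longrightarrow> \<beta> * h n \<le> 1"
  shows "exp (-1) * (z ^ N * (z / (1 - z))) \<le> wsum h \<beta> z"
proof -
  let ?u = "\<lambda>n. z ^ Suc n * exp (- \<beta> * h n)"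
  have s: "summable ?u" by (rule summable_wsum[OF z h b])
  have g: "(\<lambda>n. exp (-1) * (z ^ N * z ^ Suc n)) sums (exp (-1) * (z ^ N * (z / (1 - z))))"
    by (intro sums_mult geometric_weights z)
  have "exp (-1) * (z ^ N * (z / (1 - z))) \<le> (\<Sum>n. ?u (n + N))"
    unfolding sums_unique[OF g]
  proof (rule suminf_le[OF _ sums_summable[OF g] summable_iff_shift[THEN iffD2, OF s]])
    fix n
    have "exp (-1) * z ^ Suc (n + N) \<le> exp (- \<beta> * h (n + N)) * z ^ Suc (n + N)"
      using z N[of "n + N"] by (intro mult_right_mono) auto
    then show "exp (-1) * (z ^ N * z ^ Suc n) \<le> ?u (n + N)" by (simp add: power_add mult_ac)
  qed
  also have "\<dots> \<le> wsum h \<beta> z"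
    unfolding wsum_def using suminf_split_initial_segment[OF s, of N] z by (simp add: sum_nonneg)
  finally show ?thesis .
qed

lemma wsum_le_geometric:
  assumes z: "0 < z" "z < 1" and b: "0 \<le> \<beta>" and h: "\<And>n. 0 \<le> h n"
  shows "wsum h \<beta> z \<le> z / (1 - z)"
  unfolding wsum_def sums_unique[OF geometric_weights(1)[OF z]]
  by (intro suminf_le summable_wsum z h b sums_summable[OF geometric_weights(1)[OF z]])
    (use z b h in \<open>auto intro!: mult_left_le mult_nonneg_nonneg\<close>)

text \<open>Beyond \<open>N\<close> the weights lie between \<open>exp (-1) * z ^ Suc n\<close> and
  \<open>z ^ Suc n\<close>, so up to a factor e they are geometric, with an excess over
  \<open>N\<close> of mean 1 / (1 - z). Lengths up to \<open>N\<close> contribute at most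
  \<open>N\<close>.\<close>

lemma mean_short_le:
  assumes z: "0 < z" "z < 1" and b: "0 \<le> \<beta>" and h: "\<And>n. 0 \<le> h n" and N: "\<And>n. N \<le> n \<Longrightarrow> \<beta> * h n \<le> 1"
  shows "wmean h \<beta> z / wsum h \<beta> z \<le> real N + exp 1 * (real N + 1 / (1 - z))"
proof -
  let ?u = "\<lambda>n. z ^ Suc n * exp (- \<beta> * h n)"
  have s: "summable ?u" by (rule summable_wsum[OF z h b])
  have s2: "summable (\<lambda>n. real (Suc n) * ?u n)"
    using summable_mult[OF summable_wmean_scaled[OF z h b], of "z / (1 - z)"] z by (simp add: mult_ac)
  have F: "0 < wsum h \<beta> z" by (rule wsum_pos[OF z h b])
  have u0: "0 \<le> ?u n" for n using z by simp
  have "(\<Sum>n<N. real (Suc n) * ?u n) \<le> (\<Sum>n<N. real N * ?u n)"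
    using u0 by (intro sum_mono mult_right_mono) auto
  also have "\<dots> = real N * (\<Sum>n<N. ?u n)" by (simp add: sum_distrib_left)
  also have "\<dots> \<le> real N * wsum h \<beta> z"
    unfolding wsum_def using u0 by (intro mult_left_mono sum_le_suminf s) auto
  finally have 1: "(\<Sum>n<N. real (Suc n) * ?u n) \<le> real N * wsum h \<beta> z" .
  have d: "(\<lambda>n. real (Suc n) * z ^ Suc n) sums (z / (1 - z) * (1 / (1 - z)))"
    using sums_mult[OF geometric_weights(3)[OF z], of "z / (1 - z)"] z by (simp add: mult_ac)
  have g: "(\<lambda>n. z ^ N * (real N * z ^ Suc n + real (Suc n) * z ^ Suc n)) sums
      (z ^ N * (real N * (z / (1 - z)) + z / (1 - z) * (1 / (1 - z))))"
    by (intro sums_mult sums_add d geometric_weights z)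
  have "(\<Sum>n. real (Suc (n + N)) * ?u (n + N)) \<le> z ^ N * (real N * (z / (1 - z)) + z / (1 - z) * (1 / (1 - z)))"
    unfolding sums_unique[OF g]
  proof (rule suminf_le[OF _ summable_iff_shift[THEN iffD2, OF s2] sums_summable[OF g]])
    fix n
    have "exp (- \<beta> * h (n + N)) \<le> 1" using b h[of "n + N"] by simp
    then have "real (Suc (n + N)) * ?u (n + N) \<le> real (Suc (n + N)) * z ^ Suc (n + N)"
      using z by (intro mult_left_mono mult_left_le) auto
    also have "\<dots> = z ^ N * (real N * z ^ Suc n + real (Suc n) * z ^ Suc n)"
      by (simp add: power_add algebra_simps)
    finally show "real (Suc (n + N)) * ?u (n + N) \<le> \<dots>" .
  qed
  also have "\<dots> = exp 1 * (real N + 1 / (1 - z)) * (exp (-1) * (z ^ N * (z / (1 - z))))"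
  proof -
    have "exp 1 * exp (-1) = (1::real)" by (simp flip: exp_add)
    moreover have "exp 1 * (real N + 1 / (1 - z)) * (exp (-1) * (z ^ N * (z / (1 - z)))) =
      (exp 1 * exp (-1)) * (z ^ N * (real N * (z / (1 - z)) + z / (1 - z) * (1 / (1 - z))))"
      by (simp only: algebra_simps)
    ultimately show ?thesis by simp
  qed
  also have "\<dots> \<le> exp 1 * (real N + 1 / (1 - z)) * wsum h \<beta> z"
    using z by (intro mult_left_mono wsum_ge_tail z b h N) auto
  finally have "wmean h \<beta> z \<le> (real N + exp 1 * (real N + 1 / (1 - z))) * wsum h \<beta> z"
    unfolding wmean_def using suminf_split_initial_segment[OF s2, of N] 1 by (simp add: distrib_right)
  then show ?thesis using F by (simp add: pos_divide_le_eq)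
qed

text \<open>With y = z / (1 - z), the tail bounds for both sums and the equation \<open>F\<close>
  give y^2 z^(N + N') \<le> e^2; take logarithms and use - ln z \<le> 1 / y. The point is that y
  grows more slowly than N, so the geometric cutoff comes well before the break point
  \<open>N\<close>.\<close>

lemma fugacity_bound:
  assumes z: "0 < z" "z < 1" and b: "0 \<le> \<beta>" and h: "\<And>n. 0 \<le> hL n" "\<And>n. 0 \<le> hS n"
    and N: "\<And>n. N \<le> n \<Longrightarrow> \<beta> * hL n \<le> 1" "\<And>n. N' \<le> n \<Longrightarrow> \<beta> * hS n \<le> 1" and le: "N' \<le> N"
    and F: "wsum hL \<beta> z * wsum hS \<beta> z = 1"
  shows "z / (1 - z) * (ln (z / (1 - z)) - 1) \<le> real N"
proof -
  define y where "y = z / (1 - z)"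
  have y: "0 < y" using z by (simp add: y_def)
  have FL: "0 < wsum hL \<beta> z" by (rule wsum_pos[OF z h(1) b])
  have "exp (-1) * (z ^ N * y) \<le> wsum hL \<beta> z" "exp (-1) * (z ^ N' * y) \<le> wsum hS \<beta> z"
    unfolding y_def by (intro wsum_ge_tail z b h N, assumption)+
  then have "(exp (-1) * (z ^ N * y)) * (exp (-1) * (z ^ N' * y)) \<le> wsum hL \<beta> z * wsum hS \<beta> z"
    using z y less_imp_le[OF FL] by (intro mult_mono) auto
  then have "(exp (-1) * (z ^ N * y)) * (exp (-1) * (z ^ N' * y)) \<le> 1" unfolding F .
  then have "ln ((exp (-1) * (z ^ N * y)) * (exp (-1) * (z ^ N' * y))) \<le> 0"
    using z y by (subst ln_le_zero_iff) auto
  then have "2 * ln y + (real N + real N') * ln z \<le> 2"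
    using z y by (simp add: ln_mult ln_realpow algebra_simps)
  moreover have "- ln z \<le> 1 / y"
  proof -
    have "ln (1 / z) \<le> 1 / z - 1" using z by (intro ln_le_minus_one) auto
    then show ?thesis using z by (simp add: ln_div y_def field_simps)
  qed
  then have "- ((real N + real N') * ln z) \<le> (real N + real N) * (1 / y)"
    using z le mult_mono[of "real N + real N'" "real N + real N" "- ln z" "1 / y"] by (simp add: ln_le_zero_iff)
  ultimately have "ln y - 1 \<le> real N / y" by simp
  then show ?thesis using y by (simp add: y_def[symmetric] pos_le_divide_eq mult.commute)
qed

text \<open>The mean for \<open>hL\<close> is eventually at least N / 2. The mean for
  \<open>hS\<close> is bounded in terms of N' and y, which are both negligible against N: the former
  by hypothesis, the latter by \<open>fugacity_bound\<close>.\<close>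

lemma long_run_limits:
  fixes \<beta> z :: "nat \<Rightarrow> real" and N N' :: "nat \<Rightarrow> nat"
  assumes h: "\<And>n. 0 < hL n" "\<And>n. 0 < hS n" and b: "\<And>k. 0 < \<beta> k" "filterlim \<beta> at_top sequentially"
    and z: "\<And>k. 0 < z k" "\<And>k. z k < 1" and F: "\<And>k. wsum hL (\<beta> k) (z k) * wsum hS (\<beta> k) (z k) = 1"
    and long: "\<And>k n. n < N k \<Longrightarrow> real (N k) \<le> \<beta> k * hL n" "\<And>k n. N k \<le> n \<Longrightarrow> \<beta> k * hL n \<le> 1"
    and short: "\<And>k n. N' k \<le> n \<Longrightarrow> \<beta> k * hS n \<le> 1"
    and N: "\<And>k. N' k \<le> N k" "filterlim N at_top sequentially" "(\<lambda>k. real (N' k) / real (N k)) \<longlonglongrightarrow> 0"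
  defines "mL \<equiv> \<lambda>k. wmean hL (\<beta> k) (z k) / wsum hL (\<beta> k) (z k)" and "mS \<equiv> \<lambda>k. wmean hS (\<beta> k) (z k) / wsum hS (\<beta> k) (z k)"
  shows "(\<lambda>k. 1 / (mL k + mS k)) \<longlonglongrightarrow> 0" "(\<lambda>k. mS k / (mL k + mS k)) \<longlonglongrightarrow> 0"
    "(\<lambda>k. mL k / (mL k + mS k)) \<longlonglongrightarrow> 1"
proof -
  have h': "0 \<le> hL n" "0 \<le> hS n" for n using h[of n] by auto
  have b': "0 \<le> \<beta> k" for k using b(1)[of k] by simp
  define y where "y = (\<lambda>k. z k / (1 - z k))"
  have y: "0 < y k" for k using z[of k] by (simp add: y_def)
  have zl: "z \<longlonglongrightarrow> 1" by (rule fugacity_tendsto_1[OF h b(2)]) (use z F in auto)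
  have y_inf: "filterlim y at_top sequentially"
    unfolding y_def
  proof (rule LIM_at_top_divide[OF zl])
    show "(\<lambda>k. 1 - z k) \<longlonglongrightarrow> 0" using tendsto_diff[OF tendsto_const[of 1] zl] by simp
  qed (use z in auto)
  have Nr: "filterlim (\<lambda>k. real (N k)) at_top sequentially"
    by (rule filterlim_compose[OF filterlim_real_sequentially N(2)])
  have Npos: "\<forall>\<^sub>F k in sequentially. 0 < real (N k)" using Nr unfolding filterlim_at_top_dense by blast
  have yN: "(\<lambda>k. y k / real (N k)) \<longlonglongrightarrow> 0"
  proof (rule tendsto_sandwich[OF _ _ tendsto_const])
    show "\<forall>\<^sub>F k in sequentially. 0 \<le> y k / real (N k)" using y by (simp add: less_imp_le)
    have "\<forall>\<^sub>F k in sequentially. exp 2 < y k" using y_inf by (simp add: filterlim_at_top_dense)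
    then show "\<forall>\<^sub>F k in sequentially. y k / real (N k) \<le> 1 / (ln (y k) - 1)"
      using Npos
    proof eventually_elim
      case (elim k)
      have "exp 2 < y k" by fact
      then have "2 < ln (y k)" using y[of k] by (metis exp_less_cancel_iff exp_ln)
      moreover have "y k * (ln (y k) - 1) \<le> real (N k)"
        unfolding y_def
        by (rule fugacity_bound[where hL = hL and hS = hS and N = "N k" and N' = "N' k", OF z b' h' long(2) short N(1) F])
      ultimately show ?case using elim by (simp add: field_simps)
    qed
    have "((\<lambda>x::real. 1 / (ln x - 1)) \<longlongrightarrow> 0) at_top" by real_asymp
    from filterlim_compose[OF this y_inf] show "(\<lambda>k. 1 / (ln (y k) - 1)) \<longlonglongrightarrow> 0" .
  qed
  have mS_nonneg: "0 \<le> mS k" for k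
  proof -
    have "0 < wsum hS (\<beta> k) (z k)" by (intro wsum_pos z h' b')
    moreover have "summable (\<lambda>n. z k / (1 - z k) * ((1 - z k) * (real (Suc n) * z k ^ n) * exp (- \<beta> k * hS n)))"
      by (intro summable_mult summable_wmean_scaled z h' b')
    then have "summable (\<lambda>n. real (Suc n) * (z k ^ Suc n * exp (- \<beta> k * hS n)))"
      using z[of k] by (simp add: mult_ac)
    ultimately show ?thesis
      unfolding mS_def wmean_def using z[of k] by (intro divide_nonneg_pos suminf_nonneg) auto
  qed
  have mS: "(\<lambda>k. mS k / real (N k)) \<longlonglongrightarrow> 0"
  proof (rule tendsto_sandwich[OF _ _ tendsto_const])
    show "\<forall>\<^sub>F k in sequentially. 0 \<le> mS k / real (N k)" using mS_nonneg by simp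
    show "\<forall>\<^sub>F k in sequentially. mS k / real (N k) \<le>
        real (N' k) / real (N k) + exp 1 * (real (N' k) / real (N k) + (y k / real (N k)) / z k)"
    proof (intro always_eventually allI)
      fix k
      have "mS k \<le> real (N' k) + exp 1 * (real (N' k) + 1 / (1 - z k))"
        unfolding mS_def using z b' h' short by (intro mean_short_le) auto
      also have "1 / (1 - z k) = y k / z k" using z[of k] by (simp add: y_def)
      finally have "mS k / real (N k) \<le> (real (N' k) + exp 1 * (real (N' k) + y k / z k)) / real (N k)"
        by (rule divide_right_mono) simp
      also have "\<dots> = real (N' k) / real (N k) + exp 1 * (real (N' k) / real (N k) + (y k / real (N k)) / z k)"
        by (simp add: add_divide_distrib distrib_left)
      finally show "mS k / real (N k) \<le> \<dots>" .
    qed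
    have "(\<lambda>k. real (N' k) / real (N k) + exp 1 * (real (N' k) / real (N k) + (y k / real (N k)) / z k)) \<longlonglongrightarrow> 0 + exp 1 * (0 + 0 / 1)"
      by (intro tendsto_intros N(3) yN zl) simp
    then show "(\<lambda>k. real (N' k) / real (N k) + exp 1 * (real (N' k) / real (N k) + (y k / real (N k)) / z k)) \<longlonglongrightarrow> 0" by simp
  qed
  \<comment> \<open>The discarded weight N exp (- N) has to be small relative to
    \<open>wsum hL\<close>. The equation \<open>F\<close> turns the reciprocal of that sum into
    \<open>wsum hS\<close>, which is at most y and hence of smaller order than N, so exp (- N)
    wins.\<close>
  have mL: "\<forall>\<^sub>F k in sequentially. 1 / 2 \<le> mL k / real (N k)"
  proof -
    have "((\<lambda>x::real. x * x * exp (- x)) \<longlongrightarrow> 0) at_top" by real_asymp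
    from tendsto_mult[OF filterlim_compose[OF this Nr] yN]
    have "(\<lambda>k. real (N k) * real (N k) * exp (- real (N k)) * (y k / real (N k))) \<longlonglongrightarrow> 0" by simp
    then have "\<forall>\<^sub>F k in sequentially. real (N k) * real (N k) * exp (- real (N k)) * (y k / real (N k)) < 1 / 2"
      by (rule order_tendstoD) simp
    then show ?thesis using Npos
    proof eventually_elim
      case (elim k)
      have FL: "0 < wsum hL (\<beta> k) (z k)" and FS: "0 < wsum hS (\<beta> k) (z k)" by (intro wsum_pos z h' b')+
      have "wsum hS (\<beta> k) (z k) \<le> y k" unfolding y_def by (intro wsum_le_geometric z h' b')
      then have "wsum hL (\<beta> k) (z k) * wsum hS (\<beta> k) (z k) \<le> wsum hL (\<beta> k) (z k) * y k"
        using FL by (intro mult_left_mono) auto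
      then have "1 / wsum hL (\<beta> k) (z k) \<le> y k"
        unfolding F using FL by (simp add: pos_divide_le_eq mult.commute)
      then have "real (N k) * exp (- real (N k)) * (1 / wsum hL (\<beta> k) (z k)) \<le> real (N k) * exp (- real (N k)) * y k"
        by (intro mult_left_mono) auto
      also have "\<dots> \<le> 1 / 2" using elim by simp
      finally have "real (N k) * exp (- real (N k)) / wsum hL (\<beta> k) (z k) \<le> 1 / 2" by simp
      then have "1 / 2 \<le> (wsum hL (\<beta> k) (z k) - real (N k) * exp (- real (N k))) / wsum hL (\<beta> k) (z k)"
        using FL by (simp add: diff_divide_distrib)
      also have "\<dots> \<le> mL k / real (N k)"
      proof -
        have "real (N k) * (wsum hL (\<beta> k) (z k) - real (N k) * exp (- real (N k))) \<le> wmean hL (\<beta> k) (z k)"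
          by (intro mean_long_ge z b' h' long)
        then have "wsum hL (\<beta> k) (z k) - real (N k) * exp (- real (N k)) \<le> wmean hL (\<beta> k) (z k) / real (N k)"
          using elim by (simp add: pos_le_divide_eq mult.commute)
        from divide_right_mono[OF this less_imp_le[OF FL]] show ?thesis
          unfolding mL_def by (simp add: mult.commute)
      qed
      finally show ?case .
    qed
  qed
  have big: "\<forall>\<^sub>F k in sequentially. real (N k) / 2 \<le> mL k + mS k \<and> 0 < real (N k)"
    using mL Npos by eventually_elim (use mS_nonneg in \<open>auto simp: field_simps intro: add_increasing2\<close>)
  show "(\<lambda>k. 1 / (mL k + mS k)) \<longlonglongrightarrow> 0"
  proof (rule tendsto_sandwich[OF _ _ tendsto_const])
    show "\<forall>\<^sub>F k in sequentially. 0 \<le> 1 / (mL k + mS k)" using big by eventually_elim auto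
    show "\<forall>\<^sub>F k in sequentially. 1 / (mL k + mS k) \<le> 2 / real (N k)"
      using big by eventually_elim (use frac_le[of 1 1] in \<open>force simp: field_simps\<close>)
    have "((\<lambda>x::real. 2 / x) \<longlongrightarrow> 0) at_top" by real_asymp
    from filterlim_compose[OF this Nr] show "(\<lambda>k. 2 / real (N k)) \<longlonglongrightarrow> 0" .
  qed
  show S0: "(\<lambda>k. mS k / (mL k + mS k)) \<longlonglongrightarrow> 0"
  proof (rule tendsto_sandwich[OF _ _ tendsto_const])
    show "\<forall>\<^sub>F k in sequentially. 0 \<le> mS k / (mL k + mS k)" using big by eventually_elim (use mS_nonneg in auto)
    show "\<forall>\<^sub>F k in sequentially. mS k / (mL k + mS k) \<le> 2 * (mS k / real (N k))"
      using big
    proof eventually_elim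
      case (elim k)
      have "mS k / (mL k + mS k) \<le> mS k / (real (N k) / 2)"
        using elim mS_nonneg[of k] by (intro divide_left_mono mult_pos_pos) auto
      then show ?case by (simp add: mult.commute)
    qed
    show "(\<lambda>k. 2 * (mS k / real (N k))) \<longlonglongrightarrow> 0" using tendsto_mult[OF tendsto_const[of 2] mS] by simp
  qed
  have "(\<lambda>k. 1 - mS k / (mL k + mS k)) \<longlonglongrightarrow> 1 - 0" by (intro tendsto_intros S0)
  then have "(\<lambda>k. 1 - mS k / (mL k + mS k)) \<longlonglongrightarrow> 1" by simp
  moreover have "\<forall>\<^sub>F k in sequentially. 1 - mS k / (mL k + mS k) = mL k / (mL k + mS k)"
    using big by eventually_elim (auto simp: field_simps)
  ultimately show "(\<lambda>k. mL k / (mL k + mS k)) \<longlonglongrightarrow> 1" by (rule Lim_transform_eventually)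
qed

section \<open>The step potential and its sequence of temperatures\<close>

definition brk :: "nat \<Rightarrow> nat" where "brk j = fact (Suc j)"

lemma brk_ge: "Suc j \<le> brk j"
  unfolding brk_def by (rule fact_ge_self)

text \<open>The ratio of consecutive break points tends to infinity, which makes the previous one
  negligible against the current one; that it is at least 2 is what the choice of
  \<open>osc_beta\<close> relies on.\<close>

lemma brk_Suc: "brk (Suc j) = (j + 2) * brk j"
  by (simp add: brk_def)

lemma brk_double: "2 * brk j \<le> brk (Suc j)"
  unfolding brk_Suc by (intro mult_right_mono) auto

lemma brk_mono: "i \<le> j \<Longrightarrow> brk i \<le> brk j"
  unfolding brk_def by (intro fact_mono) auto

text \<open>\<open>b_n^0\<close> has its steps at the break points of even index and \<open>b_n^1\<close> at those of odd index.\<close>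

definition lev :: "bool \<Rightarrow> nat \<Rightarrow> nat" where
  "lev i n = (LEAST m. \<exists>j. even j = (\<not> i) \<and> m = brk j \<and> n \<le> m)"

lemma lev_brk: "\<exists>j. even j = (\<not> i) \<and> lev i n = brk j \<and> n \<le> lev i n"
proof -
  obtain j where "even j = (\<not> i)" "n \<le> j"
    by (cases "even n = (\<not> i)") (auto intro: that[of n] that[of "Suc n"])
  then have "\<exists>j. even j = (\<not> i) \<and> brk j = brk j \<and> n \<le> brk j"
    using brk_ge[of j] by (intro exI[of _ j]) auto
  then have "\<exists>m. \<exists>j. even j = (\<not> i) \<and> m = brk j \<and> n \<le> m" by blast
  from LeastI_ex[OF this] show ?thesis unfolding lev_def[symmetric] by metis
qed

lemma lev_ge: "n \<le> lev i n"
  using lev_brk by blast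

lemma lev_le: "even j = (\<not> i) \<Longrightarrow> n \<le> brk j \<Longrightarrow> lev i n \<le> brk j"
  unfolding lev_def by (rule Least_le) blast

text \<open>Break points of one parity are two indices apart, so past \<open>brk j\<close> the level
  skips \<open>brk (Suc j)\<close>.\<close>

lemma lev_jump:
  assumes "even j = (\<not> i)" "brk j < n" shows "brk (Suc (Suc j)) \<le> lev i n"
proof -
  obtain j' where j': "even j' = (\<not> i)" "lev i n = brk j'" "n \<le> lev i n" using lev_brk by blast
  have "\<not> j' \<le> j" using brk_mono[of j' j] j' assms(2) by linarith
  then have "Suc j \<le> j'" by simp
  moreover have "j' \<noteq> Suc j" using j'(1) assms(1) by auto
  ultimately show ?thesis unfolding j'(2) by (intro brk_mono) simp
qed

definition osc_b :: "bool \<Rightarrow> nat \<Rightarrow> real" where "osc_b i n = (1/2) ^ lev i n"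

text \<open>Positions 0 and 1 are settled by the first conjunct, so the run following x_0 has length
  one more than the \<open>LEAST\<close> index. Where that run never ends, the value 0 is the limit
  of \<open>osc_b\<close>, as continuity requires.\<close>

definition osc_H :: "seq \<Rightarrow> real" where
  "osc_H x = (if x 0 \<noteq> x 1 \<and> (\<exists>n. x (Suc (Suc n)) = x 0)
     then osc_b (x 0) (Suc (LEAST n. x (Suc (Suc n)) = x 0)) else 0)"

lemma osc_b_pos: "0 < osc_b i n" and osc_b_le: "osc_b i n \<le> (1/2) ^ n"
  unfolding osc_b_def by (simp, intro power_decreasing) (auto simp: lev_ge)

lemma osc_H_const: "x 0 = x 1 \<Longrightarrow> osc_H x = 0"
  by (simp add: osc_H_def)

lemma osc_H_nonneg: "0 \<le> osc_H x"
  by (simp add: osc_H_def osc_b_pos less_imp_le)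

lemma osc_H_run:
  assumes "1 \<le> n" "x 0 = i" "\<forall>k\<in>{1..n}. x k = (\<not> i)" "x (Suc n) = i"
  shows "osc_H x = osc_b i n"
proof -
  have L: "(LEAST m. x (Suc (Suc m)) = x 0) = n - 1"
  proof (rule Least_equality)
    show "x (Suc (Suc (n - 1))) = x 0" using assms by simp
    fix m assume "x (Suc (Suc m)) = x 0"
    then have "Suc (Suc m) \<notin> {1..n}" using assms(2,3) by metis
    then show "n - 1 \<le> m" by simp
  qed
  have "x 0 \<noteq> x 1" using assms(1-3) by auto
  moreover have "\<exists>m. x (Suc (Suc m)) = x 0" using assms by (intro exI[of _ "n - 1"]) simp
  ultimately show ?thesis unfolding osc_H_def L using assms(1,2) by simp
qed

lemma osc_H_le:
  assumes "x 0 \<noteq> x 1" "\<And>n. Suc (Suc n) < k \<Longrightarrow> x (Suc (Suc n)) \<noteq> x 0"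
  shows "osc_H x \<le> 2 * (1/2) ^ k"
proof (cases "\<exists>n. x (Suc (Suc n)) = x 0")
  case True
  define m where "m = (LEAST n. x (Suc (Suc n)) = x 0)"
  have "x (Suc (Suc m)) = x 0" unfolding m_def using True by (rule LeastI_ex)
  then have "k \<le> Suc (Suc m)" using assms(2)[of m] by linarith
  have "osc_H x = osc_b (x 0) (Suc m)" using assms(1) True by (simp add: osc_H_def m_def)
  also have "\<dots> \<le> (1/2) ^ Suc m" by (rule osc_b_le)
  also have "\<dots> = 2 * (1/2) ^ Suc (Suc m)" by simp
  also have "\<dots> \<le> 2 * (1/2) ^ k" using \<open>k \<le> _\<close> by (intro mult_left_mono power_decreasing) auto
  finally show ?thesis .
qed (simp add: osc_H_def)

text \<open>If the first return of x_0 is visible in the common prefix, the values agree. Otherwise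
  both runs have length at least k - 1, and both values are at most 2^-(k - 1): hence the factor
  2.\<close>

lemma osc_H_lipschitz:
  assumes "same_cyl k x y" shows "\<bar>osc_H x - osc_H y\<bar> \<le> 2 * (1/2) ^ k"
proof -
  have le1: "osc_H x \<le> 1" for x
  proof -
    have "osc_b i n \<le> 1" for i n
      using order_trans[OF osc_b_le power_le_one] by simp
    then show ?thesis unfolding osc_H_def by (split if_split) (intro conjI impI zero_le_one)
  qed
  have half: "\<bar>osc_H x - osc_H y\<bar> \<le> c" if "osc_H x \<le> c" "osc_H y \<le> c" for c
    using that osc_H_nonneg[of x] osc_H_nonneg[of y] by linarith
  consider "k < 2" | "2 \<le> k" "x 0 = x 1" | "2 \<le> k" "x 0 \<noteq> x 1" "\<exists>n. Suc (Suc n) < k \<and> x (Suc (Suc n)) = x 0"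
    | "2 \<le> k" "x 0 \<noteq> x 1" "\<And>n. Suc (Suc n) < k \<Longrightarrow> x (Suc (Suc n)) \<noteq> x 0" by fastforce
  then show ?thesis
  proof cases
    case 1
    then have "(1::real) \<le> 2 * (1/2) ^ k" by (cases k) auto
    then show ?thesis using half[of 1] le1 by fastforce
  next
    case 2
    then have "y 0 = y 1" using assms by (auto simp: same_cyl_def)
    then show ?thesis using 2 by (simp add: osc_H_const)
  next
    case 3
    then obtain n where n: "Suc (Suc n) < k" "x (Suc (Suc n)) = x 0" by blast
    have eq: "x m = y m" if "m < k" for m using assms that by (simp add: same_cyl_def)
    have y: "y 0 \<noteq> y 1" "y (Suc (Suc n)) = y 0" using 3(1,2) n eq[of 0] eq[of 1] eq[of "Suc (Suc n)"] by auto
    let ?lx = "LEAST n. x (Suc (Suc n)) = x 0" and ?ly = "LEAST n. y (Suc (Suc n)) = y 0"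
    have lx: "?lx \<le> n" "x (Suc (Suc ?lx)) = x 0" using n(2) by (rule Least_le, rule LeastI)
    have ly: "?ly \<le> n" "y (Suc (Suc ?ly)) = y 0" using y(2) by (rule Least_le, rule LeastI)
    have "?ly \<le> ?lx" using lx eq[of 0] eq[of "Suc (Suc ?lx)"] n(1) 3(1) by (intro Least_le) auto
    moreover have "?lx \<le> ?ly" using ly eq[of 0] eq[of "Suc (Suc ?ly)"] n(1) 3(1) by (intro Least_le) auto
    ultimately have "?lx = ?ly" by simp
    moreover have "\<exists>n. x (Suc (Suc n)) = x 0" "\<exists>n. y (Suc (Suc n)) = y 0" using n(2) y(2) by blast+
    ultimately have "osc_H x = osc_H y" unfolding osc_H_def using 3(1,2) y(1) eq[of 0] by simp
    then show ?thesis by simp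
  next
    case 4
    have eq: "x m = y m" if "m < k" for m using assms that by (simp add: same_cyl_def)
    have "osc_H x \<le> 2 * (1/2) ^ k" by (rule osc_H_le) (use 4 in auto)
    moreover have "osc_H y \<le> 2 * (1/2) ^ k"
    proof (rule osc_H_le)
      show "y 0 \<noteq> y 1" using 4 eq[of 0] eq[of 1] by auto
      show "y (Suc (Suc n)) \<noteq> y 0" if "Suc (Suc n) < k" for n
        using 4(3)[OF that] eq[OF that] eq[of 0] 4(1) by auto
    qed
    ultimately show ?thesis by (rule half)
  qed
qed

lemma osc_H_dS: "\<bar>osc_H x - osc_H y\<bar> \<le> 2 * dS x y"
proof (cases "x = y")
  case False
  then have "same_cyl (LEAST i. x i \<noteq> y i) x y"
    by (auto simp: same_cyl_def dest: not_less_Least)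
  from osc_H_lipschitz[OF this] show ?thesis using False by (simp add: dS_def)
qed (simp add: dS_def)

lemma half_power_lim: "(\<lambda>k. C * (1/2::real) ^ k) \<longlonglongrightarrow> 0"
proof -
  have "(\<lambda>k. C * (1/2::real) ^ k) \<longlonglongrightarrow> C * 0" by (intro tendsto_intros LIMSEQ_power_zero) simp
  then show ?thesis by simp
qed

lemma contS_osc_H: "contS osc_H"
  unfolding contS_iff_cyl_uc cyl_uc_def
proof (intro allI impI)
  fix e :: real assume "0 < e"
  then have "\<forall>\<^sub>F k in sequentially. 2 * (1/2::real) ^ k < e" by (intro order_tendstoD[OF half_power_lim])
  then obtain k where k: "2 * (1/2::real) ^ k < e" by (auto simp: eventually_sequentially)
  show "\<exists>n. \<forall>x y. same_cyl n x y \<longrightarrow> \<bar>osc_H x - osc_H y\<bar> < e"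
    using osc_H_lipschitz k by (meson order_le_less_trans)
qed

lemma summable_half_power: "summable (\<lambda>n. C * (1/2::real) ^ n)"
  by (intro summable_mult summable_geometric) simp

lemma osc_b_summable_osc: "summable_osc (osc_b i)"
proof -
  have d: "\<bar>osc_b i k - osc_b i (k + n)\<bar> \<le> (1/2) ^ k" for k n
  proof -
    have "osc_b i (k + n) \<le> (1/2) ^ (k + n)" by (rule osc_b_le)
    also have "\<dots> \<le> (1/2::real) ^ k" by (intro power_decreasing) auto
    finally show ?thesis using osc_b_le[of i k] osc_b_pos[of i k] osc_b_pos[of i "k + n"] by linarith
  qed
  have bdd: "bdd_above (range (\<lambda>n. \<bar>osc_b i k - osc_b i (k + n)\<bar>))" for k
    using d by (intro bdd_aboveI[of _ "(1/2) ^ k"]) auto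
  have "summable (\<lambda>k. SUP n. \<bar>osc_b i (Suc k) - osc_b i (Suc k + n)\<bar>)"
  proof (rule summable_comparison_test'[OF summable_half_power[of 1]])
    fix k :: nat
    have "(SUP n. \<bar>osc_b i (Suc k) - osc_b i (Suc k + n)\<bar>) \<le> (1/2) ^ Suc k"
      using d by (intro cSUP_least UNIV_not_empty)
    moreover have "0 \<le> (SUP n. \<bar>osc_b i (Suc k) - osc_b i (Suc k + n)\<bar>)"
      by (rule order_trans[OF _ cSUP_upper[OF UNIV_I[of 0] bdd]]) simp
    moreover have "(1/2::real) ^ Suc k \<le> (1/2) ^ k" by simp
    ultimately show "norm (SUP n. \<bar>osc_b i (Suc k) - osc_b i (Suc k + n)\<bar>) \<le> 1 * (1/2) ^ k"
      unfolding real_norm_def mult_1 by linarith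
  qed
  then show ?thesis using bdd by (simp add: summable_osc_def)
qed

lemma osc_H_summable_variation: "summable_variation osc_H"
  unfolding summable_variation_def
proof (rule summable_comparison_test'[OF summable_half_power[of 2]])
  fix n :: nat
  let ?V = "(\<lambda>p. \<bar>osc_H (fst p) - osc_H (snd p)\<bar>) ` {(x, y). same_cyl (Suc n) x y}"
  have ne: "(zeros, zeros) \<in> {(x, y). same_cyl (Suc n) x y}" by simp
  have le: "\<bar>osc_H (fst p) - osc_H (snd p)\<bar> \<le> 2 * (1/2) ^ Suc n" if "p \<in> {(x, y). same_cyl (Suc n) x y}" for p
    using that osc_H_lipschitz[of "Suc n"] by auto
  have "var osc_H (Suc n) \<le> 2 * (1/2) ^ Suc n"
    unfolding var_def using ne le by (intro cSUP_least) blast+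
  moreover have "0 \<le> var osc_H (Suc n)"
    unfolding var_def
  proof (rule cSUP_upper2[OF _ ne])
    show "bdd_above ?V" using le by (intro bdd_aboveI[of _ "2 * (1/2) ^ Suc n"]) blast
  qed simp
  moreover have "(2::real) * (1/2) ^ Suc n \<le> 2 * (1/2) ^ n" by simp
  ultimately show "norm (var osc_H (Suc n)) \<le> 2 * (1/2) ^ n"
    unfolding real_norm_def by linarith
qed

lemma osc_double_well: "double_well osc_H (\<lambda>_. 0) (\<lambda>_. 0) (osc_b False) (osc_b True)"
  unfolding double_well_def
proof (intro conjI allI impI)
  show "osc_H x = 0" if "1 \<le> n" "(\<forall>i\<le>n. \<not> x i) \<and> x (Suc n)" for n x
    using that by (intro osc_H_const) auto
  show "osc_H x = 0" if "1 \<le> n" "(\<forall>i\<le>n. x i) \<and> \<not> x (Suc n)" for n x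
    using that by (intro osc_H_const) auto
  show "osc_H x = osc_b False n" if "1 \<le> n" "\<not> x 0 \<and> (\<forall>i\<in>{1..n}. x i) \<and> \<not> x (Suc n)" for n x
    using that by (intro osc_H_run) auto
  show "osc_H x = osc_b True n" if "1 \<le> n" "x 0 \<and> (\<forall>i\<in>{1..n}. \<not> x i) \<and> x (Suc n)" for n x
    using that by (intro osc_H_run) auto
qed (simp_all add: contS_osc_H osc_H_nonneg osc_H_summable_variation osc_b_summable_osc osc_b_pos)

lemma osc_b_lim: "osc_b i \<longlonglongrightarrow> 0"
proof (rule Lim_null_comparison)
  show "\<forall>\<^sub>F n in sequentially. norm (osc_b i n) \<le> 1 * (1/2) ^ n"
    using osc_b_le osc_b_pos by (auto simp: less_imp_le)
  show "(\<lambda>n. 1 * (1/2::real) ^ n) \<longlonglongrightarrow> 0" by (rule half_power_lim)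
qed

text \<open>The base 4 serves this estimate and the next one. With N = \<open>brk j\<close>, a level
  at most N gives 4^N 2^-N = 2^N \<ge> N, and a level at least 2 N gives at most 4^N 2^-(2 N) =
  1.\<close>

lemma osc_b_long:
  assumes "even j = (\<not> i)" "n \<le> brk j" shows "real (brk j) \<le> 4 ^ brk j * osc_b i n"
proof -
  have "real (brk j) \<le> 2 ^ brk j" by (simp add: of_nat_less_two_power less_imp_le)
  also have "\<dots> = 4 ^ brk j * (1/2) ^ brk j" by (simp flip: power_mult_distrib)
  also have "\<dots> \<le> 4 ^ brk j * osc_b i n"
    unfolding osc_b_def by (intro mult_left_mono power_decreasing lev_le assms) auto
  finally show ?thesis .
qed

lemma osc_b_negligible:
  assumes "brk (Suc j) \<le> lev i n" shows "4 ^ brk j * osc_b i n \<le> 1"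
proof -
  have "osc_b i n \<le> (1/2) ^ (2 * brk j)"
    unfolding osc_b_def using assms brk_double[of j] by (intro power_decreasing) auto
  also have "\<dots> = (1/4) ^ brk j" by (simp add: power_mult power2_eq_square)
  finally have "4 ^ brk j * osc_b i n \<le> 4 ^ brk j * (1/4::real) ^ brk j" by (intro mult_left_mono) auto
  then show ?thesis by (simp flip: power_mult_distrib)
qed

text \<open>
  With \<open>N = brk (Suc k)\<close>, at this \<open>\<beta>\<close> the step function of matching parity has \<open>\<beta> b_n \<ge> N\<close> up to \<open>N\<close> and
  \<open>\<beta> b_n \<le> 1\<close> beyond, while the other one is already negligible beyond the previous break point.
\<close>

definition osc_beta :: "nat \<Rightarrow> real" where "osc_beta k = 4 ^ brk (Suc k)"

lemma osc_beta_pos: "0 < osc_beta k"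
  by (simp add: osc_beta_def)

lemma brk_lim: "filterlim brk at_top sequentially"
  by (rule filterlim_at_top_mono[OF filterlim_Suc]) (auto simp: brk_ge)

lemma osc_beta_lim: "filterlim osc_beta at_top sequentially"
proof (rule filterlim_at_top_mono[OF filterlim_real_sequentially], intro always_eventually allI)
  fix k
  have "real k \<le> real (brk (Suc k))" using brk_ge[of "Suc k"] by linarith
  also have "\<dots> < 2 ^ brk (Suc k)" by (rule of_nat_less_two_power)
  also have "\<dots> \<le> osc_beta k" unfolding osc_beta_def by (rule power_mono) auto
  finally show "real k \<le> osc_beta k" by simp
qed

lemma osc_potential: "potential osc_H (\<lambda>i n. 0) osc_b (\<lambda>i. 0)"
proof -
  have "(\<lambda>i::bool. if i then (\<lambda>_::nat. 0::real) else (\<lambda>_. 0)) = (\<lambda>i n. 0)"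
    "(\<lambda>i. if i then osc_b True else osc_b False) = osc_b"
    "(\<lambda>i. if i then lim (osc_b True) else lim (osc_b False)) = (\<lambda>i. 0)"
    using limI[OF osc_b_lim] by (auto simp: fun_eq_iff)
  with double_well_potential[OF osc_double_well] show ?thesis by metis
qed

text \<open>Ensures that the convergence claim, which ranges over all families of Gibbs measures, is
  not vacuous.\<close>

lemma osc_gibbs_exists: "\<exists>\<mu>. \<forall>t>0. gibbs osc_H t (\<mu> t)"
proof -
  interpret potential osc_H "\<lambda>i n. 0" osc_b "\<lambda>i. 0" by (rule osc_potential)
  have "\<exists>\<mu>. gibbs osc_H t \<mu>" if "0 < t" for t
    using that by (intro gibbs_exists[of 2] osc_H_const osc_H_lipschitz) auto
  then show ?thesis by metis
qed

lemma osc_weak_star: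
  assumes "\<And>t. 0 < t \<Longrightarrow> gibbs osc_H t (\<mu> t)"
  shows "weak_star (\<lambda>k. \<mu> (osc_beta (2 * k))) (\<lambda>f. f zeros) sequentially"
    and "weak_star (\<lambda>k. \<mu> (osc_beta (2 * k + 1))) (\<lambda>f. f ones) sequentially"
proof -
  interpret potential osc_H "\<lambda>i n. 0" osc_b "\<lambda>i. 0" by (rule osc_potential)
  obtain z where z: "\<And>\<beta>. 0 < \<beta> \<Longrightarrow> 0 < z \<beta> \<and> z \<beta> < 1 \<and> total_weight \<beta> (z \<beta>) = 1"
    and w: "\<And>F (g :: nat \<Rightarrow> real) p. \<lbrakk>filterlim g at_top F;
        ((\<lambda>s. 1 / (mean_run False (g s) (z (g s)) + mean_run True (g s) (z (g s)))) \<longlongrightarrow> 0) F;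
        ((\<lambda>s. mean_run True (g s) (z (g s)) / (mean_run False (g s) (z (g s)) + mean_run True (g s) (z (g s)))) \<longlongrightarrow> p) F\<rbrakk>
      \<Longrightarrow> weak_star (\<lambda>s. \<mu> (g s)) (\<lambda>f. (1 - p) * f zeros + p * f ones) F"
    using gibbs_renewal_family[OF assms] by blast
  have cost: "cost i n = osc_b (\<not> i) (Suc n)" for i n by (simp add: cost_def)
  have lim: "filterlim (\<lambda>k. osc_beta (2 * k + c)) at_top sequentially" for c
    by (rule filterlim_compose[OF osc_beta_lim filterlim_subseq]) (simp add: strict_mono_def)
  \<comment> \<open>The symbol \<open>s\<close> is the one with long runs. Its costs come from
    \<open>osc_b (\<not> s)\<close>, whose steps have indices of the parity of
    \<open>Suc (r s k)\<close>; those for the other symbol have the parity of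
    \<open>r s k\<close>.\<close>
  define r where "r = (\<lambda>s k. 2 * k + (of_bool s :: nat))"
  have par: "even (r s k) = (\<not> s)" for s k by (cases s) (auto simp: r_def)
  have r_mono: "filterlim (r s) at_top sequentially" for s
    unfolding r_def by (rule filterlim_subseq) (simp add: strict_mono_def)
  note L = long_run_limits[where hL = "cost s" and hS = "cost (\<not> s)" and \<beta> = "\<lambda>k. osc_beta (r s k)"
      and z = "\<lambda>k. z (osc_beta (r s k))" and N = "\<lambda>k. brk (Suc (r s k))" and N' = "\<lambda>k. brk (r s k)" for s]
  have A1: "wsum (cost s) (osc_beta (r s k)) (z (osc_beta (r s k))) *
      wsum (cost (\<not> s)) (osc_beta (r s k)) (z (osc_beta (r s k))) = 1" for s k
    using z[OF osc_beta_pos] by (cases s) (auto simp: mult.commute)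
  have A2: "real (brk (Suc (r s k))) \<le> osc_beta (r s k) * cost s n" if "n < brk (Suc (r s k))" for s k n
    unfolding cost osc_beta_def using that par[of s k] by (intro osc_b_long) auto
  have A3: "osc_beta (r s k) * cost s n \<le> 1" if "brk (Suc (r s k)) \<le> n" for s k n
    unfolding cost osc_beta_def
  proof (rule osc_b_negligible)
    have "brk (Suc (Suc (Suc (r s k)))) \<le> lev (\<not> s) (Suc n)"
      using that par[of s k] by (intro lev_jump) auto
    then show "brk (Suc (Suc (r s k))) \<le> lev (\<not> s) (Suc n)"
      using brk_mono[of "Suc (Suc (r s k))" "Suc (Suc (Suc (r s k)))"] by simp
  qed
  have A4: "osc_beta (r s k) * cost (\<not> s) n \<le> 1" if "brk (r s k) \<le> n" for s k n
    unfolding cost osc_beta_def not_not using that par[of s k] by (intro osc_b_negligible lev_jump) auto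
  have A5: "(\<lambda>k. real (brk (r s k)) / real (brk (Suc (r s k)))) \<longlonglongrightarrow> 0" for s
  proof -
    have "real (brk j) / real (brk (Suc j)) = 1 / real (j + 2)" for j
    proof -
      have "0 < real (brk j)" using brk_ge[of j] by simp
      then show ?thesis unfolding brk_Suc of_nat_mult by (simp del: of_nat_add)
    qed
    moreover have "(\<lambda>k. 1 / real (r s k + 2)) \<longlonglongrightarrow> 0"
    proof (rule filterlim_compose[OF _ r_mono])
      show "(\<lambda>j. 1 / real (j + 2)) \<longlonglongrightarrow> 0" by real_asymp
    qed
    ultimately show ?thesis by simp
  qed
  have A6: "filterlim (\<lambda>k. brk (Suc (r s k))) at_top sequentially" for s
    by (rule filterlim_compose[OF brk_lim filterlim_compose[OF filterlim_Suc r_mono]])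
  have A7: "filterlim (\<lambda>k. osc_beta (r s k)) at_top sequentially" for s
    by (rule filterlim_compose[OF osc_beta_lim r_mono])
  have A8: "0 < z (osc_beta (r s k))" "z (osc_beta (r s k)) < 1" for s k
    using z[OF osc_beta_pos] by auto
  note LL = L[OF cost_pos cost_pos osc_beta_pos A7 A8 A1 A2 A3 A4 brk_mono[OF le_SucI[OF order_refl]] A6 A5]
  have "weak_star (\<lambda>k. \<mu> (osc_beta (r False k))) (\<lambda>f. (1 - 0) * f zeros + 0 * f ones) sequentially"
    by (rule w[OF A7]) (use LL(1,2)[of False] in simp_all)
  then show "weak_star (\<lambda>k. \<mu> (osc_beta (2 * k))) (\<lambda>f. f zeros) sequentially" by (simp add: r_def)
  have "weak_star (\<lambda>k. \<mu> (osc_beta (r True k))) (\<lambda>f. (1 - 1) * f zeros + 1 * f ones) sequentially"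
    by (rule w[OF A7]) (use LL(1,3)[of True] in \<open>simp_all add: add.commute\<close>)
  then show "weak_star (\<lambda>k. \<mu> (osc_beta (2 * k + 1))) (\<lambda>f. f ones) sequentially" by (simp add: r_def)
qed

lemma osc_Hinf: "Hinf (osc_b i) (\<lambda>_. 0) = 0"
  using limI[OF osc_b_lim[of i]] by (simp add: Hinf_def)

theorem theorem1p2:
  shows
  "(\<forall>H a0 a1 b0 b1 \<mu>.
      double_well H a0 a1 b0 b1 \<and> Hinf b0 a1 \<le> Hinf b1 a0 \<and>
      (\<forall>\<beta>>0. gibbs H \<beta> (\<mu> \<beta>)) \<and>
      (Hinf b1 a0 + Hinf b0 a1) / 2 > Hmin b1 a0 + Hinf b0 a1
      \<longrightarrow> weak_star \<mu> (\<lambda>f. f ones) at_top)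
   \<and>
   (\<forall>H a0 a1 b0 b1 \<mu>.
      double_well H a0 a1 b0 b1 \<and> Hinf b0 a1 \<le> Hinf b1 a0 \<and>
      (\<forall>\<beta>>0. gibbs H \<beta> (\<mu> \<beta>)) \<and>
      Hmin b1 a0 + Hinf b0 a1 \<ge> (Hinf b1 a0 + Hinf b0 a1) / 2 \<and>
      (Hinf b1 a0 + Hinf b0 a1) / 2 > 0
      \<longrightarrow> (let c = cnum (kappa a0 a1 b0 b1) in
           weak_star \<mu> (\<lambda>f. 1 / (1 + c\<^sup>2) * f zeros + c\<^sup>2 / (1 + c\<^sup>2) * f ones) at_top))
   \<and>
   (\<exists>H a0 a1 b0 b1.
      double_well H a0 a1 b0 b1 \<and>
      (\<forall>n\<ge>1. a0 n = 0 \<and> a1 n = 0) \<and> Hinf b0 a1 = 0 \<and> Hinf b1 a0 = 0 \<and>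
      (\<exists>L. \<forall>x y. \<bar>H x - H y\<bar> \<le> L * dS x y) \<and>
      (\<exists>\<beta>::nat \<Rightarrow> real. (\<forall>k. 0 < \<beta> k) \<and> filterlim \<beta> at_top sequentially \<and>
         (\<exists>\<mu>. \<forall>t>0. gibbs H t (\<mu> t)) \<and>
         (\<forall>\<mu>. (\<forall>t>0. gibbs H t (\<mu> t)) \<longrightarrow>
            weak_star (\<lambda>k. \<mu> (\<beta> (2 * k))) (\<lambda>f. f zeros) sequentially \<and>
            weak_star (\<lambda>k. \<mu> (\<beta> (2 * k + 1))) (\<lambda>f. f ones) sequentially)))"
  (is "?P1 \<and> ?P2 \<and> ?P3")
proof (intro conjI)
  show ?P1 using double_well_weak_star(1) by blast
  show ?P2 unfolding Let_def using double_well_weak_star(2)[OF _ _ _ _ _ refl] by blast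
  show ?P3
  proof (intro exI conjI)
    show "double_well osc_H (\<lambda>_. 0) (\<lambda>_. 0) (osc_b False) (osc_b True)" by (rule osc_double_well)
    show "\<forall>x y. \<bar>osc_H x - osc_H y\<bar> \<le> 2 * dS x y" using osc_H_dS by blast
    show "\<forall>k. 0 < osc_beta k" by (simp add: osc_beta_pos)
    show "\<forall>t>0. gibbs osc_H t ((SOME \<mu>. \<forall>t>0. gibbs osc_H t (\<mu> t)) t)"
      using someI_ex[OF osc_gibbs_exists] .
    show "\<forall>\<mu>. (\<forall>t>0. gibbs osc_H t (\<mu> t)) \<longrightarrow>
            weak_star (\<lambda>k. \<mu> (osc_beta (2 * k))) (\<lambda>f. f zeros) sequentially \<and>
            weak_star (\<lambda>k. \<mu> (osc_beta (2 * k + 1))) (\<lambda>f. f ones) sequentially"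
      using osc_weak_star by blast
  qed (simp_all add: osc_Hinf osc_beta_lim)
qed

end
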